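(* Let $\theta\in H^\infty$ be inner, let $\phi,\psi\in L^\infty$ be unimodular with $\phi K_\theta\perp\psi K_\theta$ and such that neither $\phi\overline\psi$ nor $\overline\phi\psi$ is a constant multiple of $\theta$, and let $M=\phi K_\theta\oplus\psi K_\theta$. Suppose that the symbol $$\Phi:=\begin{pmatrix} g & \overline\phi\psi g \\ \overline\psi\phi g & g \end{pmatrix}$$ is in $(H^\infty)^{2\times2}$. Then $$\|T^M_g\|=\|W\|=\operatorname{dist}\bigl(\overline\theta\Phi,(H^\infty)^{2\times2}\bigr)=\|\Gamma_{\overline\theta\Phi}\|,$$ where $W=\begin{pmatrix} A^\theta_g & A^\theta_{\overline\phi\psi g} \\ A^\theta_{\overline\psi\phi g} & A^\theta_g \end{pmatrix}$ on $K_\theta\oplus K_\theta$ and the vectorial Hankel operator $\Gamma_{\overline\theta\Phi}:(H^2)^2\to(L^2\ominus H^2)^2$ is defined by $\Gamma_{\overline\theta\Phi}v=P_{(L^2\ominus H^2)^2}(\overline\theta\Phi v)$.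
   Context: All function spaces are on the unit circle $\mathbb T$; $H^2,H^\infty$ are the Hardy spaces of the unit disc. For $\theta$ inner, $K_\theta=H^2\ominus\theta H^2$, and $P_\theta$ is the orthogonal projection from $L^2=L^2(\mathbb T)$ onto $K_\theta$; $A^\theta_hf=P_\theta(hf)$ for $f\in K_\theta$, $h\in L^\infty$. $M=\phi K_\theta\oplus\psi K_\theta$ (orthogonal sum) is a closed subspace of $L^2$ with orthogonal projection $P_M$, and $T^M_gf=P_M(gf)$ for $f\in M$. The distance is in the space $L^\infty(M_2(\mathbb C))$ of essentially bounded $2\times2$ matrix functions, with norm the essential supremum of the pointwise operator norm on $\mathbb C^2$; $P_{(L^2\ominus H^2)^2}$ is the orthogonal projection of $(L^2)^2$ onto $(L^2\ominus H^2)^2$. *)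

theory Defs
  imports "HOL-Probability.Probability"
begin

text \<open>
  Elements of the function spaces on the unit circle are represented by functions
  \<open>complex \<Rightarrow> 'a\<close> that are Borel measurable for normalized arc length. This measure is
  concentrated on the circle, so values elsewhere are irrelevant. Functions are not
  identified when they agree almost everywhere; norms and inner products do not see
  the choice of representative.
\<close>

definition circle :: "complex measure" where
  "circle = distr (uniform_measure lborel {0..2 * pi}) borel cis"

definition L2 :: "(complex \<Rightarrow> complex) set" where
  "L2 = {f \<in> borel_measurable circle. integrable circle (\<lambda>z. (cmod (f z))\<^sup>2)}"

definition Linf :: "(complex \<Rightarrow> complex) set" where
  "Linf = {h \<in> borel_measurable circle. \<exists>C::real. AE z in circle. cmod (h z) \<le> C}"

definition fourier_coeff :: "(complex \<Rightarrow> complex) \<Rightarrow> int \<Rightarrow> complex" where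
  "fourier_coeff f n = (\<integral>z. f z * z powi (- n) \<partial>circle)"

text \<open>
  The Hardy spaces of the disc, identified via boundary values with the functions on
  the circle whose Fourier coefficients of negative index vanish.
\<close>

definition H2 :: "(complex \<Rightarrow> complex) set" where
  "H2 = {f \<in> L2. \<forall>n<0. fourier_coeff f n = 0}"

definition Hinf :: "(complex \<Rightarrow> complex) set" where
  "Hinf = {f \<in> Linf. \<forall>n<0. fourier_coeff f n = 0}"

definition unimodular :: "(complex \<Rightarrow> complex) \<Rightarrow> bool" where
  "unimodular u \<longleftrightarrow> (AE z in circle. cmod (u z) = 1)"

definition inner_function :: "(complex \<Rightarrow> complex) \<Rightarrow> bool" where
  "inner_function \<theta> \<longleftrightarrow> \<theta> \<in> Hinf \<and> unimodular \<theta>"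

definition L2_norm :: "(complex \<Rightarrow> 'a::real_normed_vector) \<Rightarrow> real" where
  "L2_norm f = sqrt (\<integral>z. (norm (f z))\<^sup>2 \<partial>circle)"

definition L2_inner :: "(complex \<Rightarrow> complex) \<Rightarrow> (complex \<Rightarrow> complex) \<Rightarrow> complex" where
  "L2_inner f h = (\<integral>z. f z * cnj (h z) \<partial>circle)"

definition L2_vec_inner ::
  "(complex \<Rightarrow> complex^'n) \<Rightarrow> (complex \<Rightarrow> complex^'n) \<Rightarrow> complex" where
  "L2_vec_inner v w = (\<Sum>i\<in>UNIV. L2_inner (\<lambda>z. v z $ i) (\<lambda>z. w z $ i))"

definition L2_orthogonal :: "(complex \<Rightarrow> complex) set \<Rightarrow> (complex \<Rightarrow> complex) set \<Rightarrow> bool" where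
  "L2_orthogonal S R \<longleftrightarrow> (\<forall>f\<in>S. \<forall>h\<in>R. L2_inner f h = 0)"

definition L2_ominus ::
  "(complex \<Rightarrow> complex) set \<Rightarrow> (complex \<Rightarrow> complex) set \<Rightarrow> (complex \<Rightarrow> complex) set"
  (infixl "\<ominus>\<^sub>L" 65) where
  "S \<ominus>\<^sub>L R = {f \<in> S. \<forall>h\<in>R. L2_inner f h = 0}"

definition mult_space ::
  "(complex \<Rightarrow> complex) \<Rightarrow> (complex \<Rightarrow> complex) set \<Rightarrow> (complex \<Rightarrow> complex) set" where
  "mult_space u S = (\<lambda>f z. u z * f z) ` S"

definition sum_space ::
  "(complex \<Rightarrow> complex) set \<Rightarrow> (complex \<Rightarrow> complex) set \<Rightarrow> (complex \<Rightarrow> complex) set" where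
  "sum_space S R = {\<lambda>z. f z + h z |f h. f \<in> S \<and> h \<in> R}"

text \<open>The direct sum of copies of \<open>S\<close>, one for each coordinate.\<close>

definition vec_space :: "(complex \<Rightarrow> complex) set \<Rightarrow> (complex \<Rightarrow> complex^'n) set" where
  "vec_space S = {v. \<forall>i. (\<lambda>z. v z $ i) \<in> S}"

definition mat_space :: "(complex \<Rightarrow> complex) set \<Rightarrow> (complex \<Rightarrow> complex^'n^'m) set" where
  "mat_space S = {F. \<forall>i j. (\<lambda>z. F z $ i $ j) \<in> S}"

text \<open>
  The orthogonal projection onto \<open>S\<close> with respect to the inner product \<open>ip\<close>. For a closed
  subspace \<open>S\<close> its value is determined up to equality almost everywhere, and \<open>SOME\<close> picks
  a representative.
\<close>

definition orth_proj ::
  "((complex \<Rightarrow> 'a::minus) \<Rightarrow> (complex \<Rightarrow> 'a) \<Rightarrow> complex) \<Rightarrow> (complex \<Rightarrow> 'a) set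
    \<Rightarrow> (complex \<Rightarrow> 'a) \<Rightarrow> (complex \<Rightarrow> 'a)" where
  "orth_proj ip S f = (SOME p. p \<in> S \<and> (\<forall>s\<in>S. ip (\<lambda>z. f z - p z) s = 0))"

text \<open>
  The norm of an operator with domain \<open>S\<close>, as an extended real so that the supremum
  is meaningful without a boundedness proof.
\<close>

definition op_norm ::
  "(complex \<Rightarrow> 'a::real_normed_vector) set
    \<Rightarrow> ((complex \<Rightarrow> 'a) \<Rightarrow> (complex \<Rightarrow> 'b::real_normed_vector)) \<Rightarrow> ereal" where
  "op_norm S T = (SUP f\<in>{f \<in> S. L2_norm f \<le> 1}. ereal (L2_norm (T f)))"

definition model_space :: "(complex \<Rightarrow> complex) \<Rightarrow> (complex \<Rightarrow> complex) set" where
  "model_space \<theta> = H2 \<ominus>\<^sub>L mult_space \<theta> H2"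

definition compressed_mult ::
  "(complex \<Rightarrow> complex) set \<Rightarrow> (complex \<Rightarrow> complex) \<Rightarrow> (complex \<Rightarrow> complex) \<Rightarrow> (complex \<Rightarrow> complex)"
  where
  "compressed_mult S h f = orth_proj L2_inner S (\<lambda>z. h z * f z)"

abbreviation truncated_toeplitz ::
  "(complex \<Rightarrow> complex) \<Rightarrow> (complex \<Rightarrow> complex) \<Rightarrow> (complex \<Rightarrow> complex) \<Rightarrow> (complex \<Rightarrow> complex)"
  where
  "truncated_toeplitz \<theta> h \<equiv> compressed_mult (model_space \<theta>) h"

definition block_operator ::
  "((complex \<Rightarrow> complex) \<Rightarrow> (complex \<Rightarrow> complex)) \<Rightarrow> ((complex \<Rightarrow> complex) \<Rightarrow> (complex \<Rightarrow> complex))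
    \<Rightarrow> ((complex \<Rightarrow> complex) \<Rightarrow> (complex \<Rightarrow> complex)) \<Rightarrow> ((complex \<Rightarrow> complex) \<Rightarrow> (complex \<Rightarrow> complex))
    \<Rightarrow> (complex \<Rightarrow> complex^2) \<Rightarrow> (complex \<Rightarrow> complex^2)" where
  "block_operator A B C D v =
    (\<lambda>z. vector [A (\<lambda>w. v w $ 1) z + B (\<lambda>w. v w $ 2) z,
                 C (\<lambda>w. v w $ 1) z + D (\<lambda>w. v w $ 2) z])"

definition matrix_symbol ::
  "(complex \<Rightarrow> complex) \<Rightarrow> (complex \<Rightarrow> complex) \<Rightarrow> (complex \<Rightarrow> complex) \<Rightarrow> complex \<Rightarrow> complex^2^2"
  where
  "matrix_symbol \<phi> \<psi> g z =
    vector [vector [g z,                       cnj (\<phi> z) * \<psi> z * g z],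
            vector [cnj (\<psi> z) * \<phi> z * g z,  g z]]"

definition scale_matrix ::
  "(complex \<Rightarrow> complex) \<Rightarrow> (complex \<Rightarrow> complex^'n^'m) \<Rightarrow> complex \<Rightarrow> complex^'n^'m" where
  "scale_matrix u F z = (\<chi> i j. u z * F z $ i $ j)"

definition Linf_mat_norm :: "(complex \<Rightarrow> complex^'n^'m) \<Rightarrow> ereal" where
  "Linf_mat_norm F = esssup circle (\<lambda>z. ereal (onorm (\<lambda>x. F z *v x)))"

definition Linf_mat_dist ::
  "(complex \<Rightarrow> complex^'n^'m) \<Rightarrow> (complex \<Rightarrow> complex^'n^'m) set \<Rightarrow> ereal" where
  "Linf_mat_dist F S = (INF G\<in>S. Linf_mat_norm (\<lambda>z. F z - G z))"

definition hankel ::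
  "(complex \<Rightarrow> complex^'n^'n) \<Rightarrow> (complex \<Rightarrow> complex^'n) \<Rightarrow> (complex \<Rightarrow> complex^'n)" where
  "hankel F v = orth_proj L2_vec_inner (vec_space (L2 \<ominus>\<^sub>L H2)) (\<lambda>z. F z *v v z)"

end

(*
  The operator T is unitarily equivalent to W, and W is unitarily equivalent to the restriction of
  the Hankel operator to the model space, because P_theta u = theta P_-(conj theta u) for u in H2
  and the Hankel operator annihilates theta (H2)^2. It remains to prove the matrix Nehari theorem.
  For this the Fourier coefficients of the best approximant are chosen one after another: by
  Parrott's lemma a one-step extension of a block Hankel matrix keeps its norm, so the matrix of
  negative coefficients extends to a block Laurent matrix of the same norm, and the norm of a block
  Laurent matrix is the essential supremum of its symbol.
*)
theory Submission
  imports Defs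
begin

section \<open>Parrott completion of matrices\<close>

text \<open>Parrott's lemma is usually proved with square roots and contractive factorizations of
  operators. Here an infinite matrix is bounded when all its finite sections are
  (\<open>matrix_bound\<close>), so no operators on sequence spaces occur. One missing scalar in a
  finite section is supplied by a near-minimizer of a quadratic form, at the price of a slightly
  larger bound; compactness of a disc removes both the finiteness and the slack.

  The symbol belonging to a completed Laurent matrix is at the start only square integrable, so its
  pointwise bound is extracted from integrals against squared moduli of trigonometric polynomials.
  This positivity test also gives uniqueness of Fourier coefficients, on which Parseval's inequality
  and the calculus of analytic functions rest.

  Since functions are not identified almost everywhere, projections are handled through the relation
  \<open>is_orth_proj\<close>, and operators are compared through norms of images rather than
  through identities.\<close>

lemma sum_cmod_add_mult_square:
  fixes a b :: "'i \<Rightarrow> complex"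
  shows "(\<Sum>i\<in>A. (cmod (a i + t * b i))\<^sup>2)
    = (\<Sum>i\<in>A. (cmod (a i))\<^sup>2) + 2 * Re (cnj t * (\<Sum>i\<in>A. a i * cnj (b i)))
      + (cmod t)\<^sup>2 * (\<Sum>i\<in>A. (cmod (b i))\<^sup>2)"
proof -
  have "(cmod (a i + t * b i))\<^sup>2 = (cmod (a i))\<^sup>2 + 2 * Re (cnj t * (a i * cnj (b i)))
      + (cmod t)\<^sup>2 * (cmod (b i))\<^sup>2" for i
    unfolding cmod_power2 by (simp add: power2_eq_square algebra_simps)
  then show ?thesis
    by (simp add: sum.distrib sum_distrib_left Re_sum)
qed

text \<open>The unknown corner \<open>c\<close> is the value of the new row at \<open>j\<close>, so
  choosing it amounts to prescribing the row on one vector \<open>w\<close> with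
  \<open>w j = 1\<close>. Taking \<open>w\<close> almost minimal for the defect form
  \<open>q\<close> makes it almost \<open>q\<close>-orthogonal to the vectors supported on
  \<open>B\<close>, on which the row is already controlled. The gap between \<open>\<rho>\<close>
  and \<open>\<rho>'\<close> makes the form definite and absorbs the error.\<close>

lemma parrott_finite_strict:
  fixes T :: "'r \<Rightarrow> 'c \<Rightarrow> complex"
  assumes fin: "finite B" and j: "j \<notin> B"
    and column: "\<And>x. (\<Sum>r\<in>A. (cmod (\<Sum>k\<in>insert j B. T r k * x k))\<^sup>2)
                  \<le> \<rho>\<^sup>2 * (\<Sum>k\<in>insert j B. (cmod (x k))\<^sup>2)"
    and row: "\<And>x. (\<Sum>r\<in>A. (cmod (\<Sum>k\<in>B. T r k * x k))\<^sup>2) + (cmod (\<Sum>k\<in>B. u k * x k))\<^sup>2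
                  \<le> \<rho>\<^sup>2 * (\<Sum>k\<in>B. (cmod (x k))\<^sup>2)"
    and \<rho>: "0 \<le> \<rho>" "\<rho> < \<rho>'"
  shows "\<exists>c. \<forall>x. (\<Sum>r\<in>A. (cmod (\<Sum>k\<in>insert j B. T r k * x k))\<^sup>2)
      + (cmod (c * x j + (\<Sum>k\<in>B. u k * x k)))\<^sup>2
    \<le> \<rho>'\<^sup>2 * (\<Sum>k\<in>insert j B. (cmod (x k))\<^sup>2)"
proof -
  define N where "N x = (\<Sum>k\<in>insert j B. (cmod (x k))\<^sup>2)" for x :: "'c \<Rightarrow> complex"
  define S where "S x r = (\<Sum>k\<in>insert j B. T r k * x k)" for x r
  define L where "L x = (\<Sum>k\<in>B. u k * x k)" for x
  \<comment> \<open>The defect form of the rows in \<open>A\<close> at level \<open>\<rho>'\<close>,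
    with polarization \<open>b\<close>. The completed matrix has the required bound exactly when the
    squared new row is dominated by \<open>q\<close>.\<close>
  define q where "q x = \<rho>'\<^sup>2 * N x - (\<Sum>r\<in>A. (cmod (S x r))\<^sup>2)" for x
  define b where "b x y = of_real (\<rho>'\<^sup>2) * (\<Sum>k\<in>insert j B. x k * cnj (y k))
      - (\<Sum>r\<in>A. S x r * cnj (S y r))" for x y
  define \<delta> where "\<delta> = \<rho>'\<^sup>2 - \<rho>\<^sup>2"
  have \<delta>: "\<delta> > 0"
    using \<rho> by (simp add: \<delta>_def power_strict_mono)
  have N_nonneg: "0 \<le> N x" for x
    by (simp add: N_def sum_nonneg)
  have S_add: "S (\<lambda>k. x k + t * y k) r = S x r + t * S y r" for x y t r
    by (simp add: S_def sum.distrib sum_distrib_left algebra_simps)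
  have L_add: "L (\<lambda>k. x k + t * y k) = L x + t * L y" for x y t
    by (simp add: L_def sum.distrib sum_distrib_left algebra_simps)
  have q_add: "q (\<lambda>k. x k + t * y k) = q x + 2 * Re (cnj t * b x y) + (cmod t)\<^sup>2 * q y" for x y t
  proof -
    have "Re (cnj t * (complex_of_real (\<rho>'\<^sup>2) * z - w))
        = \<rho>'\<^sup>2 * Re (cnj t * z) - Re (cnj t * w)" for z w
      by (simp add: algebra_simps)
    then show ?thesis
      unfolding q_def b_def N_def S_add sum_cmod_add_mult_square
      by (simp add: algebra_simps)
  qed
  have q_lower: "\<delta> * N x \<le> q x" for x
    using column[of x] by (simp add: q_def N_def S_def \<delta>_def algebra_simps)
  have q_upper: "q x \<le> \<rho>'\<^sup>2 * N x" for x
    by (simp add: q_def sum_nonneg)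
  define Q where "Q = {q x |x. x j = 1}"
  \<comment> \<open>The tolerance satisfies
    \<open>\<epsilon> * \<rho>'\<^sup>2 = \<delta>\<^sup>2\<close>, which turns near-minimality of
    \<open>w\<close> into the bound \<open>b_bound\<close>.\<close>
  define \<epsilon> where "\<epsilon> = (\<delta> / \<rho>')\<^sup>2"
  have \<epsilon>: "\<epsilon> > 0"
    using \<delta> \<rho> by (simp add: \<epsilon>_def)
  have Q_ne: "Q \<noteq> {}"
    by (auto simp: Q_def intro: exI[of _ "\<lambda>k. 1"])
  have q_nonneg: "0 \<le> q x" for x
    using q_lower[of x] N_nonneg[of x] \<delta> by (smt (verit) mult_nonneg_nonneg)
  have "bdd_below Q"
    using q_nonneg by (intro bdd_belowI[of _ 0]) (auto simp: Q_def)
  have "\<exists>v\<in>Q. v < Inf Q + \<epsilon>"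
    using cInf_lessD[OF Q_ne, of "Inf Q + \<epsilon>"] \<epsilon> by auto
  then obtain w where w: "w j = 1" "q w < Inf Q + \<epsilon>"
    by (auto simp: Q_def)
  have w_min: "q w \<le> q x + \<epsilon>" if "x j = 1" for x
    using cInf_lower[OF _ \<open>bdd_below Q\<close>, of "q x"] w that by (force simp: Q_def)
  have b_bound: "cmod (b f w) \<le> \<delta> * sqrt (N f)" if f: "f j = 0" for f
  proof -
    have b_sym: "b w f = cnj (b f w)"
      by (simp add: b_def mult.commute)
    have "(cmod (b w f))\<^sup>2 \<le> \<epsilon> * q f"
    proof (cases "q f = 0")
      case True
      then have "N f = 0"
        using q_lower[of f] N_nonneg[of f] \<delta> by (simp add: mult_le_0_iff)
      then have "\<forall>k\<in>insert j B. f k = 0"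
        using fin by (auto simp: N_def sum_nonneg_eq_0_iff add_nonneg_eq_0_iff sum_nonneg j)
      then show ?thesis
        using True fin j by (simp add: b_def S_def)
    next
      case False
      then have qf: "q f > 0"
        using q_nonneg[of f] by simp
      \<comment> \<open>This is the minimizer of \<open>q\<close> on the line through
        \<open>w\<close> in direction \<open>f\<close>. The line stays in the hyperplane
        \<open>x j = 1\<close>, so the value of \<open>q\<close> can drop by at most
        \<open>\<epsilon>\<close>.\<close>
      define t where "t = - b w f / of_real (q f)"
      have "cnj t * b w f = of_real (- (cmod (b w f))\<^sup>2 / q f)"
        unfolding t_def by (simp add: complex_norm_square[symmetric] mult.commute)
      then have "Re (cnj t * b w f) = - (cmod (b w f))\<^sup>2 / q f"
        by simp
      moreover have "(cmod t)\<^sup>2 * q f = (cmod (b w f))\<^sup>2 / q f"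
        using qf by (simp add: t_def norm_divide power_divide power2_eq_square)
      ultimately have "q (\<lambda>k. w k + t * f k) = q w - (cmod (b w f))\<^sup>2 / q f"
        by (simp add: q_add)
      then have "(cmod (b w f))\<^sup>2 / q f \<le> \<epsilon>"
        using w_min[of "\<lambda>k. w k + t * f k"] w f by simp
      then show ?thesis
        using qf by (simp add: pos_divide_le_eq)
    qed
    also have "\<dots> \<le> \<epsilon> * (\<rho>'\<^sup>2 * N f)"
      using q_upper \<epsilon> by simp
    also have "\<dots> = (\<delta> * sqrt (N f))\<^sup>2"
      using \<rho> N_nonneg by (simp add: \<epsilon>_def power_divide power_mult_distrib)
    finally have "cmod (b w f) \<le> \<delta> * sqrt (N f)"
      by (rule power2_le_imp_le) (use \<delta> N_nonneg in simp)
    then show ?thesis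
      by (simp add: b_sym)
  qed
  \<comment> \<open>With this choice the new row annihilates \<open>w\<close>, so it only sees the component \<open>f\<close> of \<open>x\<close>
    that is almost \<open>q\<close>-orthogonal to \<open>w\<close>.\<close>
  define c where "c = - L w"
  have "(\<Sum>r\<in>A. (cmod (S x r))\<^sup>2) + (cmod (c * x j + L x))\<^sup>2 \<le> \<rho>'\<^sup>2 * N x" for x
  proof -
    define \<alpha> where "\<alpha> = x j"
    define f where "f k = x k + (- \<alpha>) * w k" for k
    have f: "f j = 0"
      by (simp add: f_def \<alpha>_def w)
    have x: "x = (\<lambda>k. f k + \<alpha> * w k)"
      by (auto simp: f_def)
    have Lf: "c * x j + L x = L f"
      unfolding f_def L_add by (simp add: c_def \<alpha>_def)
    have "S f r = (\<Sum>k\<in>B. T r k * f k)" for r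
      using fin j f by (simp add: S_def)
    moreover have "N f = (\<Sum>k\<in>B. (cmod (f k))\<^sup>2)"
      using fin j f by (simp add: N_def)
    ultimately have "(\<Sum>r\<in>A. (cmod (S f r))\<^sup>2) + (cmod (L f))\<^sup>2 \<le> \<rho>\<^sup>2 * N f"
      using row[of f] by (simp add: L_def)
    then have f_row: "\<delta> * N f \<le> q f - (cmod (L f))\<^sup>2"
      by (simp add: q_def \<delta>_def algebra_simps)
    have "1 \<le> N w"
      using fin j w by (simp add: N_def sum_nonneg)
    then have "\<delta> * 1 \<le> \<delta> * N w"
      using \<delta> by (intro mult_left_mono) auto
    then have qw: "\<delta> \<le> q w"
      using q_lower[of w] by linarith
    have "- Re (cnj \<alpha> * b f w) \<le> cmod \<alpha> * cmod (b f w)"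
      using complex_Re_le_cmod[of "- (cnj \<alpha> * b f w)"] by (simp add: norm_mult)
    also have "\<dots> \<le> cmod \<alpha> * (\<delta> * sqrt (N f))"
      by (intro mult_left_mono b_bound f) auto
    finally have cross: "- Re (cnj \<alpha> * b f w) \<le> \<delta> * (cmod \<alpha> * sqrt (N f))"
      by (simp add: algebra_simps)
    \<comment> \<open>The cross term costs at most
      \<open>2 * \<delta> * cmod \<alpha> * sqrt (N f)\<close>. The reserve
      \<open>\<delta> * N f\<close> from the row bound and the reserve
      \<open>\<delta> * (cmod \<alpha>)\<^sup>2\<close> from \<open>qw\<close> complete it to a
      square.\<close>
    have "0 \<le> (cmod \<alpha> - sqrt (N f))\<^sup>2"
      by simp
    then have "2 * (cmod \<alpha> * sqrt (N f)) \<le> (cmod \<alpha>)\<^sup>2 + N f"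
      using N_nonneg[of f] by (simp add: power2_diff)
    then have "\<delta> * (2 * (cmod \<alpha> * sqrt (N f))) \<le> \<delta> * ((cmod \<alpha>)\<^sup>2 + N f)"
      using \<delta> by (intro mult_left_mono) auto
    moreover have "(cmod \<alpha>)\<^sup>2 * \<delta> \<le> (cmod \<alpha>)\<^sup>2 * q w"
      using qw by (intro mult_left_mono) auto
    moreover have "q x = q f + 2 * Re (cnj \<alpha> * b f w) + (cmod \<alpha>)\<^sup>2 * q w"
      by (subst x) (rule q_add)
    ultimately have "(cmod (L f))\<^sup>2 \<le> q x"
      using f_row cross by (simp add: algebra_simps)
    then show ?thesis
      by (simp add: Lf q_def)
  qed
  then show ?thesis
    unfolding S_def L_def N_def by blast
qed

section \<open>Bounds on infinite matrices and passage from finite sections\<close>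

definition matrix_bound :: "('r \<Rightarrow> 'c \<Rightarrow> complex) \<Rightarrow> real \<Rightarrow> 'r set \<Rightarrow> 'c set \<Rightarrow> bool" where
  "matrix_bound T \<rho> I J \<longleftrightarrow> (\<forall>A B x. finite A \<and> A \<subseteq> I \<and> finite B \<and> B \<subseteq> J \<longrightarrow>
    (\<Sum>r\<in>A. (cmod (\<Sum>k\<in>B. T r k * x k))\<^sup>2) \<le> \<rho>\<^sup>2 * (\<Sum>k\<in>B. (cmod (x k))\<^sup>2))"

lemma matrix_boundD:
  assumes "matrix_bound T \<rho> I J" "finite A" "A \<subseteq> I" "finite B" "B \<subseteq> J"
  shows "(\<Sum>r\<in>A. (cmod (\<Sum>k\<in>B. T r k * x k))\<^sup>2) \<le> \<rho>\<^sup>2 * (\<Sum>k\<in>B. (cmod (x k))\<^sup>2)"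
  using assms unfolding matrix_bound_def by blast

lemma matrix_bound_mono:
  assumes "matrix_bound T \<rho> I J" "I' \<subseteq> I" "J' \<subseteq> J"
  shows "matrix_bound T \<rho> I' J'"
  using assms unfolding matrix_bound_def by (meson subset_trans)

lemma matrix_bound_cong:
  assumes "\<And>r k. r \<in> I \<Longrightarrow> k \<in> J \<Longrightarrow> T r k = T' r k"
  shows "matrix_bound T \<rho> I J \<longleftrightarrow> matrix_bound T' \<rho> I J"
proof -
  have "(\<Sum>k\<in>B. T r k * x k) = (\<Sum>k\<in>B. T' r k * x k)" if "r \<in> A" "A \<subseteq> I" "B \<subseteq> J" for A B r x
    using assms that by (intro sum.cong) auto
  then have "(\<Sum>r\<in>A. (cmod (\<Sum>k\<in>B. T r k * x k))\<^sup>2) = (\<Sum>r\<in>A. (cmod (\<Sum>k\<in>B. T' r k * x k))\<^sup>2)"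
    if "A \<subseteq> I" "B \<subseteq> J" for A B x
    using that by (intro sum.cong) auto
  then show ?thesis
    unfolding matrix_bound_def by auto
qed

lemma matrix_bound_reindex:
  assumes "matrix_bound T \<rho> (f ` I) (h ` J)" "inj_on f I" "inj_on h J"
  shows "matrix_bound (\<lambda>r k. T (f r) (h k)) \<rho> I J"
  unfolding matrix_bound_def
proof (intro allI impI, elim conjE)
  fix A B and x :: "'d \<Rightarrow> complex"
  assume *: "finite A" "A \<subseteq> I" "finite B" "B \<subseteq> J"
  have inj: "inj_on f A" "inj_on h B"
    using * assms by (auto intro: inj_on_subset)
  have "(\<Sum>r\<in>f ` A. (cmod (\<Sum>k\<in>h ` B. T r k * x (inv_into B h k)))\<^sup>2)
    \<le> \<rho>\<^sup>2 * (\<Sum>k\<in>h ` B. (cmod (x (inv_into B h k)))\<^sup>2)"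
    by (rule matrix_boundD[OF assms(1)]) (use * in auto)
  then show "(\<Sum>r\<in>A. (cmod (\<Sum>k\<in>B. T (f r) (h k) * x k))\<^sup>2) \<le> \<rho>\<^sup>2 * (\<Sum>k\<in>B. (cmod (x k))\<^sup>2)"
    using inj by (simp add: sum.reindex)
qed

text \<open>The corners admissible for a finite section and a bound above \<open>\<rho>\<close> form
  a closed nonempty set that shrinks as the section grows or the bound falls. Compactness yields a
  corner common to all these sets, and for it the bound can tend to \<open>\<rho>\<close>.\<close>

lemma parrott:
  fixes T :: "'r \<Rightarrow> 'c \<Rightarrow> complex"
  assumes i: "i \<notin> I" and j: "j \<notin> J" and \<rho>: "0 \<le> \<rho>"
    and column: "matrix_bound T \<rho> I (insert j J)"
    and row: "matrix_bound T \<rho> (insert i I) J"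
  shows "\<exists>c. matrix_bound (T(i := (T i)(j := c))) \<rho> (insert i I) (insert j J)"
proof -
  define P where "P = {(A, B, \<sigma>). finite A \<and> A \<subseteq> I \<and> finite B \<and> B \<subseteq> J \<and> \<rho> < \<sigma>}"
  define C where "C = (\<lambda>(A, B, \<sigma>). {c. \<forall>x. (\<Sum>r\<in>A. (cmod (\<Sum>k\<in>insert j B. T r k * x k))\<^sup>2)
      + (cmod (c * x j + (\<Sum>k\<in>B. T i k * x k)))\<^sup>2
    \<le> \<sigma>\<^sup>2 * (\<Sum>k\<in>insert j B. (cmod (x k))\<^sup>2)})"
  have C_ne: "C p \<noteq> {}" if "p \<in> P" for p
  proof -
    obtain A B \<sigma> where p: "p = (A, B, \<sigma>)" and AB: "finite A" "A \<subseteq> I" "finite B" "B \<subseteq> J" "\<rho> < \<sigma>"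
      using \<open>p \<in> P\<close> by (auto simp: P_def)
    have "\<exists>c. \<forall>x. (\<Sum>r\<in>A. (cmod (\<Sum>k\<in>insert j B. T r k * x k))\<^sup>2)
        + (cmod (c * x j + (\<Sum>k\<in>B. T i k * x k)))\<^sup>2
      \<le> \<sigma>\<^sup>2 * (\<Sum>k\<in>insert j B. (cmod (x k))\<^sup>2)"
    proof (rule parrott_finite_strict)
      show "finite B" "0 \<le> \<rho>" "\<rho> < \<sigma>"
        using AB \<rho> by auto
      show "j \<notin> B"
        using AB j by auto
      show "(\<Sum>r\<in>A. (cmod (\<Sum>k\<in>insert j B. T r k * x k))\<^sup>2)
          \<le> \<rho>\<^sup>2 * (\<Sum>k\<in>insert j B. (cmod (x k))\<^sup>2)" for x
        by (rule matrix_boundD[OF column]) (use AB in auto)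
      show "(\<Sum>r\<in>A. (cmod (\<Sum>k\<in>B. T r k * x k))\<^sup>2) + (cmod (\<Sum>k\<in>B. T i k * x k))\<^sup>2
          \<le> \<rho>\<^sup>2 * (\<Sum>k\<in>B. (cmod (x k))\<^sup>2)" for x
      proof -
        have "i \<notin> A"
          using AB i by auto
        then show ?thesis
          using matrix_boundD[OF row, of "insert i A" B x] AB by (simp add: subset_insertI2 add.commute)
      qed
    qed
    then show ?thesis
      by (auto simp: C_def p)
  qed
  have C_mono: "C (A, B, \<sigma>) \<subseteq> C (A', B', \<sigma>')"
    if "finite A" "A' \<subseteq> A" "finite B" "B' \<subseteq> B" "0 \<le> \<sigma>" "\<sigma> \<le> \<sigma>'" "B \<subseteq> J" for A A' B B' \<sigma> \<sigma>'
  proof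
    fix c
    assume c: "c \<in> C (A, B, \<sigma>)"
    show "c \<in> C (A', B', \<sigma>')"
      unfolding C_def
    proof (clarify)
      fix x :: "'c \<Rightarrow> complex"
      \<comment> \<open>Padding with zeros carries a test vector of the smaller section to the
        larger one.\<close>
      define y where "y k = (if k \<in> insert j B' then x k else 0)" for k
      have fB: "finite B'"
        using that(3,4) by (rule rev_finite_subset)
      have jB: "j \<notin> B" "j \<notin> B'"
        using that j by auto
      have s: "(\<Sum>k\<in>B. a k * y k) = (\<Sum>k\<in>B'. a k * x k)" for a
        using that jB by (intro sum.mono_neutral_cong_right) (auto simp: y_def)
      have s2: "(\<Sum>k\<in>B. (cmod (y k))\<^sup>2) = (\<Sum>k\<in>B'. (cmod (x k))\<^sup>2)"
        using that jB by (intro sum.mono_neutral_cong_right) (auto simp: y_def)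
      have yj: "y j = x j"
        by (simp add: y_def)
      have "(\<Sum>r\<in>A'. (cmod (\<Sum>k\<in>insert j B'. T r k * x k))\<^sup>2)
          \<le> (\<Sum>r\<in>A. (cmod (\<Sum>k\<in>insert j B'. T r k * x k))\<^sup>2)"
        using that by (intro sum_mono2) auto
      moreover have "(\<Sum>r\<in>A. (cmod (\<Sum>k\<in>insert j B'. T r k * x k))\<^sup>2)
            + (cmod (c * x j + (\<Sum>k\<in>B'. T i k * x k)))\<^sup>2
          \<le> \<sigma>\<^sup>2 * (\<Sum>k\<in>insert j B'. (cmod (x k))\<^sup>2)"
        using c that jB fB by (auto simp: C_def s s2 yj dest!: spec[of _ y])
      moreover have "\<sigma>\<^sup>2 * (\<Sum>k\<in>insert j B'. (cmod (x k))\<^sup>2) \<le> \<sigma>'\<^sup>2 * (\<Sum>k\<in>insert j B'. (cmod (x k))\<^sup>2)"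
        using that by (intro mult_right_mono power_mono sum_nonneg) auto
      ultimately show "(\<Sum>r\<in>A'. (cmod (\<Sum>k\<in>insert j B'. T r k * x k))\<^sup>2)
            + (cmod (c * x j + (\<Sum>k\<in>B'. T i k * x k)))\<^sup>2
          \<le> \<sigma>'\<^sup>2 * (\<Sum>k\<in>insert j B'. (cmod (x k))\<^sup>2)"
        by linarith
    qed
  qed
  \<comment> \<open>The radius comes from the empty section with bound \<open>\<rho> + 1\<close>,
    whose condition reads \<open>cmod c \<le> \<rho> + 1\<close>.\<close>
  have "cball 0 (\<rho> + 1) \<inter> (\<Inter>p\<in>P. C p) \<noteq> {}"
  proof (rule compact_imp_fip_image)
    show "compact (cball (0::complex) (\<rho> + 1))"
      by simp
    show "closed (C p)" for p
    proof -
      obtain A B \<sigma> where p: "p = (A, B, \<sigma>)"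
        by (cases p) auto
      show ?thesis
        unfolding C_def p prod.case
        by (intro closed_Collect_all closed_Collect_le continuous_intros)
    qed
    fix P'
    assume P': "finite P'" "P' \<subseteq> P"
    define A where "A = (\<Union>p\<in>P'. fst p)"
    define B where "B = (\<Union>p\<in>P'. fst (snd p))"
    \<comment> \<open>Inserting \<open>\<rho> + 1\<close> keeps the minimum meaningful for empty
      \<open>P'\<close> and places the common corner in the disc.\<close>
    define \<sigma> where "\<sigma> = Min (insert (\<rho> + 1) (snd ` snd ` P'))"
    have "(A, B, \<sigma>) \<in> P"
      using P' by (fastforce simp: P_def A_def B_def \<sigma>_def)
    then obtain c where c: "c \<in> C (A, B, \<sigma>)"
      using C_ne by blast
    have A: "finite A" "finite B" "B \<subseteq> J" "\<rho> < \<sigma>"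
      using \<open>(A, B, \<sigma>) \<in> P\<close> by (auto simp: P_def)
    have "c \<in> C p" if "p \<in> P'" for p
    proof -
      obtain A' B' \<sigma>' where p: "p = (A', B', \<sigma>')"
        by (cases p) auto
      have "\<sigma> \<le> \<sigma>'"
        unfolding \<sigma>_def using P' that by (force simp: p intro!: Min_le)
      moreover have "A' \<subseteq> A" "B' \<subseteq> B"
        using that by (auto simp: A_def B_def p intro: bexI[of _ p])
      ultimately show ?thesis
        using C_mono[of A A' B B' \<sigma> \<sigma>'] A c \<rho> by (auto simp: p)
    qed
    moreover have "c \<in> cball 0 (\<rho> + 1)"
    proof -
      have "\<sigma> \<le> \<rho> + 1"
        unfolding \<sigma>_def using P' by simp
      then have "c \<in> C ({}, {}, \<rho> + 1)"
        using C_mono[of A "{}" B "{}" \<sigma> "\<rho> + 1"] A c \<rho> by auto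
      then have "(cmod c)\<^sup>2 \<le> (\<rho> + 1)\<^sup>2"
        by (auto simp: C_def dest!: spec[of _ "\<lambda>k. 1"])
      then show ?thesis
        using \<rho> by (simp add: power2_le_iff_abs_le)
    qed
    ultimately show "cball 0 (\<rho> + 1) \<inter> (\<Inter>p\<in>P'. C p) \<noteq> {}"
      by auto
  qed
  then obtain c where c: "c \<in> C p" if "p \<in> P" for p
    by auto
  define T' where "T' = T(i := (T i)(j := c))"
  have main: "(\<Sum>r\<in>A. (cmod (\<Sum>k\<in>insert j B. T r k * x k))\<^sup>2)
        + (cmod (c * x j + (\<Sum>k\<in>B. T i k * x k)))\<^sup>2
      \<le> \<rho>\<^sup>2 * (\<Sum>k\<in>insert j B. (cmod (x k))\<^sup>2)" (is "?l \<le> \<rho>\<^sup>2 * ?n")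
    if "finite A" "A \<subseteq> I" "finite B" "B \<subseteq> J" for A B x
  proof (rule tendsto_lowerbound)
    show "((\<lambda>\<sigma>. \<sigma>\<^sup>2 * ?n) \<longlongrightarrow> \<rho>\<^sup>2 * ?n) (at_right \<rho>)"
      by (intro tendsto_intros)
    have "?l \<le> \<sigma>\<^sup>2 * ?n" if "\<rho> < \<sigma>" for \<sigma>
      using c[of "(A, B, \<sigma>)"] that \<open>finite A\<close> \<open>A \<subseteq> I\<close> \<open>finite B\<close> \<open>B \<subseteq> J\<close>
      by (auto simp: P_def C_def)
    then show "\<forall>\<^sub>F \<sigma> in at_right \<rho>. ?l \<le> \<sigma>\<^sup>2 * ?n"
      by (auto simp: eventually_at_right_less intro: eventually_mono[OF eventually_at_right_less])
  qed simp
  have "matrix_bound T' \<rho> (insert i I) (insert j J)"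
    unfolding matrix_bound_def
  proof (intro allI impI, elim conjE)
    fix A B and x :: "'c \<Rightarrow> complex"
    assume *: "finite A" "A \<subseteq> insert i I" "finite B" "B \<subseteq> insert j J"
    \<comment> \<open>A section need not contain \<open>i\<close> or \<open>j\<close>. It is
      enlarged to one that does, and \<open>y\<close> vanishes at \<open>j\<close> when that column
      was added.\<close>
    define A0 B0 where "A0 = A - {i}" and "B0 = B - {j}"
    define y where "y k = (if k \<in> B then x k else 0)" for k
    have 0: "finite A0" "A0 \<subseteq> I" "finite B0" "B0 \<subseteq> J" "i \<notin> A0" "j \<notin> B0"
      using * by (auto simp: A0_def B0_def)
    have e: "(\<Sum>k\<in>B. T' r k * x k) = (\<Sum>k\<in>insert j B0. T' r k * y k)" for r
      using * by (intro sum.mono_neutral_cong_left) (auto simp: y_def B0_def)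
    have n: "(\<Sum>k\<in>B. (cmod (x k))\<^sup>2) = (\<Sum>k\<in>insert j B0. (cmod (y k))\<^sup>2)"
      using * by (intro sum.mono_neutral_cong_left) (auto simp: y_def B0_def)
    have "(\<Sum>r\<in>A. (cmod (\<Sum>k\<in>B. T' r k * x k))\<^sup>2)
        \<le> (\<Sum>r\<in>insert i A0. (cmod (\<Sum>k\<in>B. T' r k * x k))\<^sup>2)"
      using 0 by (intro sum_mono2) (auto simp: A0_def)
    also have "\<dots> = (\<Sum>r\<in>A0. (cmod (\<Sum>k\<in>insert j B0. T r k * y k))\<^sup>2)
        + (cmod (c * y j + (\<Sum>k\<in>B0. T i k * y k)))\<^sup>2"
    proof -
      have "(\<Sum>r\<in>A0. (cmod (\<Sum>k\<in>insert j B0. T' r k * y k))\<^sup>2)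
          = (\<Sum>r\<in>A0. (cmod (\<Sum>k\<in>insert j B0. T r k * y k))\<^sup>2)"
        using 0 by (intro sum.cong refl) (auto simp: T'_def)
      moreover have "(\<Sum>k\<in>B0. T' i k * y k) = (\<Sum>k\<in>B0. T i k * y k)"
        using 0 by (intro sum.cong refl) (auto simp: T'_def)
      moreover have "T' i j = c"
        by (simp add: T'_def)
      ultimately show ?thesis
        using 0 by (simp add: e)
    qed
    also have "\<dots> \<le> \<rho>\<^sup>2 * (\<Sum>k\<in>insert j B0. (cmod (y k))\<^sup>2)"
      using 0 by (intro main)
    finally show "(\<Sum>r\<in>A. (cmod (\<Sum>k\<in>B. T' r k * x k))\<^sup>2) \<le> \<rho>\<^sup>2 * (\<Sum>k\<in>B. (cmod (x k))\<^sup>2)"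
      by (simp add: n)
  qed
  then show ?thesis
    unfolding T'_def by blast
qed

text \<open>The missing block is filled entry by entry, in an induction over rows with an inner
  induction over columns. Entries filled in row \<open>i\<close> lie outside the rows
  \<open>I\<close>, so the inner column hypothesis survives; all filled entries lie in the columns
  \<open>S\<close>, outside \<open>J\<close>, so the outer row hypothesis survives.\<close>

lemma parrott_block:
  fixes T :: "'r \<Rightarrow> 'c \<Rightarrow> complex"
  assumes \<rho>: "0 \<le> \<rho>" and "finite R" "finite S" "R \<inter> I = {}" "S \<inter> J = {}"
    and "matrix_bound T \<rho> I (S \<union> J)" "matrix_bound T \<rho> (R \<union> I) J"
  shows "\<exists>T'. matrix_bound T' \<rho> (R \<union> I) (S \<union> J)
    \<and> (\<forall>r k. \<not> (r \<in> R \<and> k \<in> S) \<longrightarrow> T' r k = T r k)"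
proof -
  have one: "\<exists>T'. matrix_bound T' \<rho> (insert i I) (S \<union> J)
      \<and> (\<forall>r k. \<not> (r = i \<and> k \<in> S) \<longrightarrow> T' r k = T r k)"
    if i: "i \<notin> I" and "finite S" "S \<inter> J = {}"
      "matrix_bound T \<rho> I (S \<union> J)" "matrix_bound T \<rho> (insert i I) J"
    for T :: "'r \<Rightarrow> 'c \<Rightarrow> complex" and i I S
    using \<open>finite S\<close> that(3-)
  proof (induction S)
    case empty
    then show ?case
      by auto
  next
    case (insert j S)
    have "matrix_bound T \<rho> I (S \<union> J)"
      using insert.prems by (auto intro: matrix_bound_mono)
    then obtain T1 where T1: "matrix_bound T1 \<rho> (insert i I) (S \<union> J)"
        "\<And>r k. \<not> (r = i \<and> k \<in> S) \<Longrightarrow> T1 r k = T r k"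
      using insert by auto
    have "matrix_bound T1 \<rho> I (insert j (S \<union> J)) \<longleftrightarrow> matrix_bound T \<rho> I (insert j (S \<union> J))"
      using i by (intro matrix_bound_cong T1(2)) auto
    then have "matrix_bound T1 \<rho> I (insert j (S \<union> J))"
      using insert.prems by simp
    then obtain c where c: "matrix_bound (T1(i := (T1 i)(j := c))) \<rho> (insert i I) (insert j (S \<union> J))"
      using parrott[OF i _ \<rho> _ T1(1), of j] insert by auto
    show ?case
    proof (intro exI conjI)
      show "matrix_bound (T1(i := (T1 i)(j := c))) \<rho> (insert i I) (insert j S \<union> J)"
        using c by (simp only: Un_insert_left)
      show "\<forall>r k. \<not> (r = i \<and> k \<in> insert j S) \<longrightarrow> (T1(i := (T1 i)(j := c))) r k = T r k"
        using T1(2) by auto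
    qed
  qed
  show ?thesis
    using \<open>finite R\<close> assms(4,6,7)
  proof (induction R)
    case empty
    then show ?case
      by auto
  next
    case (insert i R)
    have "matrix_bound T \<rho> (R \<union> I) J"
      using insert.prems by (auto intro: matrix_bound_mono)
    then obtain T1 where T1: "matrix_bound T1 \<rho> (R \<union> I) (S \<union> J)"
        "\<And>r k. \<not> (r \<in> R \<and> k \<in> S) \<Longrightarrow> T1 r k = T r k"
      using insert by auto
    have "matrix_bound T1 \<rho> (insert i (R \<union> I)) J \<longleftrightarrow> matrix_bound T \<rho> (insert i (R \<union> I)) J"
      using \<open>S \<inter> J = {}\<close> by (intro matrix_bound_cong T1(2)) auto
    then have "matrix_bound T1 \<rho> (insert i (R \<union> I)) J"
      using insert.prems by simp
    then obtain T2 where "matrix_bound T2 \<rho> (insert i (R \<union> I)) (S \<union> J)"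
        "\<And>r k. \<not> (r = i \<and> k \<in> S) \<Longrightarrow> T2 r k = T1 r k"
      using one[of i "R \<union> I" S T1] T1(1) insert assms by auto
    then show ?case
      using T1(2) by (intro exI[of _ T2]) auto
  qed
qed

section \<open>Completion of block Toeplitz matrices\<close>

text \<open>An index pairs a block position with a coordinate inside the block. This makes the block
  matrix a scalar matrix, to which the completion lemma applies directly; \<open>a k\<close> is the
  block on diagonal \<open>k\<close>.\<close>

definition block_toeplitz :: "(int \<Rightarrow> 'n \<Rightarrow> 'n \<Rightarrow> complex) \<Rightarrow> int \<times> 'n \<Rightarrow> int \<times> 'n \<Rightarrow> complex" where
  "block_toeplitz a r k = a (fst r - fst k) (snd r) (snd k)"

text \<open>Entries depend only on the difference of block positions, so a simultaneous shift of
  rows and columns changes nothing.\<close>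

lemma block_toeplitz_shift:
  assumes "matrix_bound (block_toeplitz a) \<rho> ({..<m} \<times> UNIV) ({n..} \<times> UNIV)"
  shows "matrix_bound (block_toeplitz a) \<rho> ({..<m + l} \<times> UNIV) ({n + l..} \<times> UNIV)"
proof -
  define f :: "int \<times> 'a \<Rightarrow> int \<times> 'a" where "f p = (fst p - l, snd p)" for p
  have "inj_on f X" for X
    by (auto simp: inj_on_def f_def prod_eq_iff)
  moreover have "f ` ({..<m + l} \<times> UNIV) \<subseteq> {..<m} \<times> UNIV" "f ` ({n + l..} \<times> UNIV) \<subseteq> {n..} \<times> UNIV"
    by (auto simp: f_def)
  ultimately have "matrix_bound (\<lambda>r k. block_toeplitz a (f r) (f k)) \<rho>
      ({..<m + l} \<times> UNIV) ({n + l..} \<times> UNIV)"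
    by (blast intro: matrix_bound_reindex[of "block_toeplitz a" \<rho> f _ f] matrix_bound_mono[OF assms])
  moreover have "(\<lambda>r k. block_toeplitz a (f r) (f k)) = block_toeplitz a"
    by (intro ext) (simp add: block_toeplitz_def f_def)
  ultimately show ?thesis
    by simp
qed

text \<open>Among the rows up to \<open>m\<close> and the columns from \<open>0\<close> on, diagonal
  \<open>m\<close> meets only the block at row \<open>m\<close> and column \<open>0\<close>. That
  block can therefore be chosen freely, and the row bound needed for Parrott's lemma is the
  hypothesis shifted by one.\<close>

lemma block_toeplitz_step:
  fixes a :: "int \<Rightarrow> 'n::finite \<Rightarrow> 'n \<Rightarrow> complex"
  assumes \<rho>: "0 \<le> \<rho>"
    and a: "matrix_bound (block_toeplitz a) \<rho> ({..<m} \<times> UNIV) ({0..} \<times> UNIV)"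
  shows "\<exists>a'. matrix_bound (block_toeplitz a') \<rho> ({..<m + 1} \<times> UNIV) ({0..} \<times> UNIV)
    \<and> (\<forall>k. k \<noteq> m \<longrightarrow> a' k = a k)"
proof -
  define R I J S :: "(int \<times> 'n) set"
    where "R = {m} \<times> UNIV" and "I = {..<m} \<times> UNIV" and "J = {1..} \<times> UNIV" and "S = {0} \<times> UNIV"
  have RI: "R \<union> I = {..<m + 1} \<times> UNIV" and SJ: "S \<union> J = {0..} \<times> UNIV"
    by (auto simp: R_def I_def S_def J_def)
  have "\<exists>T'. matrix_bound T' \<rho> (R \<union> I) (S \<union> J)
      \<and> (\<forall>r k. \<not> (r \<in> R \<and> k \<in> S) \<longrightarrow> T' r k = block_toeplitz a r k)"
  proof (rule parrott_block[OF \<rho>])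
    show "finite R" "finite S" "R \<inter> I = {}" "S \<inter> J = {}"
      by (auto simp: R_def S_def I_def J_def)
    show "matrix_bound (block_toeplitz a) \<rho> I (S \<union> J)"
      using a by (simp add: SJ I_def)
    show "matrix_bound (block_toeplitz a) \<rho> (R \<union> I) J"
      using block_toeplitz_shift[OF a, of 1] by (simp add: RI J_def)
  qed
  then obtain T' where T': "matrix_bound T' \<rho> (R \<union> I) (S \<union> J)"
    and eq: "\<And>r k. \<not> (r \<in> R \<and> k \<in> S) \<Longrightarrow> T' r k = block_toeplitz a r k"
    by blast
  define a' where "a' = a(m := (\<lambda>i j. T' (m, i) (0, j)))"
  have "T' r k = block_toeplitz a' r k" if "r \<in> R \<union> I" "k \<in> S \<union> J" for r k
  proof (cases "r \<in> R \<and> k \<in> S")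
    case True
    then show ?thesis
      by (auto simp: R_def S_def block_toeplitz_def a'_def)
  next
    case False
    then have "fst r - fst k \<noteq> m"
      using that by (auto simp: R_def S_def I_def J_def)
    then show ?thesis
      using eq[OF False] by (simp add: block_toeplitz_def a'_def)
  qed
  then have "matrix_bound (block_toeplitz a') \<rho> (R \<union> I) (S \<union> J)"
    using matrix_bound_cong[of "R \<union> I" "S \<union> J" T' "block_toeplitz a'" \<rho>] T' by blast
  then show ?thesis
    by (intro exI[of _ a'] conjI) (simp_all add: RI SJ a'_def)
qed

text \<open>Each stage settles one more diagonal and later stages do not touch it, so the stages
  have a limit. Every finite section of the limit can be shifted along the diagonals to nonnegative
  columns, where it lies in the range of a single stage.\<close>

lemma block_toeplitz_completion:
  fixes a :: "int \<Rightarrow> 'n::finite \<Rightarrow> 'n \<Rightarrow> complex"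
  assumes \<rho>: "0 \<le> \<rho>"
    and a: "matrix_bound (block_toeplitz a) \<rho> ({..<0} \<times> UNIV) ({0..} \<times> UNIV)"
  obtains a' where "\<And>k. k < 0 \<Longrightarrow> a' k = a k" "matrix_bound (block_toeplitz a') \<rho> UNIV UNIV"
proof -
  have "\<exists>s. \<forall>m. (matrix_bound (block_toeplitz (s m)) \<rho> ({..<int m} \<times> UNIV) ({0..} \<times> UNIV)
        \<and> (\<forall>k<0. s m k = a k)) \<and> (\<forall>k. k \<noteq> int m \<longrightarrow> s (Suc m) k = s m k)"
  proof (rule dependent_nat_choice)
    show "\<exists>x. matrix_bound (block_toeplitz x) \<rho> ({..<int 0} \<times> UNIV) ({0..} \<times> UNIV) \<and> (\<forall>k<0. x k = a k)"
      using a by auto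
  next
    fix x :: "int \<Rightarrow> 'n \<Rightarrow> 'n \<Rightarrow> complex" and m :: nat
    assume x: "matrix_bound (block_toeplitz x) \<rho> ({..<int m} \<times> UNIV) ({0..} \<times> UNIV) \<and> (\<forall>k<0. x k = a k)"
    then obtain y where y: "matrix_bound (block_toeplitz y) \<rho> ({..<int m + 1} \<times> UNIV) ({0..} \<times> UNIV)"
        "\<forall>k. k \<noteq> int m \<longrightarrow> y k = x k"
      using block_toeplitz_step[OF \<rho>, of x "int m"] by blast
    have "int (Suc m) = int m + 1"
      by simp
    with x y show "\<exists>y. (matrix_bound (block_toeplitz y) \<rho> ({..<int (Suc m)} \<times> UNIV) ({0..} \<times> UNIV)
        \<and> (\<forall>k<0. y k = a k)) \<and> (\<forall>k. k \<noteq> int m \<longrightarrow> y k = x k)"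
      by (intro exI[of _ y]) (simp only:, simp)
  qed
  then obtain s where s: "\<And>m. matrix_bound (block_toeplitz (s m)) \<rho> ({..<int m} \<times> UNIV) ({0..} \<times> UNIV)"
    and s_neg: "\<And>m k. k < 0 \<Longrightarrow> s m k = a k"
    and s_Suc: "\<And>m k. k \<noteq> int m \<Longrightarrow> s (Suc m) k = s m k"
    by blast
  have s_const: "s n k = s m k" if "m \<le> n" "k < int m" for m n k
    using that by (induction n rule: dec_induct) (simp_all add: s_Suc)
  \<comment> \<open>Stage \<open>k + 1\<close> is the earliest at which a diagonal
    \<open>k \<ge> 0\<close> is settled. For negative \<open>k\<close> the stage is
    \<open>0\<close>, which carries the given coefficients.\<close>
  define a' where "a' k = s (nat (k + 1)) k" for k
  have a': "a' k = s m k" if "k < int m" for k m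
  proof (cases "k < 0")
    case True
    then show ?thesis
      by (simp add: a'_def s_neg)
  next
    case False
    then have "s m k = s (nat (k + 1)) k"
      using that by (intro s_const) auto
    then show ?thesis
      by (simp add: a'_def)
  qed
  have half: "matrix_bound (block_toeplitz a') \<rho> ({..<int m} \<times> UNIV) ({0..} \<times> UNIV)" for m
  proof -
    have "block_toeplitz (s m) r k = block_toeplitz a' r k"
      if "r \<in> {..<int m} \<times> UNIV" "k \<in> {0..} \<times> UNIV" for r k :: "int \<times> 'n"
      using that by (auto simp: block_toeplitz_def a'[of _ m])
    then show ?thesis
      using matrix_bound_cong[of "{..<int m} \<times> UNIV" "{0..} \<times> UNIV" "block_toeplitz (s m)"
          "block_toeplitz a'" \<rho>] s[of m] by blast
  qed
  have "matrix_bound (block_toeplitz a') \<rho> UNIV UNIV"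
    unfolding matrix_bound_def
  proof (intro allI impI, elim conjE)
    fix A B :: "(int \<times> 'n) set" and x :: "int \<times> 'n \<Rightarrow> complex"
    assume fin: "finite A" "finite B"
    \<comment> \<open>Sums of absolute values are crude bounds on the block positions that make
      sense for empty sets as well. Shifting by \<open>- l\<close> must admit all columns of
      \<open>B\<close>, and \<open>m\<close> compensates for the rows lost by that shift.\<close>
    define l where "l = (\<Sum>p\<in>B. \<bar>fst p\<bar>)"
    define m where "m = nat ((\<Sum>p\<in>A. \<bar>fst p\<bar>) + l + 1)"
    have "0 \<le> l"
      by (simp add: l_def sum_nonneg)
    have B: "\<bar>fst p\<bar> \<le> l" if "p \<in> B" for p
      unfolding l_def using fin that by (intro member_le_sum) auto
    have "\<bar>fst p\<bar> \<le> (\<Sum>p\<in>A. \<bar>fst p\<bar>)" if "p \<in> A" for p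
      using fin that by (intro member_le_sum) auto
    then have A: "fst p < int m - l" if "p \<in> A" for p
      using that \<open>0 \<le> l\<close> by (fastforce simp: m_def abs_le_iff)
    have "matrix_bound (block_toeplitz a') \<rho> ({..<int m + - l} \<times> UNIV) ({0 + - l..} \<times> UNIV)"
      by (rule block_toeplitz_shift[OF half])
    moreover have "A \<subseteq> {..<int m + - l} \<times> UNIV"
      using A by auto
    moreover have "B \<subseteq> {0 + - l..} \<times> UNIV"
      using B by (fastforce simp: abs_le_iff)
    ultimately show "(\<Sum>r\<in>A. (cmod (\<Sum>k\<in>B. block_toeplitz a' r k * x k))\<^sup>2) \<le> \<rho>\<^sup>2 * (\<Sum>k\<in>B. (cmod (x k))\<^sup>2)"
      using fin by (intro matrix_boundD)
  qed
  moreover have "a' k = a k" if "k < 0" for k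
    using that by (simp add: a'_def s_neg)
  ultimately show thesis
    by (intro that)
qed

section \<open>Square-integrable functions on the circle\<close>

lemma sets_circle [simp, measurable_cong]: "sets circle = sets borel"
  by (simp add: circle_def)

lemma space_circle [simp]: "space circle = UNIV"
  by (simp add: circle_def)

lemma measurable_circle [simp]: "measurable circle N = measurable borel N"
  by (intro measurable_cong_sets) simp_all

lemma cis_measurable [measurable]: "cis \<in> borel_measurable borel"
  by (intro borel_measurable_continuous_onI continuous_intros)

interpretation circle: prob_space circle
  unfolding circle_def
  by (intro prob_space.prob_space_distr prob_space_uniform_measure) auto

lemma AE_circle: "AE z in circle. cmod z = 1"
  unfolding circle_def by (subst AE_distr_iff) auto

lemma integral_circle_eq:
  fixes f :: "complex \<Rightarrow> complex"
  assumes [measurable]: "f \<in> borel_measurable borel"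
  shows "(\<integral>z. f z \<partial>circle) = (\<integral>x. indicator {0..2 * pi} x *\<^sub>R f (cis x) \<partial>lborel) / (2 * pi)"
proof -
  have "uniform_measure lborel {0..2 * pi}
      = density lborel (\<lambda>x. ennreal (indicator {0..2 * pi} x / (2 * pi)))"
    unfolding uniform_measure_def
    by (intro density_cong) (auto simp: divide_ennreal[symmetric] split: split_indicator)
  then have "(\<integral>z. f z \<partial>circle)
      = (\<integral>x. (indicator {0..2 * pi} x / (2 * pi)) *\<^sub>R f (cis x) \<partial>lborel)"
    by (simp add: circle_def integral_distr integral_density)
  also have "\<dots> = (\<integral>x. (1 / (2 * pi)) *\<^sub>R (indicator {0..2 * pi} x *\<^sub>R f (cis x)) \<partial>lborel)"
    by simp
  finally show ?thesis
    by (simp only: integral_scaleR_right) (simp add: scaleR_conv_of_real)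
qed

lemma measurable_powi [measurable]: "(\<lambda>z::complex. z powi n) \<in> borel_measurable borel"
  unfolding power_int_def by measurable

lemma measurable_cnj [measurable]: "cnj \<in> borel_measurable borel"
  by (intro borel_measurable_continuous_onI continuous_intros)

lemma integral_circle_powi: "(\<integral>z. z powi n \<partial>circle) = of_bool (n = 0)"
proof (cases "n = 0")
  case True
  then show ?thesis
    using circle.prob_space by simp
next
  case False
  define F where "F x = exp (\<i> * of_int n * of_real x) / (\<i> * of_int n)" for x :: real
  have "(\<integral>x. indicator {0..2 * pi} x *\<^sub>R exp (\<i> * of_int n * of_real x) \<partial>lborel) = F (2 * pi) - F 0"
  proof (rule integral_FTC_Icc)
    show "(F has_vector_derivative exp (\<i> * of_int n * of_real x)) (at x within {0..2 * pi})" for x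
      unfolding F_def using False
      by (auto intro!: derivative_eq_intros has_vector_derivative_real_field)
  qed (auto intro!: continuous_intros)
  also have "F (2 * pi) = F 0"
  proof -
    have "exp (\<i> * of_int n * of_real (2 * pi)) = exp (\<i> * of_int n * of_real 0)"
      by (subst exp_eq) (auto simp: algebra_simps)
    then show ?thesis
      by (simp only: F_def)
  qed
  finally have "(\<integral>x. indicator {0..2 * pi} x *\<^sub>R exp (\<i> * of_int n * of_real x) \<partial>lborel) = 0"
    by simp
  moreover have "cis x powi n = exp (\<i> * of_int n * of_real x)" for x
    unfolding cis_power_int by (simp add: cis_conv_exp mult.assoc)
  ultimately show ?thesis
    using False by (simp add: integral_circle_eq)
qed

section \<open>Linear structure of L2 and bounded multipliers\<close>

lemma L2_measurable: "f \<in> L2 \<Longrightarrow> f \<in> borel_measurable borel"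
  by (simp add: L2_def)

lemma Linf_measurable: "f \<in> Linf \<Longrightarrow> f \<in> borel_measurable borel"
  by (simp add: Linf_def)

lemma L2_square_integrable: "f \<in> L2 \<Longrightarrow> integrable circle (\<lambda>z. (cmod (f z))\<^sup>2)"
  by (simp add: L2_def)

lemma L2_mult_integrable:
  assumes "f \<in> L2" "h \<in> L2"
  shows "integrable circle (\<lambda>z. f z * h z)"
proof (rule Bochner_Integration.integrable_bound)
  show "integrable circle (\<lambda>z. (cmod (f z))\<^sup>2 + (cmod (h z))\<^sup>2)"
    using assms by (intro Bochner_Integration.integrable_add L2_square_integrable)
  have "a * b \<le> a\<^sup>2 + b\<^sup>2" if "0 \<le> a" "0 \<le> b" for a b :: real
    using sum_squares_bound[of a b] mult_nonneg_nonneg[OF that] by linarith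
  then show "AE z in circle. norm (f z * h z) \<le> norm ((cmod (f z))\<^sup>2 + (cmod (h z))\<^sup>2)"
    by (simp add: norm_mult)
  show "(\<lambda>z. f z * h z) \<in> borel_measurable circle"
    using assms[THEN L2_measurable] by simp
qed

lemma Linf_mult_L2:
  assumes "h \<in> Linf" "f \<in> L2"
  shows "(\<lambda>z. h z * f z) \<in> L2"
proof -
  note [measurable] = Linf_measurable[OF assms(1)] L2_measurable[OF assms(2)]
  obtain C where C: "AE z in circle. cmod (h z) \<le> C"
    using assms by (auto simp: Linf_def)
  have "integrable circle (\<lambda>z. (cmod (h z * f z))\<^sup>2)"
  proof (rule Bochner_Integration.integrable_bound)
    show "integrable circle (\<lambda>z. C\<^sup>2 * (cmod (f z))\<^sup>2)"
      using assms by (intro integrable_mult_right L2_square_integrable)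
    show "AE z in circle. norm ((cmod (h z * f z))\<^sup>2) \<le> norm (C\<^sup>2 * (cmod (f z))\<^sup>2)"
      using C by eventually_elim (auto simp: norm_mult power_mult_distrib intro!: mult_right_mono power_mono)
  qed simp
  then show ?thesis
    by (simp add: L2_def)
qed

lemma L2_cnj: "f \<in> L2 \<Longrightarrow> (\<lambda>z. cnj (f z)) \<in> L2"
  by (auto simp: L2_def)

lemma Linf_cnj: "f \<in> Linf \<Longrightarrow> (\<lambda>z. cnj (f z)) \<in> Linf"
  by (auto simp: Linf_def)

lemma L2_add:
  assumes "f \<in> L2" "h \<in> L2"
  shows "(\<lambda>z. f z + h z) \<in> L2"
proof -
  note [measurable] = assms[THEN L2_measurable]
  have "integrable circle (\<lambda>z. (cmod (f z + h z))\<^sup>2)"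
  proof (rule Bochner_Integration.integrable_bound)
    show "integrable circle (\<lambda>z. 2 * (cmod (f z))\<^sup>2 + 2 * (cmod (h z))\<^sup>2)"
      using assms by (intro Bochner_Integration.integrable_add integrable_mult_right L2_square_integrable)
    have "(cmod (a + b))\<^sup>2 \<le> 2 * (cmod a)\<^sup>2 + 2 * (cmod b)\<^sup>2" for a b
    proof -
      have "(cmod (a + b))\<^sup>2 \<le> (cmod a + cmod b)\<^sup>2"
        by (intro power_mono norm_triangle_ineq) auto
      also have "\<dots> \<le> 2 * (cmod a)\<^sup>2 + 2 * (cmod b)\<^sup>2"
        using sum_squares_bound[of "cmod a" "cmod b"] by (simp add: power2_sum)
      finally show ?thesis .
    qed
    then show "AE z in circle. norm ((cmod (f z + h z))\<^sup>2) \<le> norm (2 * (cmod (f z))\<^sup>2 + 2 * (cmod (h z))\<^sup>2)"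
      by simp
  qed simp
  then show ?thesis
    by (simp add: L2_def)
qed

lemma Linf_const: "(\<lambda>z. c) \<in> Linf"
  by (auto simp: Linf_def)

lemma L2_cmult: "f \<in> L2 \<Longrightarrow> (\<lambda>z. c * f z) \<in> L2"
  using Linf_mult_L2[OF Linf_const] .

lemma L2_diff:
  assumes "f \<in> L2" "h \<in> L2"
  shows "(\<lambda>z. f z - h z) \<in> L2"
  using L2_add[OF assms(1) L2_cmult[OF assms(2), of "-1"]] by simp

lemma L2_sum: "(\<And>i. i \<in> A \<Longrightarrow> f i \<in> L2) \<Longrightarrow> (\<lambda>z. \<Sum>i\<in>A. f i z) \<in> L2"
proof (induction A rule: infinite_finite_induct)
  case (insert x F)
  then show ?case
    by (simp add: L2_add)
qed (simp_all add: L2_def)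

lemma powi_circle: "AE z in circle. cmod (z powi n) = 1"
  using AE_circle by eventually_elim (simp add: norm_power_int)

lemma powi_mult_circle: "cmod z = 1 \<Longrightarrow> z powi m * z powi n = z powi (m + n)"
  by (subst power_int_add) auto

lemma powi_Linf: "(\<lambda>z. z powi n) \<in> Linf"
  using powi_circle[of n] by (force simp: Linf_def elim: eventually_mono)

lemma const_L2: "(\<lambda>z. c) \<in> L2"
  by (simp add: L2_def)

lemma Linf_subset_L2: "h \<in> Linf \<Longrightarrow> h \<in> L2"
  using Linf_mult_L2[OF _ const_L2[of 1]] by simp

lemma powi_L2: "(\<lambda>z. z powi n) \<in> L2"
  by (intro Linf_subset_L2 powi_Linf)

lemma cnj_powi_circle: "AE z in circle. cnj (z powi n) = z powi (- n)"
  using AE_circle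
proof eventually_elim
  case (elim z)
  then have "cnj z = inverse z"
    using complex_norm_square[of z] by (metis inverse_unique mult.commute of_real_1 one_power2)
  then show ?case
    by (simp add: power_int_minus power_int_inverse)
qed

section \<open>Inner product, norm and the Cauchy-Schwarz inequality\<close>

lemma L2_inner_integrable: "f \<in> L2 \<Longrightarrow> h \<in> L2 \<Longrightarrow> integrable circle (\<lambda>z. f z * cnj (h z))"
  by (intro L2_mult_integrable L2_cnj)

lemma L2_inner_add_left:
  "f \<in> L2 \<Longrightarrow> f' \<in> L2 \<Longrightarrow> h \<in> L2 \<Longrightarrow> L2_inner (\<lambda>z. f z + f' z) h = L2_inner f h + L2_inner f' h"
  by (simp add: L2_inner_def distrib_right L2_inner_integrable)

lemma L2_inner_diff_left:
  "f \<in> L2 \<Longrightarrow> f' \<in> L2 \<Longrightarrow> h \<in> L2 \<Longrightarrow> L2_inner (\<lambda>z. f z - f' z) h = L2_inner f h - L2_inner f' h"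
  by (simp add: L2_inner_def left_diff_distrib L2_inner_integrable)

lemma L2_inner_cmult_left: "L2_inner (\<lambda>z. c * f z) h = c * L2_inner f h"
  by (simp add: L2_inner_def mult.assoc)

lemma L2_inner_commute: "L2_inner h f = cnj (L2_inner f h)"
proof -
  have "L2_inner h f = (\<integral>z. cnj (f z * cnj (h z)) \<partial>circle)"
    by (simp add: L2_inner_def mult.commute)
  then show ?thesis
    by (simp only: Bochner_Integration.integral_cnj L2_inner_def)
qed

lemma L2_inner_add_right:
  "f \<in> L2 \<Longrightarrow> h \<in> L2 \<Longrightarrow> h' \<in> L2 \<Longrightarrow> L2_inner f (\<lambda>z. h z + h' z) = L2_inner f h + L2_inner f h'"
  by (simp add: L2_inner_def distrib_left L2_inner_integrable)

lemma L2_inner_diff_right: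
  "f \<in> L2 \<Longrightarrow> h \<in> L2 \<Longrightarrow> h' \<in> L2 \<Longrightarrow> L2_inner f (\<lambda>z. h z - h' z) = L2_inner f h - L2_inner f h'"
  by (simp add: L2_inner_def right_diff_distrib L2_inner_integrable)

lemma L2_inner_cmult_right: "L2_inner f (\<lambda>z. c * h z) = cnj c * L2_inner f h"
  by (simp add: L2_inner_def mult.left_commute)

lemma L2_norm_square: "(L2_norm f)\<^sup>2 = (\<integral>z. (norm (f z))\<^sup>2 \<partial>circle)"
  by (simp add: L2_norm_def)

lemma L2_norm_nonneg: "0 \<le> L2_norm f"
  by (simp add: L2_norm_def)

lemma L2_inner_self: "L2_inner f f = of_real ((L2_norm f)\<^sup>2)"
  by (simp add: L2_inner_def L2_norm_square complex_norm_square[symmetric] flip: of_real_power)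

lemma L2_norm_add_mult_square:
  assumes "f \<in> L2" "h \<in> L2"
  shows "(L2_norm (\<lambda>z. f z + t * h z))\<^sup>2
    = (L2_norm f)\<^sup>2 + 2 * Re (cnj t * L2_inner f h) + (cmod t)\<^sup>2 * (L2_norm h)\<^sup>2"
proof -
  note 1 = L2_cmult[OF assms(2), of t]
  have "L2_inner (\<lambda>z. f z + t * h z) (\<lambda>z. f z + t * h z)
     = L2_inner f f + cnj t * L2_inner f h + cnj (cnj t * L2_inner f h) + t * cnj t * L2_inner h h"
    using assms 1 L2_inner_commute[of h f]
    by (simp add: L2_inner_add_left L2_inner_add_right L2_add L2_inner_cmult_left L2_inner_cmult_right algebra_simps)
  then have "Re (L2_inner (\<lambda>z. f z + t * h z) (\<lambda>z. f z + t * h z))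
     = Re (L2_inner f f + cnj t * L2_inner f h + cnj (cnj t * L2_inner f h) + t * cnj t * L2_inner h h)"
    by simp
  then show ?thesis
    unfolding L2_inner_self by (simp add: complex_norm_square[symmetric] flip: of_real_power of_real_mult)
qed

lemma L2_norm_eq_0:
  assumes "f \<in> L2" "L2_norm f = 0"
  shows "AE z in circle. f z = 0"
proof -
  have "(\<integral>z. (cmod (f z))\<^sup>2 \<partial>circle) = 0"
    using assms(2) by (simp add: L2_norm_def)
  then have "AE z in circle. (cmod (f z))\<^sup>2 = 0"
    using L2_square_integrable[OF assms(1)] by (subst (asm) integral_nonneg_eq_0_iff_AE) auto
  then show ?thesis
    by simp
qed

lemma L2_Cauchy_Schwarz:
  assumes "f \<in> L2" "h \<in> L2"
  shows "cmod (L2_inner f h) \<le> L2_norm f * L2_norm h"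
proof (cases "L2_norm h = 0")
  case True
  have "L2_inner f h = (\<integral>z. 0 \<partial>circle)"
    unfolding L2_inner_def using L2_norm_eq_0[OF assms(2) True] assms[THEN L2_measurable]
    by (intro integral_cong_AE) auto
  then show ?thesis
    using True by simp
next
  case False
  then have h: "(L2_norm h)\<^sup>2 > 0"
    by simp
  define b where "b = L2_inner f h"
  \<comment> \<open>This choice minimizes the norm of \<open>f + t * h\<close>; nonnegativity of the
    minimum is the inequality sought.\<close>
  define t where "t = - b / of_real ((L2_norm h)\<^sup>2)"
  have "0 \<le> (L2_norm (\<lambda>z. f z + t * h z))\<^sup>2"
    by simp
  moreover have "cnj t * b = of_real (- (cmod b)\<^sup>2 / (L2_norm h)\<^sup>2)"
    unfolding t_def by (simp add: complex_norm_square[symmetric] mult.commute)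
  then have "Re (cnj t * b) = - (cmod b)\<^sup>2 / (L2_norm h)\<^sup>2"
    by (simp only: Re_complex_of_real)
  moreover have "(cmod t)\<^sup>2 * (L2_norm h)\<^sup>2 = (cmod b)\<^sup>2 / (L2_norm h)\<^sup>2"
    using h by (simp add: t_def norm_divide power_divide norm_power power2_eq_square[of "(L2_norm h)\<^sup>2"] field_simps
        flip: power_add)
  ultimately have "(cmod b)\<^sup>2 / (L2_norm h)\<^sup>2 \<le> (L2_norm f)\<^sup>2"
    unfolding L2_norm_add_mult_square[OF assms] b_def[symmetric] by simp
  then have "(cmod b)\<^sup>2 \<le> (L2_norm f * L2_norm h)\<^sup>2"
    using h by (simp add: pos_divide_le_eq power_mult_distrib)
  then show ?thesis
    unfolding b_def by (rule power2_le_imp_le) (simp add: L2_norm_nonneg)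
qed

section \<open>Fourier coefficients, trigonometric polynomials and Bessel's inequality\<close>

lemma fourier_coeff_eq_inner: 
  assumes "f \<in> L2"
  shows "fourier_coeff f n = L2_inner f (\<lambda>z. z powi n)"
  unfolding fourier_coeff_def L2_inner_def using cnj_powi_circle[of n] L2_measurable[OF assms]
  by (intro integral_cong_AE) auto

lemma fourier_coeff_powi: "fourier_coeff (\<lambda>z. z powi m) n = of_bool (m = n)"
proof -
  have "fourier_coeff (\<lambda>z. z powi m) n = (\<integral>z. z powi (m - n) \<partial>circle)"
    unfolding fourier_coeff_def using AE_circle
    by (intro integral_cong_AE) (auto elim!: eventually_mono simp: powi_mult_circle)
  then show ?thesis
    by (simp add: integral_circle_powi)
qed

lemma fourier_coeff_add:
  "f \<in> L2 \<Longrightarrow> h \<in> L2 \<Longrightarrow> fourier_coeff (\<lambda>z. f z + h z) n = fourier_coeff f n + fourier_coeff h n"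
  by (simp add: fourier_coeff_def distrib_right L2_mult_integrable powi_L2)

lemma fourier_coeff_diff:
  "f \<in> L2 \<Longrightarrow> h \<in> L2 \<Longrightarrow> fourier_coeff (\<lambda>z. f z - h z) n = fourier_coeff f n - fourier_coeff h n"
  by (simp add: fourier_coeff_def left_diff_distrib L2_mult_integrable powi_L2)

lemma fourier_coeff_cmult: "fourier_coeff (\<lambda>z. c * f z) n = c * fourier_coeff f n"
  by (simp add: fourier_coeff_def mult.assoc)

lemma fourier_coeff_sum:
  "(\<And>i. i \<in> A \<Longrightarrow> f i \<in> L2) \<Longrightarrow> fourier_coeff (\<lambda>z. \<Sum>i\<in>A. f i z) n = (\<Sum>i\<in>A. fourier_coeff (f i) n)"
  by (simp add: fourier_coeff_def sum_distrib_right Bochner_Integration.integral_sum L2_mult_integrable powi_L2)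

lemma fourier_coeff_mult_powi:
  assumes "f \<in> L2"
  shows "fourier_coeff (\<lambda>z. f z * z powi m) n = fourier_coeff f (n - m)"
  unfolding fourier_coeff_def using AE_circle L2_measurable[OF assms]
  by (intro integral_cong_AE) (auto elim!: eventually_mono simp: mult.assoc powi_mult_circle)

definition trig_poly :: "int set \<Rightarrow> (int \<Rightarrow> complex) \<Rightarrow> complex \<Rightarrow> complex" where
  "trig_poly A c z = (\<Sum>n\<in>A. c n * z powi n)"

lemma trig_poly_L2: "trig_poly A c \<in> L2"
  unfolding trig_poly_def[abs_def] by (intro L2_sum L2_cmult powi_L2)

lemma trig_poly_fourier_coeff:
  "finite A \<Longrightarrow> fourier_coeff (trig_poly A c) n = (if n \<in> A then c n else 0)"
  unfolding trig_poly_def[abs_def]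
  by (subst fourier_coeff_sum) (auto intro: L2_cmult powi_L2 simp: fourier_coeff_cmult fourier_coeff_powi)

lemma L2_inner_trig_poly:
  assumes "f \<in> L2"
  shows "L2_inner f (trig_poly A c) = (\<Sum>n\<in>A. cnj (c n) * fourier_coeff f n)"
proof (induction A rule: infinite_finite_induct)
  case (insert m A)
  have "L2_inner f (trig_poly (insert m A) c) = L2_inner f (\<lambda>z. c m * z powi m + trig_poly A c z)"
    using insert.hyps by (simp add: trig_poly_def[abs_def])
  also have "\<dots> = cnj (c m) * fourier_coeff f m + L2_inner f (trig_poly A c)"
    using assms by (simp add: L2_inner_add_right L2_cmult powi_L2 trig_poly_L2 L2_inner_cmult_right fourier_coeff_eq_inner)
  finally show ?case
    using insert by simp
qed (simp_all add: trig_poly_def[abs_def] L2_inner_def)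

lemma trig_poly_norm:
  assumes "finite A"
  shows "(L2_norm (trig_poly A c))\<^sup>2 = (\<Sum>n\<in>A. (cmod (c n))\<^sup>2)"
proof -
  have "complex_of_real ((L2_norm (trig_poly A c))\<^sup>2) = (\<Sum>n\<in>A. cnj (c n) * c n)"
    unfolding L2_inner_self[symmetric]
    using assms by (simp add: L2_inner_trig_poly trig_poly_L2 trig_poly_fourier_coeff)
  also have "\<dots> = of_real (\<Sum>n\<in>A. (cmod (c n))\<^sup>2)"
    by (simp add: complex_norm_square mult.commute del: of_real_power)
  finally show ?thesis
    by (simp only: of_real_eq_iff)
qed

text \<open>The inner product of \<open>f\<close> with its partial sum and the squared norm of the
  partial sum are the same number, so expanding the square leaves that number once, with a minus
  sign.\<close>

lemma L2_norm_diff_partial_sum: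
  assumes "f \<in> L2" "finite A"
  shows "(L2_norm (\<lambda>z. f z - trig_poly A (fourier_coeff f) z))\<^sup>2
    = (L2_norm f)\<^sup>2 - (\<Sum>n\<in>A. (cmod (fourier_coeff f n))\<^sup>2)"
proof -
  have "L2_inner f (trig_poly A (fourier_coeff f)) = of_real (\<Sum>n\<in>A. (cmod (fourier_coeff f n))\<^sup>2)"
    using assms by (simp add: L2_inner_trig_poly complex_norm_square mult.commute del: of_real_power)
  then show ?thesis
    using L2_norm_add_mult_square[OF assms(1) trig_poly_L2[of A "fourier_coeff f"], of "-1"]
    by (simp add: trig_poly_norm[OF assms(2)])
qed

lemma Bessel:
  assumes "f \<in> L2" "finite A"
  shows "(\<Sum>n\<in>A. (cmod (fourier_coeff f n))\<^sup>2) \<le> (L2_norm f)\<^sup>2"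
  using L2_norm_diff_partial_sum[OF assms] zero_le_power2 by (smt (verit))

section \<open>Density of trigonometric polynomials\<close>

text \<open>Agreement is demanded on the circle only, because it is there that \<open>cnj z\<close>
  equals \<open>z powi (- 1)\<close> and polynomials in the real and imaginary parts become
  trigonometric.\<close>

definition trig_on_circle :: "(complex \<Rightarrow> complex) \<Rightarrow> bool" where
  "trig_on_circle f \<longleftrightarrow> (\<exists>A c. finite A \<and> (\<forall>z. cmod z = 1 \<longrightarrow> f z = trig_poly A c z))"

lemma trig_poly_mono:
  assumes "finite B" "A \<subseteq> B"
  shows "trig_poly A c z = trig_poly B (\<lambda>n. if n \<in> A then c n else 0) z"
  unfolding trig_poly_def using assms by (intro sum.mono_neutral_cong_left) auto

lemma trig_on_circle_add:
  assumes "trig_on_circle f" "trig_on_circle h"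
  shows "trig_on_circle (\<lambda>z. f z + h z)"
proof -
  obtain A c B d where fin: "finite A" "finite B"
    and eq: "\<And>z. cmod z = 1 \<Longrightarrow> f z = trig_poly A c z" "\<And>z. cmod z = 1 \<Longrightarrow> h z = trig_poly B d z"
    using assms unfolding trig_on_circle_def by metis
  let ?e = "\<lambda>n. (if n \<in> A then c n else 0) + (if n \<in> B then d n else 0)"
  have "f z + h z = trig_poly (A \<union> B) ?e z" if "cmod z = 1" for z
    using fin eq[OF that] trig_poly_mono[of "A \<union> B" A c z] trig_poly_mono[of "A \<union> B" B d z]
    by (simp add: trig_poly_def distrib_right sum.distrib)
  then show ?thesis
    unfolding trig_on_circle_def using fin by blast
qed

lemma trig_on_circle_powi: "trig_on_circle (\<lambda>z. c * z powi n)"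
  unfolding trig_on_circle_def by (intro exI[of _ "{n}"] exI[of _ "\<lambda>_. c"]) (simp add: trig_poly_def)

lemma trig_on_circle_const: "trig_on_circle (\<lambda>z. c)"
  using trig_on_circle_powi[of c 0] by simp

lemma trig_on_circle_mult_powi:
  assumes "trig_on_circle f"
  shows "trig_on_circle (\<lambda>z. f z * (d * z powi m))"
proof -
  obtain A c where A: "finite A" "\<And>z. cmod z = 1 \<Longrightarrow> f z = trig_poly A c z"
    using assms unfolding trig_on_circle_def by metis
  have "f z * (d * z powi m) = trig_poly ((\<lambda>n. n + m) ` A) (\<lambda>n. c (n - m) * d) z"
    if "cmod z = 1" for z
  proof -
    have "trig_poly ((\<lambda>n. n + m) ` A) (\<lambda>n. c (n - m) * d) z = (\<Sum>n\<in>A. c n * d * z powi (n + m))"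
      by (simp add: trig_poly_def sum.reindex)
    also have "\<dots> = f z * (d * z powi m)"
      using that by (simp add: A(2) trig_poly_def sum_distrib_left sum_distrib_right mult.assoc
          mult.left_commute flip: powi_mult_circle)
    finally show ?thesis ..
  qed
  then show ?thesis
    unfolding trig_on_circle_def using A(1) by blast
qed

lemma trig_on_circle_mult:
  assumes "trig_on_circle f" "trig_on_circle h"
  shows "trig_on_circle (\<lambda>z. f z * h z)"
proof -
  have *: "trig_on_circle (\<lambda>z. f z * trig_poly B d z)" if "finite B" for B d
    using that
  proof (induction B)
    case empty
    then show ?case
      using trig_on_circle_const[of 0] by (simp add: trig_poly_def)
  next
    case (insert n B)
    then show ?case
      using trig_on_circle_add[OF trig_on_circle_mult_powi[OF assms(1), of "d n" n] insert.IH]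
      by (simp add: trig_poly_def distrib_left)
  qed
  obtain B d where B: "finite B" "\<And>z. cmod z = 1 \<Longrightarrow> h z = trig_poly B d z"
    using assms unfolding trig_on_circle_def by metis
  then show ?thesis
    using *[of B d] unfolding trig_on_circle_def by simp
qed

lemma trig_on_circle_real_polynomial:
  assumes "real_polynomial_function f"
  shows "trig_on_circle (\<lambda>z. of_real (f z))"
  using assms
proof (induction rule: real_polynomial_function.induct)
  case (linear f)
  \<comment> \<open>A real-linear functional is \<open>2 * Re (a * z)\<close>, the sum of
    \<open>a * z\<close> and its conjugate; on the circle that conjugate is
    \<open>cnj a * z powi (- 1)\<close>.\<close>
  define a where "a = (complex_of_real (f 1) - \<i> * of_real (f \<i>)) / 2"
  have "complex_of_real (f z) = a * z powi 1 + cnj a * z powi (- 1)" if "cmod z = 1" for z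
  proof -
    have "f z = Re z * f 1 + Im z * f \<i>"
    proof -
      have "linear f"
        using linear by (rule bounded_linear.linear)
      then have "f (Re z *\<^sub>R 1 + Im z *\<^sub>R \<i>) = Re z * f 1 + Im z * f \<i>"
        by (simp only: linear_add linear_scale real_scaleR_def)
      moreover have "Re z *\<^sub>R 1 + Im z *\<^sub>R \<i> = z"
        by (simp add: complex_eq_iff)
      ultimately show ?thesis
        by simp
    qed
    moreover have "z powi (- 1) = cnj z"
    proof -
      have "z * cnj z = 1"
        using that by (simp add: complex_norm_square[symmetric])
      then show ?thesis
        by (simp add: power_int_minus inverse_unique)
    qed
    ultimately show ?thesis
      by (simp only: power_int_1_right) (simp add: a_def complex_eq_iff field_simps)
  qed
  then show ?case
    using trig_on_circle_add[OF trig_on_circle_powi[of a 1] trig_on_circle_powi[of "cnj a" "- 1"]]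
    unfolding trig_on_circle_def by simp
next
  case (const c)
  then show ?case
    by (rule trig_on_circle_const)
next
  case (add f g)
  then show ?case
    using trig_on_circle_add by simp
next
  case (mult f g)
  then show ?case
    using trig_on_circle_mult by simp
qed

lemma trig_poly_dense:
  fixes u :: "complex \<Rightarrow> real"
  assumes "continuous_on (sphere 0 1) u" "0 < e"
  obtains A c where "finite A" "\<And>z. cmod z = 1 \<Longrightarrow> cmod (of_real (u z) - trig_poly A c z) < e"
proof -
  obtain g where g: "real_polynomial_function g" "\<And>z. z \<in> sphere 0 1 \<Longrightarrow> \<bar>u z - g z\<bar> < e"
    using Stone_Weierstrass_real_polynomial_function[OF compact_sphere assms] by blast
  obtain A c where A: "finite A" "\<And>z. cmod z = 1 \<Longrightarrow> of_real (g z) = trig_poly A c z"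
    using trig_on_circle_real_polynomial[OF g(1)] unfolding trig_on_circle_def by blast
  have "cmod (of_real (u z) - trig_poly A c z) < e" if "cmod z = 1" for z
    using g(2)[of z] that by (simp flip: A(2) of_real_diff)
  with A(1) show thesis
    by (rule that)
qed

lemma trig_poly_Linf: "trig_poly A c \<in> Linf"
proof -
  have "AE z in circle. cmod (trig_poly A c z) \<le> (\<Sum>n\<in>A. cmod (c n))"
    using AE_circle
  proof eventually_elim
    case (elim z)
    have "cmod (trig_poly A c z) \<le> (\<Sum>n\<in>A. cmod (c n * z powi n))"
      unfolding trig_poly_def by (rule norm_sum)
    then show ?case
      using elim by (simp add: norm_mult norm_power_int)
  qed
  then show ?thesis
    using L2_measurable[OF trig_poly_L2] by (auto simp: Linf_def)
qed

lemma integrable_mult_bounded: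
  fixes v u :: "complex \<Rightarrow> real"
  assumes "integrable circle v" "u \<in> borel_measurable borel" "AE z in circle. \<bar>u z\<bar> \<le> C"
  shows "integrable circle (\<lambda>z. v z * u z)"
proof (rule Bochner_Integration.integrable_bound)
  show "integrable circle (\<lambda>z. C * v z)"
    using assms by simp
  show "(\<lambda>z. v z * u z) \<in> borel_measurable circle"
    using assms borel_measurable_integrable[OF assms(1)] by simp
  show "AE z in circle. norm (v z * u z) \<le> norm (C * v z)"
    using assms(3) by eventually_elim (auto simp: abs_mult mult.commute intro!: mult_right_mono)
qed

text \<open>Uniform approximation is applied to \<open>sqrt (u z)\<close> rather than to
  \<open>u\<close>: the squared modulus of the approximant is then close to \<open>u\<close> and is
  one of the weights covered by the hypothesis.\<close>

lemma integral_nonneg_continuous: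
  fixes u v :: "complex \<Rightarrow> real"
  assumes v: "integrable circle v"
    and nonneg: "\<And>A c. finite A \<Longrightarrow> 0 \<le> (\<integral>z. v z * (cmod (trig_poly A c z))\<^sup>2 \<partial>circle)"
    and u: "continuous_on UNIV u" "\<And>z. 0 \<le> u z" "\<And>z. u z \<le> 1"
  shows "0 \<le> (\<integral>z. v z * u z \<partial>circle)"
proof (rule field_le_epsilon)
  have [measurable]: "v \<in> borel_measurable borel"
    using borel_measurable_integrable[OF v] by simp
  fix e :: real
  assume e: "0 < e"
  define N where "N = (\<integral>z. \<bar>v z\<bar> \<partial>circle)"
  have N: "0 \<le> N"
    by (simp add: N_def)
  \<comment> \<open>The cap \<open>1\<close> keeps the modulus of the approximant below
    \<open>2\<close>, which gives the factor \<open>3\<close> in \<open>close\<close>. The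
    \<open>+ 1\<close> in the denominator covers \<open>N = 0\<close>.\<close>
  define d where "d = min 1 (e / (3 * N + 1))"
  have d: "0 < d" "d \<le> 1"
    using e N by (auto simp: d_def)
  have "3 * d * N \<le> e"
  proof -
    have "d \<le> e / (3 * N + 1)"
      by (simp add: d_def)
    then have "d * (3 * N + 1) \<le> e"
      using N by (subst (asm) pos_le_divide_eq) auto
    then show ?thesis
      using d by (simp add: algebra_simps)
  qed
  have "continuous_on (sphere 0 1) (\<lambda>z. sqrt (u z))"
    by (intro continuous_intros continuous_on_subset[OF u(1)]) auto
  then obtain A c where A: "finite A"
      "\<And>z. cmod z = 1 \<Longrightarrow> cmod (of_real (sqrt (u z)) - trig_poly A c z) < d"
    using trig_poly_dense[OF _ d(1)] by blast
  define p where "p z = (cmod (trig_poly A c z))\<^sup>2" for z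
  have [measurable]: "p \<in> borel_measurable borel" "u \<in> borel_measurable borel"
    using L2_measurable[OF trig_poly_L2] u(1)
    by (auto simp: p_def[abs_def] intro: borel_measurable_continuous_onI)
  have close: "\<bar>u z - p z\<bar> \<le> 3 * d" if "cmod z = 1" for z
  proof -
    define s t where "s = sqrt (u z)" and "t = cmod (trig_poly A c z)"
    have s: "0 \<le> s" "s \<le> 1"
      using u by (auto simp: s_def)
    have "\<bar>s - t\<bar> \<le> d"
      using A(2)[OF that] norm_triangle_ineq3[of "of_real s" "trig_poly A c z"] s
      by (simp add: s_def t_def)
    moreover have "\<bar>s + t\<bar> \<le> 3"
      using \<open>\<bar>s - t\<bar> \<le> d\<close> s d by (auto simp: t_def abs_le_iff)
    ultimately have "\<bar>s - t\<bar> * \<bar>s + t\<bar> \<le> d * 3"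
      using d by (intro mult_mono) auto
    moreover have "u z - p z = (s - t) * (s + t)"
      using u by (simp add: s_def t_def p_def power2_eq_square algebra_simps)
    ultimately show ?thesis
      by (simp add: abs_mult mult.commute)
  qed
  have p_bound: "AE z in circle. \<bar>p z\<bar> \<le> 4"
    using AE_circle
  proof eventually_elim
    case (elim z)
    then show ?case
      using close[OF elim] u(2,3)[of z] d by (simp add: abs_le_iff)
  qed
  have u_bound: "AE z in circle. \<bar>u z\<bar> \<le> 1"
    using u by simp
  have iu: "integrable circle (\<lambda>z. v z * u z)" and ip: "integrable circle (\<lambda>z. v z * p z)"
    using integrable_mult_bounded[OF v _ u_bound] integrable_mult_bounded[OF v _ p_bound] by auto
  have "(\<integral>z. v z * p z \<partial>circle) - (\<integral>z. v z * u z \<partial>circle) = (\<integral>z. v z * p z - v z * u z \<partial>circle)"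
    using iu ip by simp
  also have "\<dots> \<le> (\<integral>z. \<bar>v z\<bar> * (3 * d) \<partial>circle)"
  proof (rule integral_mono_AE)
    show "AE z in circle. v z * p z - v z * u z \<le> \<bar>v z\<bar> * (3 * d)"
      using AE_circle
    proof eventually_elim
      case (elim z)
      have "v z * p z - v z * u z \<le> \<bar>v z\<bar> * \<bar>u z - p z\<bar>"
        using abs_ge_self[of "v z * (p z - u z)"] unfolding abs_mult
        by (simp add: right_diff_distrib abs_minus_commute)
      also have "\<dots> \<le> \<bar>v z\<bar> * (3 * d)"
        using close[OF elim] by (intro mult_left_mono) auto
      finally show ?case .
    qed
  qed (use iu ip v in auto)
  also have "\<dots> = 3 * d * N"
    by (simp add: N_def mult.commute)
  finally show "0 \<le> (\<integral>z. v z * u z \<partial>circle) + e"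
    using nonneg[OF A(1), of c] \<open>3 * d * N \<le> e\<close> by (simp add: p_def)
qed

lemma integral_nonneg_closed:
  fixes v :: "complex \<Rightarrow> real"
  assumes v: "integrable circle v"
    and nonneg: "\<And>A c. finite A \<Longrightarrow> 0 \<le> (\<integral>z. v z * (cmod (trig_poly A c z))\<^sup>2 \<partial>circle)"
    and K: "closed K" "K \<noteq> {}"
  shows "0 \<le> (\<integral>z. indicator K z * v z \<partial>circle)"
proof (rule LIMSEQ_le_const)
  have [measurable]: "v \<in> borel_measurable borel"
    using borel_measurable_integrable[OF v] by simp
  \<comment> \<open>Continuous cutoffs that equal \<open>1\<close> on \<open>K\<close> and converge
    to its indicator. The set \<open>K\<close> must be nonempty here, since the distance to the
    empty set is zero by convention.\<close>
  define u where "u n z = max 0 (1 - real n * infdist z K)" for n z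
  have u: "continuous_on UNIV (u n)" for n
    unfolding u_def by (intro continuous_intros)
  then have [measurable]: "u n \<in> borel_measurable borel" for n
    by (intro borel_measurable_continuous_onI)
  have u01: "0 \<le> u n z" "u n z \<le> 1" for n z
    by (auto simp: u_def infdist_nonneg)
  have lim: "(\<lambda>n. u n z) \<longlonglongrightarrow> indicator K z" for z
  proof (cases "z \<in> K")
    case True
    then show ?thesis
      by (simp add: u_def)
  next
    case False
    then have pos: "infdist z K > 0"
      using K infdist_nonneg[of z K] in_closed_iff_infdist_zero[of K z] by (simp add: less_le)
    have "eventually (\<lambda>n. u n z = 0) sequentially"
    proof (rule eventually_sequentiallyI)
      fix n
      assume "nat \<lceil>1 / infdist z K\<rceil> \<le> n"
      then have "1 / infdist z K \<le> real n"
        by linarith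
      then show "u n z = 0"
        using pos by (simp add: u_def pos_divide_le_eq)
    qed
    then show ?thesis
      using False by (simp add: tendsto_eventually)
  qed
  have [measurable]: "K \<in> sets borel"
    using K by simp
  show "(\<lambda>n. \<integral>z. v z * u n z \<partial>circle) \<longlonglongrightarrow> (\<integral>z. indicator K z * v z \<partial>circle)"
  proof (rule integral_dominated_convergence[where w = "\<lambda>z. \<bar>v z\<bar>"])
    show "AE z in circle. (\<lambda>n. v z * u n z) \<longlonglongrightarrow> indicator K z * v z"
      using lim by (auto simp: mult.commute[of _ "v _"] intro!: tendsto_mult_left)
    show "AE z in circle. norm (v z * u n z) \<le> \<bar>v z\<bar>" for n
      using u01[of n] by (auto simp: abs_mult intro!: mult_left_le)
  qed (use v in auto)
  show "\<exists>N. \<forall>n\<ge>N. 0 \<le> (\<integral>z. v z * u n z \<partial>circle)"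
    using integral_nonneg_continuous[OF v nonneg u u01] by blast
qed

text \<open>Squared moduli of trigonometric polynomials approximate the continuous functions with values
  in \<open>[0, 1]\<close>, and by inner regularity these detect the sign of \<open>v\<close> on every Borel set.\<close>

lemma AE_nonneg_if_trig_poly:
  fixes v :: "complex \<Rightarrow> real"
  assumes v: "integrable circle v"
    and nonneg: "\<And>A c. finite A \<Longrightarrow> 0 \<le> (\<integral>z. v z * (cmod (trig_poly A c z))\<^sup>2 \<partial>circle)"
  shows "AE z in circle. 0 \<le> v z"
proof -
  have [measurable]: "v \<in> borel_measurable borel"
    using borel_measurable_integrable[OF v] by simp
  show ?thesis
  proof (rule circle.density_nonneg[OF v])
    fix B
    assume "B \<in> sets circle"
    then have [measurable]: "B \<in> sets borel"
      by simp
    show "0 \<le> set_lebesgue_integral circle B v"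
    proof (rule field_le_epsilon)
      fix e :: real
      assume e: "0 < e"
      \<comment> \<open>Inner regularity is applied to the finite measure with density
        \<open>\<bar>v z\<bar>\<close>, so that the part of \<open>B\<close> outside a suitable
        compact \<open>K\<close> changes the integral of \<open>v\<close> by less than
        \<open>e\<close>.\<close>
      define \<nu> where "\<nu> = density circle (\<lambda>z. ennreal \<bar>v z\<bar>)"
      have em: "emeasure \<nu> A = ennreal (\<integral>z. indicator A z * \<bar>v z\<bar> \<partial>circle)"
        if [measurable]: "A \<in> sets borel" for A
      proof -
        have "emeasure \<nu> A = (\<integral>\<^sup>+z. ennreal (indicator A z * \<bar>v z\<bar>) \<partial>circle)"
          unfolding \<nu>_def
          by (subst emeasure_density) (auto intro!: nn_integral_cong split: split_indicator)
        also have "\<dots> = ennreal (\<integral>z. indicator A z * \<bar>v z\<bar> \<partial>circle)"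
          using integrable_mult_indicator[of A circle "\<lambda>z. \<bar>v z\<bar>"] v
          by (intro nn_integral_eq_integral) auto
        finally show ?thesis .
      qed
      have "emeasure \<nu> B = (SUP K\<in>{K. K \<subseteq> B \<and> compact K}. emeasure \<nu> K)"
        by (rule inner_regular) (auto simp: \<nu>_def em[unfolded \<nu>_def])
      moreover have "emeasure \<nu> B < (SUP K\<in>{K. K \<subseteq> B \<and> compact K}. emeasure \<nu> K) + ennreal e"
        unfolding calculation[symmetric] using e by (simp add: em)
      ultimately have "\<exists>K\<in>{K. K \<subseteq> B \<and> compact K}. emeasure \<nu> B < emeasure \<nu> K + ennreal e"
        by (subst (asm) ennreal_SUP_add_left[symmetric]) (auto simp: less_SUP_iff)
      then obtain K where K: "K \<subseteq> B" "compact K" "emeasure \<nu> B < emeasure \<nu> K + ennreal e"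
        by blast
      have [measurable]: "K \<in> sets borel"
        using K(2) by (intro borel_closed compact_imp_closed)
      have int: "integrable circle (\<lambda>z. indicator A z * w z)"
        if "A \<in> sets borel" "integrable circle w" for A and w :: "complex \<Rightarrow> real"
        using integrable_mult_indicator[of A circle w] that by simp
      have "(\<integral>z. indicator B z * \<bar>v z\<bar> \<partial>circle) < (\<integral>z. indicator K z * \<bar>v z\<bar> \<partial>circle) + e"
        using K(3) e by (simp add: em flip: ennreal_plus)
          (subst (asm) ennreal_less_iff, auto)
      moreover have "(\<integral>z. indicator K z * v z \<partial>circle) - (\<integral>z. indicator B z * v z \<partial>circle)
          \<le> (\<integral>z. indicator B z * \<bar>v z\<bar> \<partial>circle) - (\<integral>z. indicator K z * \<bar>v z\<bar> \<partial>circle)"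
      proof -
        have "(\<integral>z. indicator K z * v z - indicator B z * v z \<partial>circle)
            \<le> (\<integral>z. indicator B z * \<bar>v z\<bar> - indicator K z * \<bar>v z\<bar> \<partial>circle)"
          using K(1) v
          by (intro integral_mono Bochner_Integration.integrable_diff int) (auto split: split_indicator)
        then show ?thesis
          using v by (simp add: int)
      qed
      moreover have "0 \<le> (\<integral>z. indicator K z * v z \<partial>circle)"
        using integral_nonneg_closed[OF v nonneg, of K] K(2) compact_imp_closed by (cases "K = {}") auto
      ultimately show "0 \<le> set_lebesgue_integral circle B v + e"
        by (simp add: set_lebesgue_integral_def)
    qed
  qed
qed

section \<open>Fourier series of square-integrable functions\<close>

lemma fourier_coeff_mult_trig_poly:
  assumes "f \<in> L2"
  shows "fourier_coeff (\<lambda>z. f z * trig_poly A c z) n = (\<Sum>m\<in>A. c m * fourier_coeff f (n - m))"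
proof -
  have "(\<lambda>z. f z * z powi m) \<in> L2" for m
    using Linf_mult_L2[OF powi_Linf assms, of m] by (simp add: mult.commute)
  then show ?thesis
    unfolding trig_poly_def sum_distrib_left mult.left_commute[of _ "c _"]
    by (subst fourier_coeff_sum)
      (auto intro: L2_cmult simp: fourier_coeff_cmult fourier_coeff_mult_powi assms)
qed

lemma L2_integrable: "f \<in> L2 \<Longrightarrow> integrable circle f"
  using L2_mult_integrable[OF _ const_L2[of 1]] by simp

text \<open>If all coefficients vanish, \<open>f * p\<close> is orthogonal to \<open>p\<close> for
  every trigonometric polynomial \<open>p\<close>, so the integral of \<open>Re f\<close> against
  the squared modulus of \<open>p\<close> is zero and the positivity test applies. Multiplying
  \<open>f\<close> by \<open>1\<close>, \<open>-1\<close>, \<open>\<i>\<close> and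
  \<open>-\<i>\<close> forces both real and imaginary part to vanish.\<close>

lemma fourier_uniqueness:
  assumes f: "f \<in> L2" and zero: "\<And>n. fourier_coeff f n = 0"
  shows "AE z in circle. f z = 0"
proof -
  have Re_nonneg: "AE z in circle. 0 \<le> Re (f z)"
    if f: "f \<in> L2" and zero: "\<And>n. fourier_coeff f n = 0" for f
  proof (rule AE_nonneg_if_trig_poly)
    show "integrable circle (\<lambda>z. Re (f z))"
      using L2_integrable[OF f] by simp
    fix A :: "int set" and c
    have fp: "(\<lambda>z. f z * trig_poly A c z) \<in> L2"
      using Linf_mult_L2[OF trig_poly_Linf f] by (simp add: mult.commute)
    have "Re (f z) * (cmod (trig_poly A c z))\<^sup>2
        = Re (f z * trig_poly A c z * cnj (trig_poly A c z))" for z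
      unfolding mult.assoc complex_norm_square[symmetric] by simp
    then have "(\<integral>z. Re (f z) * (cmod (trig_poly A c z))\<^sup>2 \<partial>circle)
        = Re (L2_inner (\<lambda>z. f z * trig_poly A c z) (trig_poly A c))"
      unfolding L2_inner_def by (simp only: integral_Re[OF L2_inner_integrable[OF fp trig_poly_L2]])
    also have "\<dots> = 0"
      by (simp add: L2_inner_trig_poly fp fourier_coeff_mult_trig_poly f zero)
    finally show "0 \<le> (\<integral>z. Re (f z) * (cmod (trig_poly A c z))\<^sup>2 \<partial>circle)"
      by simp
  qed
  have "AE z in circle. 0 \<le> Re (c * f z)" for c
    by (rule Re_nonneg) (simp_all add: L2_cmult f fourier_coeff_cmult zero)
  from this[of 1] this[of "-1"] this[of "\<i>"] this[of "-\<i>"] show ?thesis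
    by eventually_elim (simp add: complex_eq_iff)
qed

text \<open>Lower semicontinuity of the norm. It is used for a limit of partial sums and also for
  the distance of that limit from a fixed partial sum.\<close>

lemma L2_Fatou:
  assumes "f \<in> borel_measurable borel" and u: "\<And>i. u i \<in> L2"
    and lim: "AE z in circle. (\<lambda>i. u i z) \<longlonglongrightarrow> f z"
    and bound: "eventually (\<lambda>i. (L2_norm (u i))\<^sup>2 \<le> K) sequentially"
  shows "f \<in> L2" "(L2_norm f)\<^sup>2 \<le> K"
proof -
  note [measurable] = assms(1) L2_measurable[OF u]
  have norm_u: "(\<integral>\<^sup>+z. ennreal ((cmod (u i z))\<^sup>2) \<partial>circle) = ennreal ((L2_norm (u i))\<^sup>2)" for i
    unfolding L2_norm_square using u by (intro nn_integral_eq_integral L2_square_integrable) auto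
  have "(\<integral>\<^sup>+z. ennreal ((cmod (f z))\<^sup>2) \<partial>circle)
      = (\<integral>\<^sup>+z. liminf (\<lambda>i. ennreal ((cmod (u i z))\<^sup>2)) \<partial>circle)"
  proof (rule nn_integral_cong_AE)
    show "AE z in circle. ennreal ((cmod (f z))\<^sup>2) = liminf (\<lambda>i. ennreal ((cmod (u i z))\<^sup>2))"
      using lim
    proof eventually_elim
      case (elim z)
      then have "(\<lambda>i. ennreal ((cmod (u i z))\<^sup>2)) \<longlonglongrightarrow> ennreal ((cmod (f z))\<^sup>2)"
        by (intro tendsto_intros)
      then show ?case
        by (intro lim_imp_Liminf[symmetric]) auto
    qed
  qed
  also have "\<dots> \<le> liminf (\<lambda>i. \<integral>\<^sup>+z. ennreal ((cmod (u i z))\<^sup>2) \<partial>circle)"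
    by (intro nn_integral_liminf) simp
  also have "\<dots> \<le> liminf (\<lambda>i. ennreal K)"
    unfolding norm_u by (intro Liminf_mono eventually_mono[OF bound]) (rule ennreal_leI)
  also have "\<dots> = ennreal K"
    by (simp add: Liminf_const)
  finally have le: "(\<integral>\<^sup>+z. ennreal ((cmod (f z))\<^sup>2) \<partial>circle) \<le> ennreal K" .
  then have int: "integrable circle (\<lambda>z. (cmod (f z))\<^sup>2)"
    by (intro integrableI_nonneg) (auto intro: le_less_trans)
  then show "f \<in> L2"
    by (simp add: L2_def)
  have "0 \<le> K"
    using eventually_happens'[OF _ bound] zero_le_power2[of "L2_norm (u _)"]
    by (meson order_trans sequentially_bot)
  then show "(L2_norm f)\<^sup>2 \<le> K"
    using le int by (subst (asm) nn_integral_eq_integral) (auto simp: L2_norm_square)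
qed

lemma L1_le_L2_norm:
  assumes "f \<in> L2"
  shows "(\<integral>z. cmod (f z) \<partial>circle) \<le> L2_norm f"
proof -
  have f: "(\<lambda>z. complex_of_real (cmod (f z))) \<in> L2"
    using assms by (auto simp: L2_def)
  have "cmod (L2_inner (\<lambda>z. of_real (cmod (f z))) (\<lambda>z. 1)) \<le> L2_norm (\<lambda>z. complex_of_real (cmod (f z))) * L2_norm (\<lambda>z. 1::complex)"
    by (rule L2_Cauchy_Schwarz[OF f const_L2])
  also have "L2_inner (\<lambda>z. of_real (cmod (f z))) (\<lambda>z. 1) = of_real (\<integral>z. cmod (f z) \<partial>circle)"
    by (simp add: L2_inner_def)
  finally show ?thesis
    using circle.prob_space by (simp add: L2_norm_def)
qed

theorem Riesz_Fischer:
  assumes bound: "\<And>A. finite A \<Longrightarrow> (\<Sum>n\<in>A. (cmod (c n))\<^sup>2) \<le> K"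
  shows "\<exists>f\<in>L2. (\<forall>n. fourier_coeff f n = c n) \<and> (L2_norm f)\<^sup>2 \<le> K"
proof -
  define I where "I N = {- int N..int N}" for N :: nat
  define s where "s N = trig_poly (I N) c" for N
  define \<sigma> where "\<sigma> N = (\<Sum>n\<in>I N. (cmod (c n))\<^sup>2)" for N
  have I: "finite (I N)" "M \<le> N \<Longrightarrow> I M \<subseteq> I N" for M N
    by (auto simp: I_def)
  have s: "s N \<in> L2" for N
    by (simp add: s_def trig_poly_L2)
  have s_diff: "(L2_norm (\<lambda>z. s N z - s M z))\<^sup>2 = \<bar>\<sigma> N - \<sigma> M\<bar>" for M N
  proof (induction M N rule: linorder_wlog)
    case (le M N)
    have "s N z - s M z = trig_poly (I N - I M) c z" for z
      unfolding s_def trig_poly_def using I le by (subst sum_diff) auto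
    moreover have "\<sigma> N - \<sigma> M = (\<Sum>n\<in>I N - I M. (cmod (c n))\<^sup>2)"
      unfolding \<sigma>_def using I le by (subst sum_diff) auto
    ultimately show ?case
      using I by (simp add: trig_poly_norm sum_nonneg)
  next
    case (sym M N)
    have "L2_norm (\<lambda>z. s M z - s N z) = L2_norm (\<lambda>z. s N z - s M z)"
      by (simp add: L2_norm_def norm_minus_commute)
    then show ?case
      using sym by (simp add: abs_minus_commute)
  qed
  have "incseq \<sigma>"
    unfolding \<sigma>_def using I by (intro incseq_SucI sum_mono2) auto
  moreover have "bdd_above (range \<sigma>)"
    using bound I by (auto simp: \<sigma>_def intro!: bdd_aboveI[of _ K])
  ultimately have "Cauchy \<sigma>"
    by (intro LIMSEQ_imp_Cauchy[OF LIMSEQ_incseq_SUP])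
  have Cauchy_s: "\<exists>M. \<forall>i\<ge>M. \<forall>j\<ge>M. (L2_norm (\<lambda>z. s i z - s j z))\<^sup>2 < e" if "0 < e" for e
    using CauchyD[OF \<open>Cauchy \<sigma>\<close> that] by (simp add: s_diff)
  \<comment> \<open>On a probability space the L1 norm is at most the L2 norm, so the partial sums
    are Cauchy in L1, and this supplies a subsequence converging almost everywhere.\<close>
  obtain r where r: "strict_mono r" "AE z in circle. Cauchy (\<lambda>i. s (r i) z)"
  proof (rule cauchy_L1_AE_cauchy_subseq)
    show "integrable circle (s n)" for n
      by (intro L2_integrable s)
    fix e :: real
    assume "0 < e"
    then obtain M where M: "(L2_norm (\<lambda>z. s i z - s j z))\<^sup>2 < e\<^sup>2" if "M \<le> i" "M \<le> j" for i j
      using Cauchy_s[of "e\<^sup>2"] by auto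
    have "(LINT z|circle. cmod (s i z - s j z)) < e" if "M \<le> i" "M \<le> j" for i j
      using L1_le_L2_norm[OF L2_diff[OF s s], of i j] power2_less_imp_less[OF M[OF that]] \<open>0 < e\<close>
      by simp
    then show "\<exists>N. \<forall>i\<ge>N. \<forall>j\<ge>N. (LINT x|circle. cmod (s i x - s j x)) < e"
      by blast
  qed blast
  define f where "f z = lim (\<lambda>i. s (r i) z)" for z
  have f_meas [measurable]: "f \<in> borel_measurable borel"
    unfolding f_def[abs_def] using L2_measurable[OF s] by (intro borel_measurable_lim_metric)
  have lim: "AE z in circle. (\<lambda>i. s (r i) z) \<longlonglongrightarrow> f z"
    using r(2) by eventually_elim (simp add: f_def convergent_LIMSEQ_iff[symmetric] Cauchy_convergent_iff)
  have "(L2_norm (s i))\<^sup>2 \<le> K" for i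
    unfolding s_def using I bound by (simp add: trig_poly_norm)
  then have f: "f \<in> L2" "(L2_norm f)\<^sup>2 \<le> K"
    using L2_Fatou[OF f_meas s lim, of K] by simp_all
  have "fourier_coeff f n = c n" for n
  proof (rule ccontr)
    assume neq: "fourier_coeff f n \<noteq> c n"
    \<comment> \<open>Half of the squared discrepancy: Fatou bounds the squared norm of
      \<open>f - s k\<close> by \<open>e\<close>, whereas its coefficient at \<open>n\<close> alone
      contributes \<open>2 * e\<close>.\<close>
    define e where "e = (cmod (fourier_coeff f n - c n))\<^sup>2 / 2"
    have e: "0 < e"
      using neq by (simp add: e_def)
    obtain M where M: "(L2_norm (\<lambda>z. s i z - s j z))\<^sup>2 < e" if "M \<le> i" "M \<le> j" for i j
      using Cauchy_s[OF e] by auto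
    define k where "k = max M (nat \<bar>n\<bar>)"
    have "n \<in> I k"
      by (auto simp: I_def k_def)
    have "(L2_norm (\<lambda>z. f z - s k z))\<^sup>2 \<le> e"
    proof (rule L2_Fatou(2)[where u = "\<lambda>i z. s (r i) z - s k z"])
      show "(\<lambda>z. f z - s k z) \<in> borel_measurable borel"
        using L2_measurable[OF s] by measurable
      show "(\<lambda>z. s (r i) z - s k z) \<in> L2" for i
        by (intro L2_diff s)
      show "AE z in circle. (\<lambda>i. s (r i) z - s k z) \<longlonglongrightarrow> f z - s k z"
        using lim by eventually_elim (intro tendsto_intros)
      show "eventually (\<lambda>i. (L2_norm (\<lambda>z. s (r i) z - s k z))\<^sup>2 \<le> e) sequentially"
      proof (rule eventually_sequentiallyI)
        fix i
        assume "M \<le> i"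
        then have "M \<le> r i"
          using seq_suble[OF r(1), of i] by linarith
        then show "(L2_norm (\<lambda>z. s (r i) z - s k z))\<^sup>2 \<le> e"
          using M[of "r i" k] by (simp add: k_def)
      qed
    qed
    moreover have "fourier_coeff (\<lambda>z. f z - s k z) n = fourier_coeff f n - c n"
      using \<open>n \<in> I k\<close> I by (simp add: fourier_coeff_diff f s) (simp add: s_def trig_poly_fourier_coeff)
    then have "(cmod (fourier_coeff f n - c n))\<^sup>2 \<le> (L2_norm (\<lambda>z. f z - s k z))\<^sup>2"
      using Bessel[OF L2_diff[OF f(1) s[of k]], of "{n}"] by simp
    ultimately show False
      using e unfolding e_def by linarith
  qed
  then show ?thesis
    using f by blast
qed

lemma L2_norm_cong_AE:
  assumes "f \<in> borel_measurable borel" "h \<in> borel_measurable borel" "AE z in circle. f z = h z"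
  shows "L2_norm f = L2_norm (h :: complex \<Rightarrow> complex)"
proof -
  have "(\<integral>z. (cmod (f z))\<^sup>2 \<partial>circle) = (\<integral>z. (cmod (h z))\<^sup>2 \<partial>circle)"
    using assms by (intro integral_cong_AE) auto
  then show ?thesis
    by (simp add: L2_norm_def)
qed

text \<open>Riesz-Fischer produces a function with the same coefficients and the desired norm bound,
  and uniqueness identifies it with \<open>f\<close>.\<close>

lemma Parseval_le:
  assumes f: "f \<in> L2" and bound: "\<And>A. finite A \<Longrightarrow> (\<Sum>n\<in>A. (cmod (fourier_coeff f n))\<^sup>2) \<le> K"
  shows "(L2_norm f)\<^sup>2 \<le> K"
proof -
  obtain h where h: "h \<in> L2" "\<And>n. fourier_coeff h n = fourier_coeff f n" "(L2_norm h)\<^sup>2 \<le> K"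
    using Riesz_Fischer[OF bound] by blast
  have "AE z in circle. h z - f z = 0"
    using f h by (intro fourier_uniqueness L2_diff) (simp_all add: fourier_coeff_diff)
  then have "L2_norm h = L2_norm f"
    using f h by (intro L2_norm_cong_AE L2_measurable) auto
  then show ?thesis
    using h by simp
qed

text \<open>Every partial sum of \<open>h\<close> is orthogonal to \<open>u\<close>. A nonzero inner
  product would therefore keep all partial sums at a fixed distance from \<open>h\<close>, improving
  Bessel's bound by a fixed amount, against \<open>Parseval_le\<close>.\<close>

lemma L2_inner_eq_0_if_disjoint_spectrum:
  assumes "u \<in> L2" "h \<in> L2" and disj: "\<And>n. fourier_coeff u n = 0 \<or> fourier_coeff h n = 0"
  shows "L2_inner u h = 0"
proof (rule ccontr)
  assume neq: "L2_inner u h \<noteq> 0"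
  define d where "d = cmod (L2_inner u h)"
  have d: "0 < d"
    using neq by (simp add: d_def)
  then have u: "0 < L2_norm u"
    using L2_Cauchy_Schwarz[OF assms(1,2)] L2_norm_nonneg[of u] by (cases "L2_norm u = 0") (auto simp: d_def)
  have "(\<Sum>n\<in>A. (cmod (fourier_coeff h n))\<^sup>2) \<le> (L2_norm h)\<^sup>2 - (d / L2_norm u)\<^sup>2" if "finite A" for A
  proof -
    define p where "p = trig_poly A (fourier_coeff h)"
    have p: "p \<in> L2"
      by (simp add: p_def trig_poly_L2)
    have "L2_inner u p = 0"
      unfolding p_def L2_inner_trig_poly[OF assms(1)] using disj by (intro sum.neutral) auto
    then have "d = cmod (L2_inner u (\<lambda>z. h z - p z))"
      using assms p by (simp add: d_def L2_inner_diff_right)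
    also have "\<dots> \<le> L2_norm u * L2_norm (\<lambda>z. h z - p z)"
      using assms p by (intro L2_Cauchy_Schwarz L2_diff)
    finally have "d / L2_norm u \<le> L2_norm (\<lambda>z. h z - p z)"
      using u by (simp add: pos_divide_le_eq mult.commute)
    then have "(d / L2_norm u)\<^sup>2 \<le> (L2_norm (\<lambda>z. h z - p z))\<^sup>2"
      using d u by (intro power_mono) auto
    then show ?thesis
      using L2_norm_diff_partial_sum[OF assms(2) that] by (simp add: p_def)
  qed
  from Parseval_le[OF assms(2) this] show False
    using d u by simp
qed

section \<open>Hardy spaces, orthogonal projections and model spaces\<close>

lemma H2_L2: "f \<in> H2 \<Longrightarrow> f \<in> L2"
  by (simp add: H2_def)

lemma Hinf_Linf: "f \<in> Hinf \<Longrightarrow> f \<in> Linf"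
  by (simp add: Hinf_def)

lemma H2_add: "f \<in> H2 \<Longrightarrow> h \<in> H2 \<Longrightarrow> (\<lambda>z. f z + h z) \<in> H2"
  by (simp add: H2_def L2_add fourier_coeff_add)

lemma H2_diff: "f \<in> H2 \<Longrightarrow> h \<in> H2 \<Longrightarrow> (\<lambda>z. f z - h z) \<in> H2"
  by (simp add: H2_def L2_diff fourier_coeff_diff)

lemma H2_cmult: "f \<in> H2 \<Longrightarrow> (\<lambda>z. c * f z) \<in> H2"
  by (simp add: H2_def L2_cmult fourier_coeff_cmult)

lemma zero_H2: "(\<lambda>z. 0) \<in> H2"
  using H2_cmult[of _ 0] by (simp add: H2_def const_L2 fourier_coeff_def)

lemma H2_sum: "(\<And>i. i \<in> A \<Longrightarrow> f i \<in> H2) \<Longrightarrow> (\<lambda>z. \<Sum>i\<in>A. f i z) \<in> H2"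
  by (induction A rule: infinite_finite_induct) (simp_all add: zero_H2 H2_add)

lemma L2_ominus_H2_iff:
  "f \<in> L2 \<ominus>\<^sub>L H2 \<longleftrightarrow> f \<in> L2 \<and> (\<forall>n\<ge>0. fourier_coeff f n = 0)"
proof
  assume f: "f \<in> L2 \<ominus>\<^sub>L H2"
  then have "f \<in> L2"
    by (simp add: L2_ominus_def)
  moreover have "(\<lambda>z. z powi n) \<in> H2" if "0 \<le> n" for n
    using that by (simp add: H2_def powi_L2 fourier_coeff_powi)
  ultimately show "f \<in> L2 \<and> (\<forall>n\<ge>0. fourier_coeff f n = 0)"
    using f by (simp add: L2_ominus_def fourier_coeff_eq_inner)
next
  assume "f \<in> L2 \<and> (\<forall>n\<ge>0. fourier_coeff f n = 0)"
  then show "f \<in> L2 \<ominus>\<^sub>L H2"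
    by (auto simp: L2_ominus_def H2_def intro!: L2_inner_eq_0_if_disjoint_spectrum)
      (meson not_le)
qed

text \<open>The coefficient of the product at \<open>n\<close> is the inner product of
  \<open>f\<close> with \<open>cnj (h z) * z powi n\<close>. For negative \<open>n\<close> that
  function has negative frequencies only, and \<open>f\<close> has none.\<close>

lemma Hinf_mult_H2:
  assumes h: "h \<in> Hinf" and f: "f \<in> H2"
  shows "(\<lambda>z. h z * f z) \<in> H2"
proof -
  have hL: "h \<in> Linf" and fL: "f \<in> L2"
    using assms by (simp_all add: Hinf_def H2_def)
  have "fourier_coeff (\<lambda>z. h z * f z) n = 0" if "n < 0" for n
  proof -
    define u where "u z = cnj (h z) * z powi n" for z
    have ch: "(\<lambda>z. cnj (h z)) \<in> L2"
      using hL by (intro L2_cnj Linf_subset_L2)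
    have u: "u \<in> L2"
      unfolding u_def[abs_def] using hL by (intro Linf_mult_L2 Linf_cnj powi_L2)
    have "fourier_coeff u m = 0" if "0 \<le> m" for m
    proof -
      have "fourier_coeff u m = fourier_coeff (\<lambda>z. cnj (h z)) (m - n)"
        unfolding u_def[abs_def] by (rule fourier_coeff_mult_powi[OF ch])
      also have "\<dots> = (\<integral>z. cnj (h z * z powi (m - n)) \<partial>circle)"
        unfolding fourier_coeff_def using cnj_powi_circle[of "m - n"] Linf_measurable[OF hL]
        by (intro integral_cong_AE) auto
      also have "\<dots> = cnj (fourier_coeff h (n - m))"
        unfolding Bochner_Integration.integral_cnj by (simp add: fourier_coeff_def)
      also have "\<dots> = 0"
        using h that \<open>n < 0\<close> by (simp add: Hinf_def)
      finally show ?thesis .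
    qed
    then have "L2_inner f u = 0"
      using f fL u by (intro L2_inner_eq_0_if_disjoint_spectrum) (auto simp: H2_def, meson not_le)
    moreover have "L2_inner f u = L2_inner (\<lambda>z. h z * f z) (\<lambda>z. z powi n)"
      by (simp add: L2_inner_def u_def mult.assoc mult.left_commute)
    ultimately show ?thesis
      using Linf_mult_L2[OF hL fL] by (simp add: fourier_coeff_eq_inner)
  qed
  then show ?thesis
    using Linf_mult_L2[OF hL fL] by (simp add: H2_def)
qed

text \<open>Dropping the coefficients of negative index preserves Bessel's bound, so Riesz-Fischer
  realizes the remaining ones.\<close>

lemma Riesz_projection_exists:
  assumes "f \<in> L2"
  shows "\<exists>p\<in>H2. (\<lambda>z. f z - p z) \<in> L2 \<ominus>\<^sub>L H2"
proof -
  have "(\<Sum>n\<in>A. (cmod (if 0 \<le> n then fourier_coeff f n else 0))\<^sup>2) \<le> (L2_norm f)\<^sup>2" if "finite A" for A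
    using Bessel[OF assms that] by (rule order_trans[rotated]) (intro sum_mono, simp)
  from Riesz_Fischer[OF this] obtain p where p: "p \<in> L2"
      "\<And>n. fourier_coeff p n = (if 0 \<le> n then fourier_coeff f n else 0)"
    by blast
  then have "p \<in> H2"
    by (simp add: H2_def)
  moreover have "(\<lambda>z. f z - p z) \<in> L2 \<ominus>\<^sub>L H2"
    using assms p by (simp add: L2_ominus_H2_iff L2_diff fourier_coeff_diff)
  ultimately show ?thesis
    by blast
qed

text \<open>The property for which \<open>orth_proj\<close> picks a witness. Once any witness is
  exhibited the chosen one has the property too, and in L2 two witnesses agree almost everywhere, so
  norms can be computed with a convenient one.\<close>

definition is_orth_proj ::
  "((complex \<Rightarrow> 'a::minus) \<Rightarrow> (complex \<Rightarrow> 'a) \<Rightarrow> complex) \<Rightarrow> (complex \<Rightarrow> 'a) set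
    \<Rightarrow> (complex \<Rightarrow> 'a) \<Rightarrow> (complex \<Rightarrow> 'a) \<Rightarrow> bool" where
  "is_orth_proj ip S f p \<longleftrightarrow> p \<in> S \<and> (\<forall>s\<in>S. ip (\<lambda>z. f z - p z) s = 0)"

lemma is_orth_proj_orth_proj:
  assumes "is_orth_proj ip S f p"
  shows "is_orth_proj ip S f (orth_proj ip S f)"
  unfolding orth_proj_def is_orth_proj_def[symmetric] using assms by (rule someI[of "is_orth_proj ip S f"])

abbreviation L2_proj ::
  "(complex \<Rightarrow> complex) set \<Rightarrow> (complex \<Rightarrow> complex) \<Rightarrow> (complex \<Rightarrow> complex) \<Rightarrow> bool" where
  "L2_proj \<equiv> is_orth_proj L2_inner"

lemma L2_proj_unique:
  assumes "L2_proj S f p" "L2_proj S f p'" "S \<subseteq> L2" "f \<in> L2"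
  shows "AE z in circle. p z = p' z"
proof -
  have p: "p \<in> L2" "p' \<in> L2" "p \<in> S" "p' \<in> S"
    using assms by (auto simp: is_orth_proj_def)
  have "L2_inner (\<lambda>z. p z - p' z) s = 0" if "s \<in> S" for s
  proof -
    have "L2_inner f s - L2_inner p s = 0" "L2_inner f s - L2_inner p' s = 0"
      using assms p that
      by (auto simp: is_orth_proj_def subset_iff L2_inner_diff_left[symmetric])
    then show ?thesis
      using p that assms(3) by (subst L2_inner_diff_left) auto
  qed
  then have "L2_inner (\<lambda>z. p z - p' z) (\<lambda>z. p z - p' z) = 0"
    using p by (subst L2_inner_diff_right) (auto intro: L2_diff)
  then have "L2_norm (\<lambda>z. p z - p' z) = 0"
    by (simp add: L2_inner_self)
  then have "AE z in circle. p z - p' z = 0"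
    using p by (intro L2_norm_eq_0 L2_diff)
  then show ?thesis
    by simp
qed

lemma L2_proj_norm_unique:
  assumes "L2_proj S f p" "L2_proj S f p'" "S \<subseteq> L2" "f \<in> L2"
  shows "L2_norm p = L2_norm p'"
  using assms L2_proj_unique[OF assms]
  by (intro L2_norm_cong_AE L2_measurable) (auto simp: is_orth_proj_def)

lemma L2_proj_norm_le:
  assumes "L2_proj S f p" "S \<subseteq> L2" "f \<in> L2"
  shows "L2_norm p \<le> L2_norm f"
proof (rule power2_le_imp_le)
  have p: "p \<in> L2"
    using assms by (auto simp: is_orth_proj_def)
  have d: "(\<lambda>z. f z - p z) \<in> L2"
    using assms p by (intro L2_diff)
  have "L2_inner (\<lambda>z. f z - p z) p = 0"
    using assms by (simp add: is_orth_proj_def)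
  then have "(L2_norm (\<lambda>z. f z - p z + 1 * p z))\<^sup>2 = (L2_norm (\<lambda>z. f z - p z))\<^sup>2 + (L2_norm p)\<^sup>2"
    by (subst L2_norm_add_mult_square[OF d p]) simp
  then show "(L2_norm p)\<^sup>2 \<le> (L2_norm f)\<^sup>2"
    by simp
qed (rule L2_norm_nonneg)

lemma L2_proj_add:
  assumes "L2_proj S f p" "L2_proj S f' p'" "S \<subseteq> L2" "f \<in> L2" "f' \<in> L2"
    "(\<lambda>z. p z + p' z) \<in> S"
  shows "L2_proj S (\<lambda>z. f z + f' z) (\<lambda>z. p z + p' z)"
  unfolding is_orth_proj_def
proof (intro conjI ballI assms)
  fix s
  assume s: "s \<in> S"
  have "L2_inner (\<lambda>z. (f z - p z) + (f' z - p' z)) s = 0"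
    using assms s by (subst L2_inner_add_left) (auto simp: is_orth_proj_def subset_iff intro: L2_diff)
  then show "L2_inner (\<lambda>z. f z + f' z - (p z + p' z)) s = 0"
    by (simp add: algebra_simps)
qed

lemma L2_proj_add_orthogonal:
  assumes "L2_proj S f p" "S \<subseteq> L2" "f \<in> L2" "h \<in> L2" "\<And>s. s \<in> S \<Longrightarrow> L2_inner h s = 0"
  shows "L2_proj S (\<lambda>z. f z + h z) p"
  unfolding is_orth_proj_def
proof (intro conjI ballI)
  show p: "p \<in> S"
    using assms by (simp add: is_orth_proj_def)
  fix s
  assume s: "s \<in> S"
  have "L2_inner (\<lambda>z. (f z - p z) + h z) s = 0"
    using assms s p by (subst L2_inner_add_left) (auto simp: is_orth_proj_def subset_iff intro: L2_diff)
  then show "L2_inner (\<lambda>z. f z + h z - p z) s = 0"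
    by (simp add: algebra_simps)
qed

lemma L2_inner_mult_left: "L2_inner (\<lambda>z. u z * f z) h = L2_inner f (\<lambda>z. cnj (u z) * h z)"
  by (simp add: L2_inner_def mult.assoc mult.left_commute)

lemma unimodular_mult_cnj:
  assumes "unimodular u"
  shows "AE z in circle. cnj (u z) * (u z * w) = w" "AE z in circle. u z * (cnj (u z) * w) = w"
proof -
  have *: "cnj a * (a * w) = w" "a * (cnj a * w) = w" if "cmod a = 1" for a w
    using that complex_norm_square[of a] by (simp_all add: mult.assoc[symmetric] mult.commute)
  show "AE z in circle. cnj (u z) * (u z * w) = w"
    using assms unfolding unimodular_def by eventually_elim (rule *)
  show "AE z in circle. u z * (cnj (u z) * w) = w"
    using assms unfolding unimodular_def by eventually_elim (rule *)
qed

lemma L2_inner_unimodular: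
  assumes "unimodular u" "u \<in> Linf" "f \<in> L2" "h \<in> L2"
  shows "L2_inner (\<lambda>z. u z * f z) (\<lambda>z. u z * h z) = L2_inner f h"
proof -
  note [measurable] = Linf_measurable[OF assms(2)] L2_measurable[OF assms(3)] L2_measurable[OF assms(4)]
  have "AE z in circle. u z * f z * cnj (u z * h z) = f z * cnj (h z)"
    using unimodular_mult_cnj(2)[OF assms(1), of 1] by eventually_elim (simp add: algebra_simps)
  then show ?thesis
    unfolding L2_inner_def by (intro integral_cong_AE) auto
qed

lemma L2_norm_unimodular:
  assumes "unimodular u" "u \<in> Linf" "f \<in> L2"
  shows "L2_norm (\<lambda>z. u z * f z) = L2_norm f"
proof -
  note [measurable] = Linf_measurable[OF assms(2)] L2_measurable[OF assms(3)]
  have "(\<integral>z. (cmod (u z * f z))\<^sup>2 \<partial>circle) = (\<integral>z. (cmod (f z))\<^sup>2 \<partial>circle)"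
    using assms(1) unfolding unimodular_def
    by (intro integral_cong_AE) (auto simp: norm_mult elim!: eventually_mono)
  then show ?thesis
    by (simp add: L2_norm_def)
qed

lemma unimodular_cnj: "unimodular u \<Longrightarrow> unimodular (\<lambda>z. cnj (u z))"
  by (simp add: unimodular_def)

lemma L2_proj_L2_ominus_H2:
  assumes "a \<in> H2" "(\<lambda>z. f z - a z) \<in> L2 \<ominus>\<^sub>L H2"
  shows "L2_proj (L2 \<ominus>\<^sub>L H2) f (\<lambda>z. f z - a z)"
  unfolding is_orth_proj_def
proof (intro conjI ballI assms)
  fix s
  assume "s \<in> L2 \<ominus>\<^sub>L H2"
  then have "L2_inner s a = 0"
    using assms by (simp add: L2_ominus_def)
  then show "L2_inner (\<lambda>z. f z - (f z - a z)) s = 0"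
    using L2_inner_commute[of a s] by simp
qed

lemma L2_proj_L2_ominus_H2_exists:
  assumes "f \<in> L2"
  shows "\<exists>p. L2_proj (L2 \<ominus>\<^sub>L H2) f p"
  using Riesz_projection_exists[OF assms] L2_proj_L2_ominus_H2 by blast

section \<open>Model spaces and their projections\<close>

lemma model_space_H2: "f \<in> model_space \<theta> \<Longrightarrow> f \<in> H2"
  by (simp add: model_space_def L2_ominus_def)

lemma model_space_subset_L2: "model_space \<theta> \<subseteq> L2"
  using model_space_H2 H2_L2 by blast

lemma inner_function_Linf: "inner_function \<theta> \<Longrightarrow> \<theta> \<in> Linf"
  by (simp add: inner_function_def Hinf_def)

text \<open>Multiplication by \<open>\<theta>\<close> moves across the inner product as its
  conjugate. Membership thereby becomes a condition on frequencies.\<close>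

lemma model_space_iff:
  assumes "inner_function \<theta>"
  shows "f \<in> model_space \<theta> \<longleftrightarrow> f \<in> H2 \<and> (\<lambda>z. cnj (\<theta> z) * f z) \<in> L2 \<ominus>\<^sub>L H2"
proof -
  have "L2_inner f (\<lambda>z. \<theta> z * h z) = L2_inner (\<lambda>z. cnj (\<theta> z) * f z) h" for h
    by (simp add: L2_inner_mult_left)
  moreover have "(\<lambda>z. cnj (\<theta> z) * f z) \<in> L2" if "f \<in> H2"
    using Linf_mult_L2[OF Linf_cnj[OF inner_function_Linf[OF assms]] H2_L2[OF that]] .
  ultimately show ?thesis
    by (auto simp: model_space_def L2_ominus_def mult_space_def)
qed

lemma model_space_add: "f \<in> model_space \<theta> \<Longrightarrow> h \<in> model_space \<theta> \<Longrightarrow> \<theta> \<in> Linf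
  \<Longrightarrow> (\<lambda>z. f z + h z) \<in> model_space \<theta>"
  by (auto simp: model_space_def L2_ominus_def mult_space_def H2_add H2_L2 Linf_mult_L2 L2_inner_add_left)

lemma model_space_orthogonal:
  assumes "s \<in> model_space \<theta>" "h \<in> H2"
  shows "L2_inner (\<lambda>z. \<theta> z * h z) s = 0"
  using assms L2_inner_commute[of "\<lambda>z. \<theta> z * h z" s]
  by (simp add: model_space_def L2_ominus_def mult_space_def)

text \<open>Here \<open>a\<close> is the analytic part of \<open>cnj (\<theta> z) * u z\<close>.
  Multiplying the candidate by \<open>cnj (\<theta> z)\<close> leaves the antianalytic part, which
  places it in the model space and gives its norm; it differs from \<open>u\<close> by an element of
  \<open>\<theta> H2\<close>, which the model space does not see.\<close>

lemma model_space_proj: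
  assumes \<theta>: "inner_function \<theta>" and u: "u \<in> H2"
    and a: "a \<in> H2" "(\<lambda>z. cnj (\<theta> z) * u z - a z) \<in> L2 \<ominus>\<^sub>L H2"
  shows "L2_proj (model_space \<theta>) u (\<lambda>z. u z - \<theta> z * a z)"
    and "L2_norm (\<lambda>z. u z - \<theta> z * a z) = L2_norm (\<lambda>z. cnj (\<theta> z) * u z - a z)"
proof -
  have uni: "unimodular \<theta>" and hinf: "\<theta> \<in> Hinf" and linf: "\<theta> \<in> Linf"
    using \<theta> by (simp_all add: inner_function_def Hinf_def)
  note meas [measurable] = Linf_measurable[OF linf] L2_measurable[OF H2_L2[OF u]] L2_measurable[OF H2_L2[OF a(1)]]
  have p: "(\<lambda>z. u z - \<theta> z * a z) \<in> H2"
    using u a hinf by (intro H2_diff Hinf_mult_H2)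
  have L: "(\<lambda>z. cnj (\<theta> z) * (u z - \<theta> z * a z)) \<in> L2"
    using linf p by (intro Linf_mult_L2 Linf_cnj H2_L2)
  have ae: "AE z in circle. cnj (\<theta> z) * u z - a z = cnj (\<theta> z) * (u z - \<theta> z * a z)"
    using unimodular_mult_cnj(1)[OF uni, of 1] by eventually_elim (simp add: algebra_simps)
  have "fourier_coeff (\<lambda>z. cnj (\<theta> z) * (u z - \<theta> z * a z)) n = fourier_coeff (\<lambda>z. cnj (\<theta> z) * u z - a z) n" for n
    unfolding fourier_coeff_def using ae by (intro integral_cong_AE) auto
  then have "(\<lambda>z. cnj (\<theta> z) * (u z - \<theta> z * a z)) \<in> L2 \<ominus>\<^sub>L H2"
    using a(2) L by (simp add: L2_ominus_H2_iff)
  then have K: "(\<lambda>z. u z - \<theta> z * a z) \<in> model_space \<theta>"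
    using p by (simp add: model_space_iff[OF \<theta>])
  then show "L2_proj (model_space \<theta>) u (\<lambda>z. u z - \<theta> z * a z)"
    unfolding is_orth_proj_def using model_space_orthogonal[OF _ a(1)] by simp
  have "L2_norm (\<lambda>z. u z - \<theta> z * a z) = L2_norm (\<lambda>z. cnj (\<theta> z) * (u z - \<theta> z * a z))"
    using uni linf p by (intro L2_norm_unimodular[symmetric] unimodular_cnj Linf_cnj H2_L2)
  also have "\<dots> = L2_norm (\<lambda>z. cnj (\<theta> z) * u z - a z)"
    using ae by (intro L2_norm_cong_AE) auto
  finally show "L2_norm (\<lambda>z. u z - \<theta> z * a z) = L2_norm (\<lambda>z. cnj (\<theta> z) * u z - a z)" .
qed

lemma model_space_proj_exists:
  assumes \<theta>: "inner_function \<theta>" and u: "u \<in> H2"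
  shows "\<exists>a\<in>H2. L2_proj (model_space \<theta>) u (\<lambda>z. u z - \<theta> z * a z)"
proof -
  have "(\<lambda>z. cnj (\<theta> z) * u z) \<in> L2"
    using \<theta> u by (intro Linf_mult_L2 Linf_cnj H2_L2 inner_function_Linf)
  then show ?thesis
    using Riesz_projection_exists model_space_proj(1)[OF \<theta> u] by blast
qed

text \<open>This exchanges the model space projection for the antianalytic one whichever
  representatives \<open>p\<close> and \<open>q\<close> were chosen.\<close>

lemma model_space_proj_norm_eq:
  assumes \<theta>: "inner_function \<theta>" and u: "u \<in> H2"
    and p: "L2_proj (model_space \<theta>) u p"
    and q: "L2_proj (L2 \<ominus>\<^sub>L H2) (\<lambda>z. cnj (\<theta> z) * u z) q"
  shows "L2_norm p = L2_norm q"
proof -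
  have L: "(\<lambda>z. cnj (\<theta> z) * u z) \<in> L2"
    using \<theta> u by (intro Linf_mult_L2 Linf_cnj H2_L2 inner_function_Linf)
  obtain a where a: "a \<in> H2" "(\<lambda>z. cnj (\<theta> z) * u z - a z) \<in> L2 \<ominus>\<^sub>L H2"
    using Riesz_projection_exists[OF L] by blast
  have "L2_norm p = L2_norm (\<lambda>z. u z - \<theta> z * a z)"
    by (rule L2_proj_norm_unique[OF p model_space_proj(1)[OF \<theta> u a] model_space_subset_L2 H2_L2[OF u]])
  also have "\<dots> = L2_norm (\<lambda>z. cnj (\<theta> z) * u z - a z)"
    by (rule model_space_proj(2)[OF \<theta> u a])
  also have "\<dots> = L2_norm q"
    by (rule L2_proj_norm_unique[OF L2_proj_L2_ominus_H2[OF a] q _ L]) (auto simp: L2_ominus_def)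
  finally show ?thesis .
qed

section \<open>Vector-valued functions and Hankel operators\<close>

lemma L2_vec_proj_iff:
  fixes f p :: "complex \<Rightarrow> complex^'n"
  assumes zero: "(\<lambda>z. 0) \<in> S"
  shows "is_orth_proj L2_vec_inner (vec_space S) f p
    \<longleftrightarrow> (\<forall>i. L2_proj S (\<lambda>z. f z $ i) (\<lambda>z. p z $ i))"
proof
  assume p: "is_orth_proj L2_vec_inner (vec_space S) f p"
  show "\<forall>i. L2_proj S (\<lambda>z. f z $ i) (\<lambda>z. p z $ i)"
    unfolding is_orth_proj_def
  proof (intro allI conjI ballI)
    fix i
    show "(\<lambda>z. p z $ i) \<in> S"
      using p by (simp add: is_orth_proj_def vec_space_def)
    fix s
    assume s: "s \<in> S"
    \<comment> \<open>A test vector with one nonzero coordinate; it belongs to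
      \<open>vec_space S\<close> because \<open>S\<close> contains zero.\<close>
    define v :: "complex \<Rightarrow> complex^'n" where "v z = (\<chi> j. if j = i then s z else 0)" for z
    have v_nth: "(\<lambda>z. v z $ j) = (if j = i then s else (\<lambda>z. 0))" for j
      by (auto simp: v_def)
    have "v \<in> vec_space S"
      using s zero by (simp add: vec_space_def v_nth)
    then have "L2_vec_inner (\<lambda>z. f z - p z) v = 0"
      using p by (simp add: is_orth_proj_def)
    moreover have "L2_inner (\<lambda>z. (f z - p z) $ j) (\<lambda>z. v z $ j)
        = (if j = i then L2_inner (\<lambda>z. f z $ i - p z $ i) s else 0)" for j
      by (auto simp: v_nth L2_inner_def)
    ultimately show "L2_inner (\<lambda>z. f z $ i - p z $ i) s = 0"
      by (simp add: L2_vec_inner_def)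
  qed
next
  assume "\<forall>i. L2_proj S (\<lambda>z. f z $ i) (\<lambda>z. p z $ i)"
  then show "is_orth_proj L2_vec_inner (vec_space S) f p"
    by (simp add: is_orth_proj_def vec_space_def L2_vec_inner_def)
qed

lemma norm_vec_square: "(norm (x :: complex^'n))\<^sup>2 = (\<Sum>i\<in>UNIV. (cmod (x $ i))\<^sup>2)"
  by (simp add: norm_vec_def L2_set_def sum_nonneg)

lemma L2_vec_norm_square:
  fixes v :: "complex \<Rightarrow> complex^'n"
  assumes "v \<in> vec_space L2"
  shows "(L2_norm v)\<^sup>2 = (\<Sum>i\<in>UNIV. (L2_norm (\<lambda>z. v z $ i))\<^sup>2)"
  unfolding L2_norm_square norm_vec_square using assms
  by (intro Bochner_Integration.integral_sum L2_square_integrable) (simp add: vec_space_def)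

lemma vec_space_mono: "S \<subseteq> R \<Longrightarrow> vec_space S \<subseteq> vec_space R"
  by (auto simp: vec_space_def)

lemma vec_space_H2_L2: "v \<in> vec_space H2 \<Longrightarrow> v \<in> vec_space L2"
  by (simp add: vec_space_def H2_L2)

lemma matrix_vector_mult_nth: "((A :: complex^'n^'m) *v x) $ i = (\<Sum>j\<in>UNIV. A $ i $ j * x $ j)"
  by (simp add: matrix_vector_mult_def)

lemma mult_vec_L2:
  assumes "F \<in> mat_space Linf" "v \<in> vec_space L2"
  shows "(\<lambda>z. F z *v v z) \<in> vec_space L2"
  using assms unfolding vec_space_def mat_space_def
  by (auto simp: matrix_vector_mult_nth intro!: L2_sum Linf_mult_L2)

lemma mult_vec_H2:
  assumes "F \<in> mat_space Hinf" "v \<in> vec_space H2"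
  shows "(\<lambda>z. F z *v v z) \<in> vec_space H2"
  using assms unfolding vec_space_def mat_space_def
  by (auto simp: matrix_vector_mult_nth intro!: H2_sum Hinf_mult_H2)

lemma zero_L2_ominus_H2: "(\<lambda>z. 0) \<in> L2 \<ominus>\<^sub>L H2"
  by (simp add: L2_ominus_def const_L2 L2_inner_def)

lemma L2_ominus_H2_subset: "L2 \<ominus>\<^sub>L H2 \<subseteq> L2"
  by (auto simp: L2_ominus_def)

lemma hankel_proj:
  assumes "F \<in> mat_space Linf" "v \<in> vec_space L2"
  shows "L2_proj (L2 \<ominus>\<^sub>L H2) (\<lambda>z. (F z *v v z) $ i) (\<lambda>z. hankel F v z $ i)"
proof -
  have "\<exists>p. L2_proj (L2 \<ominus>\<^sub>L H2) (\<lambda>z. (F z *v v z) $ i) p" for i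
    using mult_vec_L2[OF assms] by (intro L2_proj_L2_ominus_H2_exists) (simp add: vec_space_def)
  then obtain p where "\<And>i. L2_proj (L2 \<ominus>\<^sub>L H2) (\<lambda>z. (F z *v v z) $ i) (p i)"
    by metis
  then have "is_orth_proj L2_vec_inner (vec_space (L2 \<ominus>\<^sub>L H2)) (\<lambda>z. F z *v v z) (\<lambda>z. \<chi> i. p i z)"
    by (simp add: L2_vec_proj_iff zero_L2_ominus_H2)
  then have "is_orth_proj L2_vec_inner (vec_space (L2 \<ominus>\<^sub>L H2)) (\<lambda>z. F z *v v z) (hankel F v)"
    unfolding hankel_def by (rule is_orth_proj_orth_proj)
  then show ?thesis
    by (simp add: L2_vec_proj_iff zero_L2_ominus_H2)
qed

lemma hankel_L2:
  assumes "F \<in> mat_space Linf" "v \<in> vec_space L2"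
  shows "hankel F v \<in> vec_space L2"
  using hankel_proj[OF assms] L2_ominus_H2_subset by (auto simp: is_orth_proj_def vec_space_def)

lemma L2_vec_proj_norm_le:
  assumes "\<And>i. L2_proj S (\<lambda>z. f z $ i) (\<lambda>z. p z $ i)" "S \<subseteq> L2" "f \<in> vec_space L2"
  shows "L2_norm p \<le> L2_norm (f :: complex \<Rightarrow> complex^'n)"
proof (rule power2_le_imp_le)
  have "p \<in> vec_space L2"
    using assms by (auto simp: vec_space_def is_orth_proj_def)
  then show "(L2_norm p)\<^sup>2 \<le> (L2_norm f)\<^sup>2"
    using assms L2_proj_norm_le[OF assms(1,2)]
    by (auto simp: L2_vec_norm_square vec_space_def L2_norm_nonneg intro!: sum_mono power_mono)
qed (rule L2_norm_nonneg)

section \<open>Essential norms of matrix symbols and the upper bound for Hankel operators\<close>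

lemma Linf_diff: "f \<in> Linf \<Longrightarrow> h \<in> Linf \<Longrightarrow> (\<lambda>z. f z - h z) \<in> Linf"
proof -
  assume fh: "f \<in> Linf" "h \<in> Linf"
  then obtain C D where "AE z in circle. cmod (f z) \<le> C" "AE z in circle. cmod (h z) \<le> D"
    by (auto simp: Linf_def)
  then have "AE z in circle. cmod (f z - h z) \<le> C + D"
    by eventually_elim (use norm_triangle_ineq4 in \<open>fastforce intro: order_trans\<close>)
  then show ?thesis
    using fh by (auto simp: Linf_def)
qed

lemma Linf_mat_norm_bound:
  fixes F :: "complex \<Rightarrow> complex^'n^'m"
  assumes "Linf_mat_norm F \<noteq> \<infinity>"
  obtains r where "Linf_mat_norm F = ereal r" "0 \<le> r"
    "AE z in circle. \<forall>x. norm (F z *v x) \<le> r * norm x"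
proof -
  have ae: "AE z in circle. ereal (onorm (\<lambda>x. F z *v x)) \<le> Linf_mat_norm F"
    unfolding Linf_mat_norm_def by (rule esssup_AE)
  \<comment> \<open>An almost sure property on a probability space holds at some point. There the
    operator norm is nonnegative, which excludes \<open>-\<infinity>\<close> and a negative
    \<open>r\<close>.\<close>
  then have "\<exists>z. ereal (onorm (\<lambda>x. F z *v x)) \<le> Linf_mat_norm F"
    using circle.AE_const[of False] by (metis (mono_tags, lifting) AE_mp eventually_mono)
  then obtain z0 where z0: "ereal (onorm (\<lambda>x. F z0 *v x)) \<le> Linf_mat_norm F"
    by blast
  moreover have "0 \<le> onorm (\<lambda>x. F z0 *v x)"
    by (intro onorm_pos_le matrix_vector_mul_bounded_linear)
  ultimately obtain r where r: "Linf_mat_norm F = ereal r" "0 \<le> r"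
    using assms by (cases "Linf_mat_norm F") auto
  have "AE z in circle. \<forall>x. norm (F z *v x) \<le> r * norm x"
    using ae unfolding r(1)
  proof eventually_elim
    case (elim z)
    have "norm (F z *v x) \<le> onorm (\<lambda>x. F z *v x) * norm x" for x
      by (intro onorm matrix_vector_mul_bounded_linear)
    then show ?case
      using elim by (meson ereal_less_eq(3) mult_right_mono norm_ge_zero order_trans)
  qed
  with r show thesis
    by (rule that)
qed

lemma L2_vec_square_integrable:
  fixes u :: "complex \<Rightarrow> complex^'n"
  assumes "u \<in> vec_space L2"
  shows "integrable circle (\<lambda>z. (norm (u z))\<^sup>2)"
  unfolding norm_vec_square using assms by (auto simp: vec_space_def L2_square_integrable)

lemma L2_norm_le_mult:
  fixes v :: "complex \<Rightarrow> complex^'n" and w :: "complex \<Rightarrow> complex^'m"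
  assumes "v \<in> vec_space L2" "w \<in> vec_space L2" "0 \<le> r" "AE z in circle. norm (w z) \<le> r * norm (v z)"
  shows "L2_norm w \<le> r * L2_norm v"
proof (rule power2_le_imp_le)
  have "(\<integral>z. (norm (w z))\<^sup>2 \<partial>circle) \<le> (\<integral>z. r\<^sup>2 * (norm (v z))\<^sup>2 \<partial>circle)"
  proof (rule integral_mono_AE)
    show "AE z in circle. (norm (w z))\<^sup>2 \<le> r\<^sup>2 * (norm (v z))\<^sup>2"
      using assms(4) by eventually_elim (auto simp: power_mult_distrib[symmetric] intro: power_mono)
  qed (use assms in \<open>auto intro: L2_vec_square_integrable\<close>)
  then show "(L2_norm w)\<^sup>2 \<le> (r * L2_norm v)\<^sup>2"
    by (simp add: power_mult_distrib L2_norm_square)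
qed (use assms in \<open>simp add: L2_norm_nonneg\<close>)

text \<open>The easy half of Nehari's theorem: an analytic \<open>G\<close> sends analytic vectors
  to analytic ones, so \<open>F - G\<close> and \<open>F\<close> have the same Hankel
  operator.\<close>

lemma hankel_norm_le_dist:
  fixes F :: "complex \<Rightarrow> complex^'n^'n"
  assumes F: "F \<in> mat_space Linf"
  shows "op_norm (vec_space H2) (hankel F) \<le> Linf_mat_dist F (mat_space Hinf)"
  unfolding op_norm_def Linf_mat_dist_def
proof (intro SUP_least INF_greatest)
  fix v :: "complex \<Rightarrow> complex^'n" and G :: "complex \<Rightarrow> complex^'n^'n"
  assume "v \<in> {v \<in> vec_space H2. L2_norm v \<le> 1}" and G: "G \<in> mat_space Hinf"
  then have v: "v \<in> vec_space H2" "L2_norm v \<le> 1"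
    by auto
  show "ereal (L2_norm (hankel F v)) \<le> Linf_mat_norm (\<lambda>z. F z - G z)"
  proof (cases "Linf_mat_norm (\<lambda>z. F z - G z) = \<infinity>")
    case False
    then obtain r where r: "Linf_mat_norm (\<lambda>z. F z - G z) = ereal r" "0 \<le> r"
        "AE z in circle. \<forall>x. norm ((F z - G z) *v x) \<le> r * norm x"
      using Linf_mat_norm_bound by blast
    have FG: "(\<lambda>z. F z - G z) \<in> mat_space Linf"
      using F G by (simp add: mat_space_def Linf_diff Hinf_Linf)
    have w: "(\<lambda>z. (F z - G z) *v v z) \<in> vec_space L2"
      using FG v by (intro mult_vec_L2 vec_space_H2_L2)
    have Gv: "(\<lambda>z. G z *v v z) \<in> vec_space H2"
      using G v by (intro mult_vec_H2)
    have "L2_proj (L2 \<ominus>\<^sub>L H2) (\<lambda>z. ((F z - G z) *v v z) $ i) (\<lambda>z. hankel F v z $ i)" for i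
    proof -
      have "L2_proj (L2 \<ominus>\<^sub>L H2) (\<lambda>z. (F z *v v z) $ i + (- 1) * (G z *v v z) $ i) (\<lambda>z. hankel F v z $ i)"
      proof (rule L2_proj_add_orthogonal[OF hankel_proj[OF F vec_space_H2_L2[OF v(1)]] L2_ominus_H2_subset])
        show "(\<lambda>z. (F z *v v z) $ i) \<in> L2"
          using mult_vec_L2[OF F vec_space_H2_L2[OF v(1)]] by (simp add: vec_space_def)
        have Gi: "(\<lambda>z. (G z *v v z) $ i) \<in> H2"
          using Gv by (simp add: vec_space_def)
        show "(\<lambda>z. - 1 * (G z *v v z) $ i) \<in> L2"
          using Gi by (intro L2_cmult H2_L2)
        show "L2_inner (\<lambda>z. - 1 * (G z *v v z) $ i) s = 0" if "s \<in> L2 \<ominus>\<^sub>L H2" for s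
          using that Gi L2_inner_commute[of "\<lambda>z. (G z *v v z) $ i" s]
          unfolding L2_inner_cmult_left by (simp add: L2_ominus_def)
      qed
      then show ?thesis
        by (simp add: matrix_vector_mult_diff_rdistrib)
    qed
    then have "L2_norm (hankel F v) \<le> L2_norm (\<lambda>z. (F z - G z) *v v z)"
      using w by (rule L2_vec_proj_norm_le[OF _ L2_ominus_H2_subset])
    also have "\<dots> \<le> r * L2_norm v"
      using r(2,3) w vec_space_H2_L2[OF v(1)] by (intro L2_norm_le_mult) auto
    also have "\<dots> \<le> r * 1"
      using r v by (intro mult_left_mono)
    finally show ?thesis
      by (simp add: r(1))
  qed simp
qed

text \<open>With a countable dense \<open>D\<close> the condition on the norm becomes countably
  many. This yields measurability of the pointwise operator norm and allows the exceptional null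
  sets of single vectors to be united.\<close>

lemma onorm_le_iff_dense:
  fixes A :: "complex^'n^'m"
  assumes dense: "\<And>X. open X \<Longrightarrow> X \<noteq> {} \<Longrightarrow> \<exists>d\<in>D. d \<in> X"
  shows "onorm (\<lambda>x. A *v x) \<le> c \<longleftrightarrow> (\<forall>d\<in>D. norm (A *v d) \<le> c * norm d)"
proof
  assume c: "onorm (\<lambda>x. A *v x) \<le> c"
  have "norm (A *v x) \<le> onorm (\<lambda>x. A *v x) * norm x" for x
    by (intro onorm matrix_vector_mul_bounded_linear)
  then show "\<forall>d\<in>D. norm (A *v d) \<le> c * norm d"
    using c by (meson mult_right_mono norm_ge_zero order_trans)
next
  assume *: "\<forall>d\<in>D. norm (A *v d) \<le> c * norm d"
  have "continuous_on UNIV (\<lambda>x. A *v x)"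
    by (intro linear_continuous_on matrix_vector_mul_bounded_linear)
  then have "open {x. c * norm x < norm (A *v x)}"
    by (intro open_Collect_less continuous_intros)
  then have "{x. c * norm x < norm (A *v x)} = {}"
    using dense[of "{x. c * norm x < norm (A *v x)}"] * by force
  then show "onorm (\<lambda>x. A *v x) \<le> c"
    by (intro onorm_le) (auto simp: not_less[symmetric])
qed

lemma Linf_mat_norm_leI:
  fixes F :: "complex \<Rightarrow> complex^'n^'m"
  assumes meas: "\<And>i j. (\<lambda>z. F z $ i $ j) \<in> borel_measurable borel"
    and bound: "\<And>x. AE z in circle. norm (F z *v x) \<le> r * norm x"
  shows "Linf_mat_norm F \<le> ereal r" "AE z in circle. onorm (\<lambda>x. F z *v x) \<le> r"
proof -
  obtain D :: "(complex^'n) set" where D: "countable D" "\<And>X. open X \<Longrightarrow> X \<noteq> {} \<Longrightarrow> \<exists>d\<in>D. d \<in> X"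
    using countable_dense_exists by blast
  note [measurable] = meas
  have [measurable]: "(\<lambda>z. norm (F z *v d)) \<in> borel_measurable borel" for d
    unfolding norm_vec_def L2_set_def matrix_vector_mult_nth by measurable
  have iff: "onorm (\<lambda>x. F z *v x) \<le> c \<longleftrightarrow> (\<forall>d\<in>D. norm (F z *v d) \<le> c * norm d)" for z c
    by (rule onorm_le_iff_dense) (rule D(2))
  have "{z \<in> space borel. onorm (\<lambda>x. F z *v x) \<le> c} \<in> sets borel" for c
    unfolding iff using D(1) by (intro sets.sets_Collect_countable_All') measurable
  then have "(\<lambda>z. onorm (\<lambda>x. F z *v x)) \<in> borel_measurable borel"
    unfolding borel_measurable_iff_le by blast
  moreover have "AE z in circle. \<forall>d\<in>D. norm (F z *v d) \<le> r * norm d"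
    using D(1) bound by (simp add: AE_ball_countable)
  then show ae: "AE z in circle. onorm (\<lambda>x. F z *v x) \<le> r"
    by (simp add: iff)
  ultimately show "Linf_mat_norm F \<le> ereal r"
    unfolding Linf_mat_norm_def by (intro esssup_I) auto
qed

section \<open>The matrix Nehari theorem\<close>

lemma L2_proj_cmult:
  assumes "L2_proj S f p" "(\<lambda>z. c * p z) \<in> S"
  shows "L2_proj S (\<lambda>z. c * f z) (\<lambda>z. c * p z)"
  using assms unfolding is_orth_proj_def
  by (simp add: L2_inner_cmult_left flip: right_diff_distrib)

lemma L2_norm_cmult_vec:
  fixes v :: "complex \<Rightarrow> complex^'n"
  shows "L2_norm (\<lambda>z. c *s v z) = cmod c * L2_norm v"
proof -
  have "(norm (c *s x))\<^sup>2 = (cmod c)\<^sup>2 * (norm x)\<^sup>2" for x :: "complex^'n"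
    by (simp add: norm_vec_square norm_mult power_mult_distrib sum_distrib_left)
  then show ?thesis
    by (simp add: L2_norm_def real_sqrt_mult)
qed

lemma op_norm_nonneg:
  assumes "v \<in> S" "L2_norm v \<le> 1"
  shows "0 \<le> op_norm S T"
proof -
  have "ereal (L2_norm (T v)) \<le> op_norm S T"
    unfolding op_norm_def using assms by (intro SUP_upper) simp
  then show ?thesis
    by (rule order_trans[rotated]) (simp add: L2_norm_nonneg)
qed

lemma zero_vec_space_H2: "(\<lambda>z. 0 :: complex^'n) \<in> vec_space H2"
  by (simp add: vec_space_def zero_H2)

lemma op_norm_hankel_nonneg:
  "0 \<le> op_norm (vec_space H2) (hankel F)"
  by (rule op_norm_nonneg[OF zero_vec_space_H2]) (simp add: L2_norm_def)

lemma hankel_norm_cmult: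
  fixes F :: "complex \<Rightarrow> complex^'n^'n"
  assumes F: "F \<in> mat_space Linf" and v: "v \<in> vec_space L2"
  shows "L2_norm (hankel F (\<lambda>z. c *s v z)) = cmod c * L2_norm (hankel F v)"
proof -
  have cv: "(\<lambda>z. c *s v z) \<in> vec_space L2"
    using v by (simp add: vec_space_def L2_cmult)
  have "L2_norm (\<lambda>z. hankel F (\<lambda>z. c *s v z) z $ i) = L2_norm (\<lambda>z. c * hankel F v z $ i)" for i
  proof (rule L2_proj_norm_unique[OF hankel_proj[OF F cv] _ L2_ominus_H2_subset])
    have "(\<lambda>z. hankel F v z $ i) \<in> L2 \<ominus>\<^sub>L H2"
      using hankel_proj[OF F v, of i] by (simp add: is_orth_proj_def)
    then have "(\<lambda>z. c * hankel F v z $ i) \<in> L2 \<ominus>\<^sub>L H2"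
      by (simp add: L2_ominus_H2_iff L2_cmult fourier_coeff_cmult)
    then have "L2_proj (L2 \<ominus>\<^sub>L H2) (\<lambda>z. c * (F z *v v z) $ i) (\<lambda>z. c * hankel F v z $ i)"
      by (intro L2_proj_cmult hankel_proj F v)
    then show "L2_proj (L2 \<ominus>\<^sub>L H2) (\<lambda>z. (F z *v (c *s v z)) $ i) (\<lambda>z. c * hankel F v z $ i)"
      by (simp add: matrix_vector_mult_nth sum_distrib_left mult.left_commute)
    show "(\<lambda>z. (F z *v (c *s v z)) $ i) \<in> L2"
      using mult_vec_L2[OF F cv] by (simp add: vec_space_def)
  qed
  then have "(L2_norm (hankel F (\<lambda>z. c *s v z)))\<^sup>2 = (L2_norm (\<lambda>z. c *s hankel F v z))\<^sup>2"
    using hankel_L2[OF F cv] hankel_L2[OF F v]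
    by (subst (1 2) L2_vec_norm_square) (auto simp: vec_space_def L2_cmult)
  then show ?thesis
    by (simp add: L2_norm_cmult_vec L2_norm_nonneg power2_eq_iff_nonneg)
qed

lemma hankel_norm_le:
  fixes F :: "complex \<Rightarrow> complex^'n^'n"
  assumes F: "F \<in> mat_space Linf" and N: "op_norm (vec_space H2) (hankel F) = ereal N"
    and v: "v \<in> vec_space H2"
  shows "L2_norm (hankel F v) \<le> N * L2_norm v"
proof (rule field_le_epsilon)
  fix e :: real
  assume e: "0 < e"
  have N0: "0 \<le> N"
    using op_norm_hankel_nonneg[of F] by (simp add: N)
  \<comment> \<open>Dividing by \<open>L2_norm v + d\<close> instead of \<open>L2_norm v\<close>
    covers vectors of norm zero; the loss \<open>N * d\<close> stays below \<open>e\<close>.\<close>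
  define d where "d = e / (N + 1)"
  have d: "0 < d" "N * d \<le> e"
    using e N0 by (auto simp: d_def field_simps)
  define t where "t = 1 / (L2_norm v + d)"
  have t: "0 < t" "t * (L2_norm v + d) = 1"
    using d L2_norm_nonneg[of v] by (auto simp: t_def)
  define w where "w z = complex_of_real t *s v z" for z
  have "w \<in> vec_space H2"
    using v by (simp add: w_def vec_space_def H2_cmult)
  moreover have "L2_norm w \<le> 1"
  proof -
    have "L2_norm w = t * L2_norm v"
      using t by (simp add: w_def[abs_def] L2_norm_cmult_vec)
    also have "\<dots> \<le> t * (L2_norm v + d)"
      using t d by (intro mult_left_mono) auto
    finally show ?thesis
      using t by simp
  qed
  ultimately have "ereal (L2_norm (hankel F w)) \<le> ereal N"
    unfolding N[symmetric] op_norm_def by (intro SUP_upper) simp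
  moreover have "L2_norm (hankel F w) = t * L2_norm (hankel F v)"
    unfolding w_def[abs_def] using F v t by (simp add: hankel_norm_cmult vec_space_H2_L2)
  ultimately have "t * L2_norm (hankel F v) \<le> t * (N * (L2_norm v + d))"
    using t by (simp add: mult.left_commute[of t])
  then have "L2_norm (hankel F v) \<le> N * (L2_norm v + d)"
    using t by simp
  then show "L2_norm (hankel F v) \<le> N * L2_norm v + e"
    using d by (simp add: distrib_left)
qed

section \<open>Multiplication by a symbol as a block Laurent matrix\<close>

lemma fourier_coeff_mult_trig_vec:
  fixes F :: "complex \<Rightarrow> complex^'n^'n"
  assumes "F \<in> mat_space L2"
  shows "fourier_coeff (\<lambda>z. (F z *v (\<chi> j. trig_poly Q (\<lambda>n. y (n, j)) z)) $ i) r
    = (\<Sum>p\<in>Q \<times> UNIV. block_toeplitz (\<lambda>k i j. fourier_coeff (\<lambda>z. F z $ i $ j) k) (r, i) p * y p)"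
proof -
  have F: "(\<lambda>z. F z $ i $ j) \<in> L2" for j
    using assms by (simp add: mat_space_def)
  have "(\<lambda>z. F z $ i $ j * trig_poly Q (\<lambda>n. y (n, j)) z) \<in> L2" for j
    by (simp add: mult.commute[of "F _ $ _ $ _"] Linf_mult_L2 trig_poly_Linf F)
  then have "fourier_coeff (\<lambda>z. (F z *v (\<chi> j. trig_poly Q (\<lambda>n. y (n, j)) z)) $ i) r
      = (\<Sum>j\<in>UNIV. \<Sum>n\<in>Q. y (n, j) * fourier_coeff (\<lambda>z. F z $ i $ j) (r - n))"
    by (simp add: matrix_vector_mult_nth fourier_coeff_sum fourier_coeff_mult_trig_poly F)
  also have "\<dots> = (\<Sum>n\<in>Q. \<Sum>j\<in>UNIV. y (n, j) * fourier_coeff (\<lambda>z. F z $ i $ j) (r - n))"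
    by (rule sum.swap)
  finally show ?thesis
    by (simp add: sum.cartesian_product block_toeplitz_def case_prod_unfold mult.commute)
qed

lemma trig_vec_norm:
  fixes y :: "int \<times> 'n::finite \<Rightarrow> complex"
  assumes "finite Q"
  shows "(L2_norm (\<lambda>z. \<chi> j. trig_poly Q (\<lambda>n. y (n, j)) z))\<^sup>2 = (\<Sum>p\<in>Q \<times> UNIV. (cmod (y p))\<^sup>2)"
proof -
  have "(L2_norm (\<lambda>z. \<chi> j. trig_poly Q (\<lambda>n. y (n, j)) z))\<^sup>2
      = (\<Sum>j\<in>UNIV. \<Sum>n\<in>Q. (cmod (y (n, j)))\<^sup>2)"
    using assms by (subst L2_vec_norm_square) (auto simp: vec_space_def trig_poly_L2 trig_poly_norm)
  also have "\<dots> = (\<Sum>n\<in>Q. \<Sum>j\<in>UNIV. (cmod (y (n, j)))\<^sup>2)"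
    by (rule sum.swap)
  finally show ?thesis
    by (simp add: sum.cartesian_product case_prod_unfold)
qed

text \<open>At negative indices \<open>hankel F v\<close> has the same coefficients as
  \<open>F v\<close>. For a trigonometric vector \<open>v\<close> these are the rows of the block
  matrix applied to the coefficients of \<open>v\<close>, and Bessel's inequality bounds them by the
  norm of the image.\<close>

lemma hankel_matrix_bound:
  fixes F :: "complex \<Rightarrow> complex^'n^'n"
  assumes F: "F \<in> mat_space Linf" and N: "op_norm (vec_space H2) (hankel F) = ereal N"
  shows "matrix_bound (block_toeplitz (\<lambda>k i j. fourier_coeff (\<lambda>z. F z $ i $ j) k)) N
    ({..<0} \<times> UNIV) ({0..} \<times> UNIV)"
  unfolding matrix_bound_def
proof (intro allI impI, elim conjE)
  fix A B :: "(int \<times> 'n) set" and x :: "int \<times> 'n \<Rightarrow> complex"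
  assume A: "finite A" "A \<subseteq> {..<0} \<times> UNIV" and B: "finite B" "B \<subseteq> {0..} \<times> UNIV"
  define T where "T = block_toeplitz (\<lambda>k i j. fourier_coeff (\<lambda>z. F z $ i $ j) k)"
  \<comment> \<open>The sections are enlarged to products with all coordinates, as needed to read
    them as vector functions; \<open>y\<close> extends \<open>x\<close> by zero.\<close>
  define P Q where "P = fst ` A" and "Q = fst ` B"
  have PQ: "finite P" "finite Q" "A \<subseteq> P \<times> UNIV" "B \<subseteq> Q \<times> UNIV"
    using A B by (force simp: P_def Q_def)+
  define y where "y p = (if p \<in> B then x p else 0)" for p
  define v where "v z = (\<chi> j. trig_poly Q (\<lambda>n. y (n, j)) z)" for z
  have v: "v \<in> vec_space H2"
    using PQ B by (auto simp: v_def vec_space_def H2_def trig_poly_L2 trig_poly_fourier_coeff Q_def)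
  have Tx: "(\<Sum>k\<in>B. T r k * x k) = (\<Sum>k\<in>Q \<times> UNIV. T r k * y k)" for r
    using PQ by (intro sum.mono_neutral_cong_left) (auto simp: y_def)
  have x: "(\<Sum>k\<in>B. (cmod (x k))\<^sup>2) = (\<Sum>k\<in>Q \<times> UNIV. (cmod (y k))\<^sup>2)"
    using PQ by (intro sum.mono_neutral_cong_left) (auto simp: y_def)
  have F2: "F \<in> mat_space L2"
    using F Linf_subset_L2 by (auto simp: mat_space_def)
  have coeff: "fourier_coeff (\<lambda>z. hankel F v z $ i) r = (\<Sum>k\<in>B. T (r, i) k * x k)" if "r < 0" for r i
  proof -
    have "L2_proj (L2 \<ominus>\<^sub>L H2) (\<lambda>z. (F z *v v z) $ i) (\<lambda>z. hankel F v z $ i)"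
      by (intro hankel_proj F vec_space_H2_L2 v)
    moreover have "(\<lambda>z. z powi r) \<in> L2 \<ominus>\<^sub>L H2"
      using that by (simp add: L2_ominus_H2_iff powi_L2 fourier_coeff_powi)
    moreover have L: "(\<lambda>z. (F z *v v z) $ i) \<in> L2" "(\<lambda>z. hankel F v z $ i) \<in> L2"
      using mult_vec_L2[OF F vec_space_H2_L2[OF v]] hankel_L2[OF F vec_space_H2_L2[OF v]]
      by (simp_all add: vec_space_def)
    ultimately have "fourier_coeff (\<lambda>z. (F z *v v z) $ i - hankel F v z $ i) r = 0"
      by (simp add: is_orth_proj_def fourier_coeff_eq_inner L2_diff)
    then show ?thesis
      using L fourier_coeff_mult_trig_vec[OF F2, of Q y i r]
      by (simp add: fourier_coeff_diff Tx[unfolded T_def] T_def v_def[abs_def])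
  qed
  have "(\<Sum>r\<in>A. (cmod (\<Sum>k\<in>B. T r k * x k))\<^sup>2)
      = (\<Sum>p\<in>A. (cmod (fourier_coeff (\<lambda>z. hankel F v z $ snd p) (fst p)))\<^sup>2)"
    using A(2) by (intro sum.cong refl) (auto simp: coeff)
  also have "\<dots> \<le> (\<Sum>p\<in>P \<times> UNIV. (cmod (fourier_coeff (\<lambda>z. hankel F v z $ snd p) (fst p)))\<^sup>2)"
    using PQ by (intro sum_mono2) auto
  also have "\<dots> = (\<Sum>i\<in>UNIV. \<Sum>r\<in>P. (cmod (fourier_coeff (\<lambda>z. hankel F v z $ i) r))\<^sup>2)"
    by (subst sum.swap) (simp add: sum.cartesian_product case_prod_unfold)
  also have "\<dots> \<le> (L2_norm (hankel F v))\<^sup>2"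
    using hankel_L2[OF F vec_space_H2_L2[OF v]] PQ
    by (subst L2_vec_norm_square) (auto simp: vec_space_def intro!: sum_mono Bessel)
  also have "\<dots> \<le> (N * L2_norm v)\<^sup>2"
    by (intro power_mono hankel_norm_le[OF F N v] L2_norm_nonneg)
  also have "\<dots> = N\<^sup>2 * (\<Sum>k\<in>B. (cmod (x k))\<^sup>2)"
    unfolding x v_def[abs_def] power_mult_distrib trig_vec_norm[OF PQ(2)] ..
  finally show "(\<Sum>r\<in>A. (cmod (\<Sum>k\<in>B. block_toeplitz (\<lambda>k i j. fourier_coeff (\<lambda>z. F z $ i $ j) k) r k * x k))\<^sup>2)
      \<le> N\<^sup>2 * (\<Sum>k\<in>B. (cmod (x k))\<^sup>2)"
    by (simp add: T_def)
qed

lemma Parseval_vec_le: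
  fixes w :: "complex \<Rightarrow> complex^'n"
  assumes w: "w \<in> vec_space L2"
    and bound: "\<And>A. finite A \<Longrightarrow> (\<Sum>i\<in>UNIV. \<Sum>n\<in>A. (cmod (fourier_coeff (\<lambda>z. w z $ i) n))\<^sup>2) \<le> K"
  shows "(L2_norm w)\<^sup>2 \<le> K"
proof (rule field_le_epsilon)
  fix e :: real
  assume e: "0 < e"
  define c where "c i n = (cmod (fourier_coeff (\<lambda>z. w z $ i) n))\<^sup>2" for i n
  \<comment> \<open>Each coordinate may lose \<open>d\<close>, which adds up to \<open>e\<close>.
    One finite set of indices, the union over the coordinates, then serves all of them.\<close>
  define d where "d = e / of_nat CARD('n)"
  have d: "0 < d"
    using e by (simp add: d_def)
  have "\<exists>A. finite A \<and> (L2_norm (\<lambda>z. w z $ i))\<^sup>2 \<le> sum (c i) A + d" for i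
  proof (rule ccontr)
    assume *: "\<not> ?thesis"
    then have "sum (c i) A \<le> (L2_norm (\<lambda>z. w z $ i))\<^sup>2 - d" if "finite A" for A
      using that by (auto simp: not_le algebra_simps)
    moreover have "(\<lambda>z. w z $ i) \<in> L2"
      using w by (simp add: vec_space_def)
    ultimately have "(L2_norm (\<lambda>z. w z $ i))\<^sup>2 \<le> (L2_norm (\<lambda>z. w z $ i))\<^sup>2 - d"
      unfolding c_def by (rule Parseval_le[rotated])
    then show False
      using d by simp
  qed
  then obtain A where A: "\<And>i. finite (A i)" "\<And>i. (L2_norm (\<lambda>z. w z $ i))\<^sup>2 \<le> sum (c i) (A i) + d"
    by metis
  define A' where "A' = (\<Union>i. A i)"
  have "finite A'"
    using A(1) by (simp add: A'_def)
  have "sum (c i) (A i) \<le> sum (c i) A'" for i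
    using \<open>finite A'\<close> by (intro sum_mono2) (auto simp: A'_def c_def)
  then have "(L2_norm (\<lambda>z. w z $ i))\<^sup>2 \<le> sum (c i) A' + d" for i
    using A(2)[of i] by (meson add_right_mono order_trans)
  then have "(L2_norm w)\<^sup>2 \<le> (\<Sum>i\<in>UNIV. sum (c i) A' + d)"
    unfolding L2_vec_norm_square[OF w] by (intro sum_mono)
  also have "\<dots> = (\<Sum>i\<in>UNIV. sum (c i) A') + e"
    by (simp add: sum.distrib d_def)
  also have "\<dots> \<le> K + e"
    using bound[OF \<open>finite A'\<close>] by (simp add: c_def)
  finally show "(L2_norm w)\<^sup>2 \<le> K + e" .
qed

text \<open>\<open>K\<close> is only square integrable, so its boundedness has to be derived.
  Applying the matrix bound to a trigonometric polynomial times the constant vector \<open>x\<close>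
  gives the inequality in mean, weighted with a squared modulus; positivity against all such weights
  makes it hold almost everywhere.\<close>

lemma symbol_bound:
  fixes K :: "complex \<Rightarrow> complex^'n^'n"
  assumes K: "K \<in> mat_space L2"
    and N: "0 \<le> N"
    and bound: "matrix_bound (block_toeplitz (\<lambda>k i j. fourier_coeff (\<lambda>z. K z $ i $ j) k)) N UNIV UNIV"
  shows "AE z in circle. norm (K z *v x) \<le> N * norm x"
proof -
  have Kx: "(\<lambda>z. K z *v x) \<in> vec_space L2"
    using K by (auto simp: vec_space_def mat_space_def matrix_vector_mult_nth mult.commute[of _ "x $ _"]
        intro!: L2_sum L2_cmult)
  define v where "v z = N\<^sup>2 * (norm x)\<^sup>2 - (norm (K z *v x))\<^sup>2" for z
  have "AE z in circle. 0 \<le> v z"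
  proof (rule AE_nonneg_if_trig_poly)
    show "integrable circle v"
      unfolding v_def[abs_def] using L2_vec_square_integrable[OF Kx] by simp
    fix A :: "int set" and c
    assume A: "finite A"
    define y where "y p = c (fst p) * x $ snd p" for p :: "int \<times> 'n"
    define w where "w z = K z *v (\<chi> j. trig_poly A (\<lambda>n. y (n, j)) z)" for z
    have w: "w \<in> vec_space L2"
      using K unfolding w_def vec_space_def mat_space_def
      by (auto simp: matrix_vector_mult_nth mult.commute[of _ "trig_poly _ _ _"]
          intro!: L2_sum Linf_mult_L2 trig_poly_Linf)
    have y: "(\<chi> j. trig_poly A (\<lambda>n. y (n, j)) z) = trig_poly A c z *s x" for z
      by (simp add: vec_eq_iff y_def trig_poly_def sum_distrib_left mult.commute mult.left_commute)
    have w_eq: "w z = trig_poly A c z *s (K z *v x)" for z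
      by (simp add: w_def y vec_eq_iff matrix_vector_mult_nth sum_distrib_left mult.left_commute)
    have norm_smult: "(norm (a *s u))\<^sup>2 = (norm u)\<^sup>2 * (cmod a)\<^sup>2" for a and u :: "complex^'n"
      by (simp add: norm_vec_square norm_mult power_mult_distrib sum_distrib_left mult.commute)
    have "(L2_norm w)\<^sup>2 \<le> N\<^sup>2 * (\<Sum>p\<in>A \<times> UNIV. (cmod (y p))\<^sup>2)"
    proof (rule Parseval_vec_le[OF w])
      fix B :: "int set"
      assume "finite B"
      have "(\<Sum>i\<in>UNIV. \<Sum>n\<in>B. (cmod (fourier_coeff (\<lambda>z. w z $ i) n))\<^sup>2)
          = (\<Sum>p\<in>B \<times> UNIV. (cmod (fourier_coeff (\<lambda>z. w z $ snd p) (fst p)))\<^sup>2)"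
        by (subst sum.swap) (simp add: sum.cartesian_product case_prod_unfold)
      also have "\<dots> \<le> N\<^sup>2 * (\<Sum>p\<in>A \<times> UNIV. (cmod (y p))\<^sup>2)"
        unfolding w_def fourier_coeff_mult_trig_vec[OF K] prod.collapse
        using A \<open>finite B\<close> by (intro matrix_boundD[OF bound]) auto
      finally show "(\<Sum>i\<in>UNIV. \<Sum>n\<in>B. (cmod (fourier_coeff (\<lambda>z. w z $ i) n))\<^sup>2)
          \<le> N\<^sup>2 * (\<Sum>p\<in>A \<times> UNIV. (cmod (y p))\<^sup>2)" .
    qed
    also have "(\<Sum>p\<in>A \<times> UNIV. (cmod (y p))\<^sup>2) = (\<integral>z. (norm x)\<^sup>2 * (cmod (trig_poly A c z))\<^sup>2 \<partial>circle)"
      unfolding trig_vec_norm[OF A, symmetric] y L2_norm_square norm_smult ..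
    finally have "(\<integral>z. (norm (K z *v x))\<^sup>2 * (cmod (trig_poly A c z))\<^sup>2 \<partial>circle)
        \<le> (\<integral>z. N\<^sup>2 * (norm x)\<^sup>2 * (cmod (trig_poly A c z))\<^sup>2 \<partial>circle)"
      by (simp add: L2_norm_square w_eq norm_smult mult.assoc)
    moreover have "integrable circle (\<lambda>z. (norm (K z *v x))\<^sup>2 * (cmod (trig_poly A c z))\<^sup>2)"
      using L2_vec_square_integrable[OF w] by (simp add: w_eq norm_smult)
    moreover have "integrable circle (\<lambda>z. (cmod (trig_poly A c z))\<^sup>2)"
      by (intro L2_square_integrable trig_poly_L2)
    ultimately show "0 \<le> (\<integral>z. v z * (cmod (trig_poly A c z))\<^sup>2 \<partial>circle)"
      by (simp add: v_def left_diff_distrib)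
  qed
  then show ?thesis
  proof eventually_elim
    case (elim z)
    then have "(norm (K z *v x))\<^sup>2 \<le> (N * norm x)\<^sup>2"
      by (simp add: v_def power_mult_distrib)
    then show ?case
      by (rule power2_le_imp_le) (simp add: N)
  qed
qed

text \<open>A completion of the negative coefficients with bound \<open>N\<close> is the coefficient
  sequence of a symbol \<open>K\<close> of norm at most \<open>N\<close>. Since \<open>K\<close> and
  \<open>F\<close> agree at negative indices, \<open>F - K\<close> is analytic and witnesses the
  distance.\<close>

theorem Nehari:
  fixes F :: "complex \<Rightarrow> complex^'n^'n"
  assumes F: "F \<in> mat_space Linf"
  shows "Linf_mat_dist F (mat_space Hinf) = op_norm (vec_space H2) (hankel F)"
proof (rule antisym[OF _ hankel_norm_le_dist[OF F]])
  show "Linf_mat_dist F (mat_space Hinf) \<le> op_norm (vec_space H2) (hankel F)"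
  proof (cases "op_norm (vec_space H2) (hankel F)")
    case (real N)
    then have N: "0 \<le> N"
      using op_norm_hankel_nonneg[of F] by simp
    define a where "a k i j = fourier_coeff (\<lambda>z. F z $ i $ j) k" for k i j
    obtain a' where a': "\<And>k. k < 0 \<Longrightarrow> a' k = a k" "matrix_bound (block_toeplitz a') N UNIV UNIV"
      using block_toeplitz_completion[OF N, of a] hankel_matrix_bound[OF F real]
      unfolding a_def by metis
    have "\<exists>f\<in>L2. (\<forall>k. fourier_coeff f k = a' k i j) \<and> (L2_norm f)\<^sup>2 \<le> N\<^sup>2" for i j
    proof (rule Riesz_Fischer)
      fix A :: "int set"
      assume A: "finite A"
      \<comment> \<open>Testing on the unit vector at \<open>(0, j)\<close> isolates one scalar
        column, whose entries in coordinate \<open>i\<close> are the coefficients of one matrix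
        entry.\<close>
      have "(\<Sum>r\<in>A \<times> {i}. (cmod (\<Sum>k\<in>{(0, j)}. block_toeplitz a' r k * 1))\<^sup>2) \<le> N\<^sup>2 * (\<Sum>k\<in>{(0::int, j)}. (cmod 1)\<^sup>2)"
        using A by (intro matrix_boundD[OF a'(2)]) auto
      moreover have "(\<Sum>r\<in>A \<times> {i}. (cmod (block_toeplitz a' r (0, j)))\<^sup>2) = (\<Sum>k\<in>A. (cmod (a' k i j))\<^sup>2)"
      proof -
        have "A \<times> {i} = (\<lambda>r. (r, i)) ` A"
          by auto
        then show ?thesis
          by (simp add: sum.reindex inj_on_def block_toeplitz_def)
      qed
      ultimately show "(\<Sum>n\<in>A. (cmod (a' n i j))\<^sup>2) \<le> N\<^sup>2"
        by simp
    qed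
    then obtain k where k: "\<And>i j. k i j \<in> L2" "\<And>i j n. fourier_coeff (k i j) n = a' n i j"
      by metis
    define K :: "complex \<Rightarrow> complex^'n^'n" where "K z = (\<chi> i j. k i j z)" for z
    have K: "K \<in> mat_space L2"
      by (simp add: K_def mat_space_def k)
    have ae: "AE z in circle. norm (K z *v x) \<le> N * norm x" for x
      using symbol_bound[OF K N] a'(2) by (simp add: K_def k)
    have Km: "(\<lambda>z. K z $ i $ j) \<in> borel_measurable borel" for i j
      using K by (simp add: mat_space_def L2_measurable)
    note norm_K = Linf_mat_norm_leI[OF Km ae]
    \<comment> \<open>The norm bound on the matrices turns square integrable entries into bounded
      ones, as membership of \<open>F - K\<close> in the bounded analytic symbols requires.\<close>
    have "AE z in circle. cmod (K z $ i $ j) \<le> N" for i j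
      using norm_K(2)
    proof eventually_elim
      case (elim z)
      have "cmod (K z $ i $ j) = cmod ((K z *v axis j 1) $ i)"
        by (simp add: matrix_vector_mult_nth axis_def if_distrib cong: if_cong)
      also have "\<dots> \<le> norm (K z *v axis j 1)"
        by (rule Finite_Cartesian_Product.norm_nth_le)
      also have "\<dots> \<le> onorm (\<lambda>x. K z *v x) * norm (axis j (1::complex))"
        by (intro onorm matrix_vector_mul_bounded_linear)
      finally show ?case
        using elim by (simp add: norm_axis_1)
    qed
    then have K_Linf: "K \<in> mat_space Linf"
      using Km by (auto simp: mat_space_def Linf_def)
    define G where "G z = F z - K z" for z
    have "G \<in> mat_space Hinf"
      unfolding mat_space_def
    proof (intro CollectI allI)
      fix i j
      have "(\<lambda>z. F z $ i $ j) \<in> Linf" "(\<lambda>z. K z $ i $ j) \<in> Linf"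
        using F K_Linf by (simp_all add: mat_space_def)
      then show "(\<lambda>z. G z $ i $ j) \<in> Hinf"
        using a'(1) k
        by (simp add: G_def Hinf_def Linf_diff fourier_coeff_diff Linf_subset_L2 K_def a_def)
    qed
    then have "Linf_mat_dist F (mat_space Hinf) \<le> Linf_mat_norm (\<lambda>z. F z - G z)"
      unfolding Linf_mat_dist_def by (rule INF_lower)
    also have "\<dots> \<le> ereal N"
      using norm_K(1) by (simp add: G_def)
    finally show ?thesis
      by (simp add: real)
  next
    case MInf
    then show ?thesis
      using op_norm_hankel_nonneg[of F] by simp
  qed simp
qed

section \<open>Truncated Toeplitz operators and the main theorem\<close>

lemma vec_space_model_space_H2: "k \<in> vec_space (model_space \<theta>) \<Longrightarrow> k \<in> vec_space H2"
  by (auto simp: vec_space_def dest: model_space_H2)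

lemma mat_space_Hinf_Linf: "F \<in> mat_space Hinf \<Longrightarrow> F \<in> mat_space Linf"
  by (simp add: mat_space_def Hinf_Linf)

lemma truncated_toeplitz_proj:
  assumes \<theta>: "inner_function \<theta>" and h: "h \<in> Hinf" and k: "k \<in> model_space \<theta>"
  shows "L2_proj (model_space \<theta>) (\<lambda>z. h z * k z) (truncated_toeplitz \<theta> h k)"
proof -
  have "(\<lambda>z. h z * k z) \<in> H2"
    by (intro Hinf_mult_H2 h model_space_H2[OF k])
  then show ?thesis
    unfolding compressed_mult_def using model_space_proj_exists[OF \<theta>] is_orth_proj_orth_proj by blast
qed

abbreviation block_truncated_toeplitz ::
  "(complex \<Rightarrow> complex) \<Rightarrow> (complex \<Rightarrow> complex^2^2) \<Rightarrow> (complex \<Rightarrow> complex^2) \<Rightarrow> (complex \<Rightarrow> complex^2)"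
  where
  "block_truncated_toeplitz \<theta> \<Phi> \<equiv> block_operator
    (truncated_toeplitz \<theta> (\<lambda>z. \<Phi> z $ 1 $ 1)) (truncated_toeplitz \<theta> (\<lambda>z. \<Phi> z $ 1 $ 2))
    (truncated_toeplitz \<theta> (\<lambda>z. \<Phi> z $ 2 $ 1)) (truncated_toeplitz \<theta> (\<lambda>z. \<Phi> z $ 2 $ 2))"

lemma block_truncated_toeplitz_proj:
  assumes \<theta>: "inner_function \<theta>" and \<Phi>: "\<Phi> \<in> mat_space Hinf" and k: "k \<in> vec_space (model_space \<theta>)"
  shows "L2_proj (model_space \<theta>) (\<lambda>z. (\<Phi> z *v k z) $ i) (\<lambda>z. block_truncated_toeplitz \<theta> \<Phi> k z $ i)"
proof -
  define t where "t i j = truncated_toeplitz \<theta> (\<lambda>z. \<Phi> z $ i $ j) (\<lambda>z. k z $ j)" for i j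
  have t: "L2_proj (model_space \<theta>) (\<lambda>z. \<Phi> z $ i $ j * k z $ j) (t i j)" for i j
    unfolding t_def using \<Phi> k by (intro truncated_toeplitz_proj \<theta>) (simp_all add: mat_space_def vec_space_def)
  have H2: "(\<lambda>z. \<Phi> z $ i $ j * k z $ j) \<in> H2" for i j
    using \<Phi> vec_space_model_space_H2[OF k] by (intro Hinf_mult_H2) (simp_all add: mat_space_def vec_space_def)
  have "L2_proj (model_space \<theta>) (\<lambda>z. \<Phi> z $ i $ 1 * k z $ 1 + \<Phi> z $ i $ 2 * k z $ 2)
      (\<lambda>z. t i 1 z + t i 2 z)"
    using t[of i 1] t[of i 2]
    by (intro L2_proj_add model_space_subset_L2 H2_L2 H2 t model_space_add inner_function_Linf[OF \<theta>])
      (simp_all add: is_orth_proj_def)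
  moreover have "block_truncated_toeplitz \<theta> \<Phi> k z $ i = t i 1 z + t i 2 z" for z
    using exhaust_2[of i] by (auto simp: block_operator_def t_def)
  ultimately show ?thesis
    by (simp add: matrix_vector_mult_nth sum_2)
qed

lemma block_truncated_toeplitz_model_space:
  assumes "inner_function \<theta>" "\<Phi> \<in> mat_space Hinf" "k \<in> vec_space (model_space \<theta>)"
  shows "block_truncated_toeplitz \<theta> \<Phi> k \<in> vec_space (model_space \<theta>)"
  using block_truncated_toeplitz_proj[OF assms] by (simp add: vec_space_def is_orth_proj_def)

lemma scale_matrix_Linf:
  assumes "u \<in> Linf" "\<Phi> \<in> mat_space Linf"
  shows "scale_matrix u \<Phi> \<in> mat_space Linf"
proof -
  have "(\<lambda>z. f z * h z) \<in> Linf" if fh: "f \<in> Linf" "h \<in> Linf" for f h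
  proof -
    obtain C D where "AE z in circle. cmod (f z) \<le> C" "AE z in circle. cmod (h z) \<le> D"
      using fh by (auto simp: Linf_def)
    then have "AE z in circle. cmod (f z * h z) \<le> C * D"
      by eventually_elim (simp add: norm_mult mult_mono' )
    then show ?thesis
      using fh by (auto simp: Linf_def)
  qed
  then show ?thesis
    using assms by (simp add: mat_space_def scale_matrix_def)
qed

text \<open>The scalar \<open>\<theta>\<close> commutes with the analytic matrix
  \<open>\<Phi>\<close>, so the summand of \<open>v\<close> containing \<open>a\<close> is mapped
  into \<open>\<theta> H2\<close> and vanishes under the projection. The case \<open>a = 0\<close>
  gives one inequality between the operator norms; splitting an arbitrary \<open>v\<close> gives the
  other.\<close>

lemma hankel_norm_eq_truncated:
  assumes \<theta>: "inner_function \<theta>" and \<Phi>: "\<Phi> \<in> mat_space Hinf"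
    and k: "k \<in> vec_space (model_space \<theta>)" and a: "a \<in> vec_space H2"
    and v: "\<And>z. v z = k z + \<theta> z *s a z"
  shows "L2_norm (hankel (scale_matrix (\<lambda>z. cnj (\<theta> z)) \<Phi>) v)
    = L2_norm (block_truncated_toeplitz \<theta> \<Phi> k)"
proof -
  define F where "F = scale_matrix (\<lambda>z. cnj (\<theta> z)) \<Phi>"
  have F: "F \<in> mat_space Linf"
    unfolding F_def by (intro scale_matrix_Linf Linf_cnj inner_function_Linf \<theta> mat_space_Hinf_Linf \<Phi>)
  have kH: "k \<in> vec_space H2"
    by (rule vec_space_model_space_H2[OF k])
  have \<theta>a: "(\<lambda>z. \<theta> z * a z $ i) \<in> H2" for i
    using \<theta> a by (intro Hinf_mult_H2) (simp_all add: inner_function_def vec_space_def)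
  have vH: "v \<in> vec_space H2"
    using kH \<theta>a by (simp add: vec_space_def v H2_add)
  have \<Phi>H: "(\<lambda>z. (\<Phi> z *v u z) $ i) \<in> H2" if "u \<in> vec_space H2" for u i
    using mult_vec_H2[OF \<Phi> that] by (simp add: vec_space_def)
  have "L2_norm (\<lambda>z. hankel F v z $ i) = L2_norm (\<lambda>z. block_truncated_toeplitz \<theta> \<Phi> k z $ i)" for i
  proof (rule model_space_proj_norm_eq[OF \<theta> \<Phi>H[OF vH], symmetric])
    have "(\<Phi> z *v v z) $ i = (\<Phi> z *v k z) $ i + \<theta> z * (\<Phi> z *v a z) $ i" for z
      by (simp add: v matrix_vector_mult_nth sum.distrib sum_distrib_left algebra_simps)
    moreover have "L2_proj (model_space \<theta>) (\<lambda>z. (\<Phi> z *v k z) $ i + \<theta> z * (\<Phi> z *v a z) $ i)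
        (\<lambda>z. block_truncated_toeplitz \<theta> \<Phi> k z $ i)"
      using \<theta> model_space_orthogonal[OF _ \<Phi>H[OF a]]
      by (intro L2_proj_add_orthogonal block_truncated_toeplitz_proj \<Phi> k model_space_subset_L2 H2_L2 \<Phi>H kH
          Linf_mult_L2 inner_function_Linf a)
    ultimately show "L2_proj (model_space \<theta>) (\<lambda>z. (\<Phi> z *v v z) $ i)
        (\<lambda>z. block_truncated_toeplitz \<theta> \<Phi> k z $ i)"
      by simp
    have "(F z *v v z) $ i = cnj (\<theta> z) * (\<Phi> z *v v z) $ i" for z
      by (simp add: F_def scale_matrix_def matrix_vector_mult_nth sum_distrib_left mult.assoc)
    then show "L2_proj (L2 \<ominus>\<^sub>L H2) (\<lambda>z. cnj (\<theta> z) * (\<Phi> z *v v z) $ i) (\<lambda>z. hankel F v z $ i)"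
      using hankel_proj[OF F vec_space_H2_L2[OF vH], of i] by simp
  qed
  moreover have "block_truncated_toeplitz \<theta> \<Phi> k \<in> vec_space L2"
    using block_truncated_toeplitz_model_space[OF \<theta> \<Phi> k] vec_space_mono[OF model_space_subset_L2] by blast
  ultimately have "(L2_norm (hankel F v))\<^sup>2 = (L2_norm (block_truncated_toeplitz \<theta> \<Phi> k))\<^sup>2"
    using hankel_L2[OF F vec_space_H2_L2[OF vH]] by (simp add: L2_vec_norm_square)
  then show ?thesis
    by (simp add: F_def L2_norm_nonneg power2_eq_iff_nonneg)
qed

lemma op_norm_leI:
  assumes "\<And>f. f \<in> S \<Longrightarrow> L2_norm f \<le> 1 \<Longrightarrow> \<exists>f'\<in>S'. L2_norm f' \<le> 1 \<and> L2_norm (T f) \<le> L2_norm (T' f')"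
  shows "op_norm S T \<le> op_norm S' T'"
  unfolding op_norm_def using assms by (intro SUP_mono) fastforce

lemma op_norm_truncated_eq_hankel:
  assumes \<theta>: "inner_function \<theta>" and \<Phi>: "\<Phi> \<in> mat_space Hinf"
  shows "op_norm (vec_space (model_space \<theta>)) (block_truncated_toeplitz \<theta> \<Phi>)
    = op_norm (vec_space H2) (hankel (scale_matrix (\<lambda>z. cnj (\<theta> z)) \<Phi>))"
proof (rule antisym)
  show "op_norm (vec_space (model_space \<theta>)) (block_truncated_toeplitz \<theta> \<Phi>)
    \<le> op_norm (vec_space H2) (hankel (scale_matrix (\<lambda>z. cnj (\<theta> z)) \<Phi>))"
  proof (rule op_norm_leI)
    fix k :: "complex \<Rightarrow> complex^2"
    assume k: "k \<in> vec_space (model_space \<theta>)" "L2_norm k \<le> 1"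
    have "k \<in> vec_space H2"
      by (rule vec_space_model_space_H2[OF k(1)])
    moreover have "L2_norm (hankel (scale_matrix (\<lambda>z. cnj (\<theta> z)) \<Phi>) k) = L2_norm (block_truncated_toeplitz \<theta> \<Phi> k)"
      by (rule hankel_norm_eq_truncated[OF \<theta> \<Phi> k(1) zero_vec_space_H2]) simp
    ultimately show "\<exists>v\<in>vec_space H2. L2_norm v \<le> 1 \<and> L2_norm (block_truncated_toeplitz \<theta> \<Phi> k)
        \<le> L2_norm (hankel (scale_matrix (\<lambda>z. cnj (\<theta> z)) \<Phi>) v)"
      using k(2) by (intro bexI[of _ k]) auto
  qed
  show "op_norm (vec_space H2) (hankel (scale_matrix (\<lambda>z. cnj (\<theta> z)) \<Phi>))
    \<le> op_norm (vec_space (model_space \<theta>)) (block_truncated_toeplitz \<theta> \<Phi>)"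
  proof (rule op_norm_leI)
    fix v :: "complex \<Rightarrow> complex^2"
    assume v: "v \<in> vec_space H2" "L2_norm v \<le> 1"
    have "\<exists>b\<in>H2. L2_proj (model_space \<theta>) (\<lambda>z. v z $ i) (\<lambda>z. v z $ i - \<theta> z * b z)" for i
      using v by (intro model_space_proj_exists \<theta>) (simp add: vec_space_def)
    then obtain b where b: "\<And>i. b i \<in> H2"
        "\<And>i. L2_proj (model_space \<theta>) (\<lambda>z. v z $ i) (\<lambda>z. v z $ i - \<theta> z * b i z)"
      by metis
    define a :: "complex \<Rightarrow> complex^2" where "a z = (\<chi> i. b i z)" for z
    \<comment> \<open>The component of \<open>v\<close> in the model space. Being a projection it
      has norm at most that of \<open>v\<close>, so it is an admissible test vector.\<close>
    define k where "k z = v z - \<theta> z *s a z" for z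
    have kp: "L2_proj (model_space \<theta>) (\<lambda>z. v z $ i) (\<lambda>z. k z $ i)" for i
      using b(2)[of i] by (simp add: k_def a_def)
    then have k: "k \<in> vec_space (model_space \<theta>)"
      by (simp add: vec_space_def is_orth_proj_def)
    have "L2_norm (hankel (scale_matrix (\<lambda>z. cnj (\<theta> z)) \<Phi>) v) = L2_norm (block_truncated_toeplitz \<theta> \<Phi> k)"
    proof (rule hankel_norm_eq_truncated[OF \<theta> \<Phi> k])
      show "a \<in> vec_space H2"
        using b by (simp add: a_def vec_space_def)
    qed (simp add: k_def)
    moreover have "L2_norm k \<le> 1"
      using L2_vec_proj_norm_le[OF kp model_space_subset_L2 vec_space_H2_L2[OF v(1)]] v(2) by simp
    ultimately show "\<exists>k\<in>vec_space (model_space \<theta>). L2_norm k \<le> 1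
        \<and> L2_norm (hankel (scale_matrix (\<lambda>z. cnj (\<theta> z)) \<Phi>) v) \<le> L2_norm (block_truncated_toeplitz \<theta> \<Phi> k)"
      using k by auto
  qed
qed

section \<open>Identification of \<open>M\<close> with two copies of the model space\<close>

lemma orthogonal_sum_norm:
  fixes k :: "complex \<Rightarrow> complex^2"
  assumes \<phi>: "\<phi> \<in> Linf" "unimodular \<phi>" and \<psi>: "\<psi> \<in> Linf" "unimodular \<psi>" and S: "S \<subseteq> L2"
    and orth: "L2_orthogonal (mult_space \<phi> S) (mult_space \<psi> S)" and k: "k \<in> vec_space S"
  shows "L2_norm (\<lambda>z. \<phi> z * k z $ 1 + \<psi> z * k z $ 2) = L2_norm k"
proof -
  have kL: "(\<lambda>z. k z $ i) \<in> L2" and kS: "(\<lambda>z. k z $ i) \<in> S" for i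
    using k S by (auto simp: vec_space_def)
  note L = Linf_mult_L2[OF \<phi>(1) kL] Linf_mult_L2[OF \<psi>(1) kL]
  have "L2_inner (\<lambda>z. \<phi> z * k z $ 1) (\<lambda>z. \<psi> z * k z $ 2) = 0"
    using orth kS[of 1] kS[of 2] by (auto simp: L2_orthogonal_def mult_space_def)
  then have "(L2_norm (\<lambda>z. \<phi> z * k z $ 1 + 1 * (\<psi> z * k z $ 2)))\<^sup>2 = (L2_norm k)\<^sup>2"
    using L k S
    by (subst L2_norm_add_mult_square)
      (auto simp: L2_norm_unimodular \<phi> \<psi> kL L2_vec_norm_square sum_2 vec_space_def subset_iff)
  then show ?thesis
    by (simp add: L2_norm_nonneg power2_eq_iff_nonneg)
qed

text \<open>The isometry of \<open>orthogonal_sum_norm\<close> carries \<open>W\<close> to the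
  compression. The function \<open>p\<close>, the image of \<open>W\<close>, is verified directly to
  be the projection of \<open>g * f\<close> onto \<open>M\<close>, which settles existence of that
  projection together with its value.\<close>

lemma compressed_mult_sum_space_norm:
  fixes k :: "complex \<Rightarrow> complex^2"
  assumes \<theta>: "inner_function \<theta>"
    and \<phi>: "\<phi> \<in> Linf" "unimodular \<phi>" and \<psi>: "\<psi> \<in> Linf" "unimodular \<psi>"
    and orth: "L2_orthogonal (mult_space \<phi> (model_space \<theta>)) (mult_space \<psi> (model_space \<theta>))"
    and \<Phi>: "matrix_symbol \<phi> \<psi> g \<in> mat_space Hinf"
    and M: "M = sum_space (mult_space \<phi> (model_space \<theta>)) (mult_space \<psi> (model_space \<theta>))"
    and k: "k \<in> vec_space (model_space \<theta>)"
  shows "L2_norm (compressed_mult M g (\<lambda>z. \<phi> z * k z $ 1 + \<psi> z * k z $ 2))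
    = L2_norm (block_truncated_toeplitz \<theta> (matrix_symbol \<phi> \<psi> g) k)"
proof -
  define W where "W = block_truncated_toeplitz \<theta> (matrix_symbol \<phi> \<psi> g) k"
  define f where "f z = \<phi> z * k z $ 1 + \<psi> z * k z $ 2" for z
  define p where "p z = \<phi> z * W z $ 1 + \<psi> z * W z $ 2" for z
  have "(\<lambda>z. matrix_symbol \<phi> \<psi> g z $ 1 $ 1) \<in> Hinf"
    using \<Phi> by (simp add: mat_space_def)
  then have g: "g \<in> Linf"
    by (simp add: matrix_symbol_def Hinf_Linf)
  have W: "W \<in> vec_space (model_space \<theta>)"
    unfolding W_def by (rule block_truncated_toeplitz_model_space[OF \<theta> \<Phi> k])
  have kK: "(\<lambda>z. k z $ i) \<in> model_space \<theta>" and WK: "(\<lambda>z. W z $ i) \<in> model_space \<theta>" for i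
    using k W by (simp_all add: vec_space_def)
  have kL: "(\<lambda>z. k z $ i) \<in> L2" and WL: "(\<lambda>z. W z $ i) \<in> L2" for i
    using kK[of i] WK[of i] model_space_subset_L2 by blast+
  note mL = Linf_mult_L2[OF \<phi>(1)] Linf_mult_L2[OF \<psi>(1)] Linf_mult_L2[OF g]
  have f: "f \<in> L2"
    unfolding f_def[abs_def] by (intro L2_add mL kL)
  have M_L2: "M \<subseteq> L2"
    unfolding M sum_space_def mult_space_def using model_space_subset_L2 by (auto intro!: L2_add mL)
  have symbol: "L2_proj (model_space \<theta>) (\<lambda>z. (matrix_symbol \<phi> \<psi> g z *v k z) $ i) (\<lambda>z. W z $ i)" for i
    unfolding W_def by (rule block_truncated_toeplitz_proj[OF \<theta> \<Phi> k])
  have symL: "(\<lambda>z. (matrix_symbol \<phi> \<psi> g z *v k z) $ i) \<in> L2" for i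
    using mult_vec_L2[OF mat_space_Hinf_Linf[OF \<Phi>], of k] kL by (simp add: vec_space_def)
  have orthogonal: "L2_inner (\<lambda>z. \<phi> z * a z) (\<lambda>z. \<psi> z * b z) = 0"
    if "a \<in> model_space \<theta>" "b \<in> model_space \<theta>" for a b
    using orth that by (auto simp: L2_orthogonal_def mult_space_def)
  \<comment> \<open>Both summands of \<open>M\<close> are treated at once: \<open>u\<close> is the
    multiplier of the tested summand and \<open>x\<close> the other one. Moving \<open>u\<close>
    across the inner product turns \<open>x * g\<close> into the off-diagonal symbol, and
    orthogonality of the summands removes the part of \<open>p\<close> carried by
    \<open>x\<close>.\<close>
  have zero: "L2_inner (\<lambda>z. g z * f z - p z) (\<lambda>z. u z * s z) = 0"
    if u: "u \<in> Linf" "unimodular u" and s: "s \<in> model_space \<theta>"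
      and "(u = \<phi> \<and> x = \<psi> \<and> i = 1 \<and> j = 2) \<or> (u = \<psi> \<and> x = \<phi> \<and> i = 2 \<and> j = 1)"
    for u x s and i j :: 2
  proof -
    have sL: "s \<in> L2"
      using s model_space_subset_L2 by blast
    have x: "x \<in> Linf"
      using that(4) \<phi> \<psi> by auto
    have f_eq: "f z = u z * k z $ i + x z * k z $ j" and p_eq: "p z = u z * W z $ i + x z * W z $ j" for z
      using that(4) by (auto simp: f_def p_def)
    have sym_eq: "(matrix_symbol \<phi> \<psi> g z *v k z) $ i = g z * k z $ i + cnj (u z) * x z * g z * k z $ j" for z
      using that(4) by (auto simp: matrix_symbol_def matrix_vector_mult_nth sum_2)
    have xW: "L2_inner (\<lambda>z. x z * W z $ j) (\<lambda>z. u z * s z) = 0"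
      using that(4) orthogonal[OF WK s] orthogonal[OF s WK]
        L2_inner_commute[of "\<lambda>z. \<phi> z * W z $ j" "\<lambda>z. \<psi> z * s z"]
        L2_inner_commute[of "\<lambda>z. \<psi> z * W z $ j" "\<lambda>z. \<phi> z * s z"]
      by auto
    note uL = Linf_mult_L2[OF u(1)] Linf_mult_L2[OF x]
    note gk = mL(3)[OF kL]
    have cross: "L2_inner (\<lambda>z. x z * (g z * k z $ j)) (\<lambda>z. u z * s z)
        = L2_inner (\<lambda>z. cnj (u z) * x z * g z * k z $ j) s"
      by (simp add: L2_inner_def algebra_simps)
    have "L2_inner (\<lambda>z. g z * f z - p z) (\<lambda>z. u z * s z)
      = L2_inner (\<lambda>z. (u z * (g z * k z $ i) + x z * (g z * k z $ j)) - (u z * W z $ i + x z * W z $ j)) (\<lambda>z. u z * s z)"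
      by (simp add: f_eq p_eq algebra_simps)
    also have "\<dots> = L2_inner (\<lambda>z. g z * k z $ i) s + L2_inner (\<lambda>z. cnj (u z) * x z * g z * k z $ j) s
        - L2_inner (\<lambda>z. W z $ i) s"
      using uL gk WL sL
      by (simp add: L2_inner_diff_left L2_inner_add_left L2_add xW cross L2_inner_unimodular[OF u(2,1)])
    also have "\<dots> = L2_inner (\<lambda>z. (matrix_symbol \<phi> \<psi> g z *v k z) $ i) s - L2_inner (\<lambda>z. W z $ i) s"
    proof -
      have "(\<lambda>z. cnj (u z) * (x z * (g z * k z $ j))) \<in> L2"
        by (intro Linf_mult_L2[OF Linf_cnj[OF u(1)]] uL gk)
      then show ?thesis
        unfolding sym_eq using gk sL by (simp add: L2_inner_add_left mult.assoc)
    qed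
    also have "\<dots> = L2_inner (\<lambda>z. (matrix_symbol \<phi> \<psi> g z *v k z) $ i - W z $ i) s"
      using symL WL sL by (simp add: L2_inner_diff_left)
    also have "\<dots> = 0"
      using symbol[of i] s by (simp add: is_orth_proj_def)
    finally show ?thesis .
  qed
  have proj: "L2_proj M (\<lambda>z. g z * f z) p"
    unfolding is_orth_proj_def
  proof (intro conjI ballI)
    show p: "p \<in> M"
      unfolding M sum_space_def mult_space_def p_def[abs_def] using WK by fastforce
    fix m
    assume "m \<in> M"
    then obtain s t where st: "s \<in> model_space \<theta>" "t \<in> model_space \<theta>" "m = (\<lambda>z. \<phi> z * s z + \<psi> z * t z)"
      by (auto simp: M sum_space_def mult_space_def)
    have "(\<lambda>z. g z * f z - p z) \<in> L2"
      using p M_L2 f by (intro L2_diff mL) auto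
    then show "L2_inner (\<lambda>z. g z * f z - p z) m = 0"
      using st model_space_subset_L2 mL zero[OF \<phi> st(1), of \<psi> 1 2] zero[OF \<psi> st(2), of \<phi> 2 1]
      by (auto simp: L2_inner_add_right subset_iff)
  qed
  have "L2_norm (compressed_mult M g f) = L2_norm p"
    unfolding compressed_mult_def
    by (rule L2_proj_norm_unique[OF is_orth_proj_orth_proj[OF proj] proj M_L2 mL(3)[OF f]])
  also have "\<dots> = L2_norm W"
    unfolding p_def[abs_def] by (rule orthogonal_sum_norm[OF \<phi> \<psi> model_space_subset_L2 orth W])
  finally show ?thesis
    by (simp add: f_def[abs_def] W_def)
qed

theorem proposition5p1:
  fixes \<theta> \<phi> \<psi> g :: "complex \<Rightarrow> complex"
    and M :: "(complex \<Rightarrow> complex) set"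
    and \<Phi> :: "complex \<Rightarrow> complex^2^2"
    and W :: "(complex \<Rightarrow> complex^2) \<Rightarrow> (complex \<Rightarrow> complex^2)"
  assumes "inner_function \<theta>"
    and "\<phi> \<in> Linf" and "unimodular \<phi>"
    and "\<psi> \<in> Linf" and "unimodular \<psi>"
    and "L2_orthogonal (mult_space \<phi> (model_space \<theta>)) (mult_space \<psi> (model_space \<theta>))"
    and "\<nexists>c::complex. AE z in circle. \<phi> z * cnj (\<psi> z) = c * \<theta> z"
    and "\<nexists>c::complex. AE z in circle. cnj (\<phi> z) * \<psi> z = c * \<theta> z"
    and "M = sum_space (mult_space \<phi> (model_space \<theta>)) (mult_space \<psi> (model_space \<theta>))"
    and "\<Phi> = matrix_symbol \<phi> \<psi> g"
    and "\<Phi> \<in> mat_space Hinf"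
    and "W = block_operator
              (truncated_toeplitz \<theta> g)
              (truncated_toeplitz \<theta> (\<lambda>z. cnj (\<phi> z) * \<psi> z * g z))
              (truncated_toeplitz \<theta> (\<lambda>z. cnj (\<psi> z) * \<phi> z * g z))
              (truncated_toeplitz \<theta> g)"
  shows "op_norm M (compressed_mult M g) = op_norm (vec_space (model_space \<theta>)) W
    \<and> op_norm (vec_space (model_space \<theta>)) W
        = Linf_mat_dist (scale_matrix (\<lambda>z. cnj (\<theta> z)) \<Phi>) (mat_space Hinf)
    \<and> Linf_mat_dist (scale_matrix (\<lambda>z. cnj (\<theta> z)) \<Phi>) (mat_space Hinf)
        = op_norm (vec_space H2) (hankel (scale_matrix (\<lambda>z. cnj (\<theta> z)) \<Phi>))"
proof -
  note \<theta> = assms(1) and \<phi> = assms(2,3) and \<psi> = assms(4,5) and orth = assms(6) and M = assms(9)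
  have \<Phi>: "\<Phi> \<in> mat_space Hinf" "matrix_symbol \<phi> \<psi> g \<in> mat_space Hinf"
    using assms(10,11) by auto
  have W: "W = block_truncated_toeplitz \<theta> \<Phi>"
    by (simp add: assms(10,12) matrix_symbol_def)
  have norm_T: "L2_norm (compressed_mult M g (\<lambda>z. \<phi> z * k z $ 1 + \<psi> z * k z $ 2)) = L2_norm (W k)"
    if "k \<in> vec_space (model_space \<theta>)" for k :: "complex \<Rightarrow> complex^2"
    unfolding W assms(10) by (rule compressed_mult_sum_space_norm[OF \<theta> \<phi> \<psi> orth \<Phi>(2) M that])
  have norm_M: "L2_norm (\<lambda>z. \<phi> z * k z $ 1 + \<psi> z * k z $ 2) = L2_norm k"
    if "k \<in> vec_space (model_space \<theta>)" for k :: "complex \<Rightarrow> complex^2"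
    by (rule orthogonal_sum_norm[OF \<phi> \<psi> model_space_subset_L2 orth that])
  \<comment> \<open>The map from \<open>k\<close> to \<open>f\<close> is onto \<open>M\<close>; by
    \<open>norm_M\<close> it matches the unit balls and by \<open>norm_T\<close> the quantities
    whose suprema are taken.\<close>
  have "op_norm M (compressed_mult M g) = op_norm (vec_space (model_space \<theta>)) W"
  proof (rule antisym)
    show "op_norm M (compressed_mult M g) \<le> op_norm (vec_space (model_space \<theta>)) W"
    proof (rule op_norm_leI)
      fix f
      assume f: "f \<in> M" "L2_norm f \<le> 1"
      then obtain s t where st: "s \<in> model_space \<theta>" "t \<in> model_space \<theta>" "f = (\<lambda>z. \<phi> z * s z + \<psi> z * t z)"
        by (auto simp: M sum_space_def mult_space_def)
      define k :: "complex \<Rightarrow> complex^2" where "k z = vector [s z, t z]" for z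
      have k: "k \<in> vec_space (model_space \<theta>)"
        using st by (auto simp: vec_space_def k_def forall_2)
      have "f = (\<lambda>z. \<phi> z * k z $ 1 + \<psi> z * k z $ 2)"
        by (simp add: st(3) k_def)
      then show "\<exists>k\<in>vec_space (model_space \<theta>). L2_norm k \<le> 1 \<and> L2_norm (compressed_mult M g f) \<le> L2_norm (W k)"
        using norm_T[OF k] norm_M[OF k] f k by (intro bexI[of _ k]) auto
    qed
    show "op_norm (vec_space (model_space \<theta>)) W \<le> op_norm M (compressed_mult M g)"
    proof (rule op_norm_leI)
      fix k :: "complex \<Rightarrow> complex^2"
      assume k: "k \<in> vec_space (model_space \<theta>)" "L2_norm k \<le> 1"
      have "(\<lambda>z. \<phi> z * k z $ 1 + \<psi> z * k z $ 2) \<in> M"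
        unfolding M sum_space_def mult_space_def using k(1) by (fastforce simp: vec_space_def)
      then show "\<exists>f\<in>M. L2_norm f \<le> 1 \<and> L2_norm (W k) \<le> L2_norm (compressed_mult M g f)"
        using norm_T[OF k(1)] norm_M[OF k(1)] k(2) by (intro bexI[of _ "\<lambda>z. \<phi> z * k z $ 1 + \<psi> z * k z $ 2"]) auto
    qed
  qed
  moreover have "op_norm (vec_space (model_space \<theta>)) W
      = op_norm (vec_space H2) (hankel (scale_matrix (\<lambda>z. cnj (\<theta> z)) \<Phi>))"
    unfolding W by (rule op_norm_truncated_eq_hankel[OF \<theta> \<Phi>(1)])
  moreover have "scale_matrix (\<lambda>z. cnj (\<theta> z)) \<Phi> \<in> mat_space Linf"
    by (intro scale_matrix_Linf Linf_cnj inner_function_Linf \<theta> mat_space_Hinf_Linf \<Phi>)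
  ultimately show ?thesis
    by (simp add: Nehari)
qed

end
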